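(* Let $0<\alpha\le 1$ and $0<d<\pi/2$, and write $\mathscr{D}=\psi^{\mathrm{DE}}(\mathscr{D}_d)$. Let $gQ$ and $\mu Q$ belong to $\mathbf{L}_{\alpha}(\mathscr{D})$, let $k(z,\cdot)Q(\cdot)\in\mathbf{L}_{\alpha}(\mathscr{D})$ for all $z\in\mathscr{D}$, and let $k(\cdot,w)Q(w)\in\mathbf{H}^{\infty}(\mathscr{D})$ for all $w\in\mathscr{D}$. Furthermore, let $\mu$, $k(t,\cdot)Q(\cdot)$ and $k(\cdot,s)Q(s)$ belong to $C([a,b])$ for all $t\in[a,b]$ and $s\in[a,b]$. Let $u$ be the solution of $$u'(t)=g(t)+\mu(t)u(t)+\int_a^t k(t,r)u(r)\,dr\quad (a\le t\le b),\qquad u(a)=u_a ,$$ and let the $n\times n$ matrix $W^{\mathrm{DE}}_n$ ($n=2N+1$) and the DE-Sinc-Nystr\"om approximate solution $u^{\mathrm{DE}}_N$ be defined with mesh size $h=\log(2dN/\alpha)/N$. Then there exists a positive integer $N_0$ such that for all $N\ge N_0$ the inverse of $(I_n-W^{\mathrm{DE}}_n)$ exists, and there exists a constant $C$ independent of $N$ such that (for all $N\ge N_0$) $$\max_{t\in[a,b]}|u(t)-u^{\mathrm{DE}}_N(t)|\le C\,\frac{\log(2dN/\alpha)}{N}\,e^{-\pi dN/\log(2dN/\alpha)} .$$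
   Context: Let $a<b$ be real numbers and $u_a$ a given initial value. Set $Q(z)=(z-a)(b-z)$ and $\mathcal{V}[u](s)=\int_a^s k(s,r)u(r)\,dr$. The initial value problem is treated in its integrated form $u(t)=u_a+\int_a^t\{g(s)+\mu(s)u(s)+\mathcal{V}[u](s)\}\,ds$, $a\le t\le b$. Functions are regarded as functions of complex variables. For $d>0$, $\mathscr{D}_d=\{\zeta\in\mathbb{C}:|\operatorname{Im}\zeta|<d\}$. The DE transformation is $\psi^{\mathrm{DE}}(x)=\frac{b-a}{2}\tanh\left(\frac{\pi}{2}\sinh x\right)+\frac{b+a}{2}$, which maps $\mathbb{R}$ onto $(a,b)$, and $\psi^{\mathrm{DE}}(\mathscr{D}_d)=\{\psi^{\mathrm{DE}}(\zeta):\zeta\in\mathscr{D}_d\}$ is regarded as an infinitely sheeted Riemann surface with global parameter $\zeta\in\mathscr{D}_d$ (a function on it is a function of $\zeta$, and points of $(a,b)$ correspond to real $\zeta$). For $\alpha>0$ and a bounded simply connected domain (or Riemann surface) $\mathscr{D}\supset(a,b)$, $\mathbf{L}_{\alpha}(\mathscr{D})$ is the family of functions $f$ analytic on $\mathscr{D}$ for which there is a constant $K$ with $|f(z)|\le K|Q(z)|^{\alpha}$ for all $z\in\mathscr{D}$. $\mathbf{H}^{\infty}(\mathscr{D})$ is the family of functions $f$ analytic on $\mathscr{D}$ with $\sup_{z\in\mathscr{D}}|f(z)|<\infty$. The scheme. Let $N$ be a positive integer, $n=2N+1$, $h>0$ the mesh size. Put $\operatorname{Si}(x)=\int_0^x\frac{\sin\tau}{\tau}\,d\tau$,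 $J(j,h)(\xi)=h\left\{\frac12+\frac1\pi\operatorname{Si}[\pi(\xi/h-j)]\right\}$, $t^{\mathrm{DE}}_j=\psi^{\mathrm{DE}}(jh)$, and $w^{\mathrm{DE}}_j(t)=(\psi^{\mathrm{DE}})'(jh)\,J(j,h)((\psi^{\mathrm{DE}})^{-1}(t))$, where $(\psi^{\mathrm{DE}})^{-1}:(a,b)\to\mathbb{R}$, extended to $t=a,b$ by continuity. Indices $i,j$ of vectors and matrices run over $-N,\dots,N$. Let $I_n$ be the identity matrix, $(I^{(-1)}_n)_{ij}=\frac12+\frac1\pi\operatorname{Si}[\pi(i-j)]$, $(K^{\mathrm{DE}}_n)_{ij}=k(t^{\mathrm{DE}}_i,t^{\mathrm{DE}}_j)$, $M^{\mathrm{DE}}_n=\operatorname{diag}[\mu(t^{\mathrm{DE}}_{-N}),\dots,\mu(t^{\mathrm{DE}}_N)]$, $D^{\mathrm{DE}}_n=\operatorname{diag}[(\psi^{\mathrm{DE}})'(-Nh),\dots,(\psi^{\mathrm{DE}})'(Nh)]$, and $$W^{\mathrm{DE}}_n=h\,I^{(-1)}_nM^{\mathrm{DE}}_nD^{\mathrm{DE}}_n+h^2\,I^{(-1)}_nD^{\mathrm{DE}}_n\,(I^{(-1)}_n\circ K^{\mathrm{DE}}_n)\,D^{\mathrm{DE}}_n ,$$ where $\circ$ is the Hadamard (entrywise) product. Let $\boldsymbol{g}^{\mathrm{DE}}_n$ be the vector with $i$th entry $u_a+\sum_{j=-N}^N g(t^{\mathrm{DE}}_j)w^{\mathrm{DE}}_j(t^{\mathrm{DE}}_i)$.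 Solve $(I_n-W^{\mathrm{DE}}_n)\boldsymbol{u}^{\mathrm{DE}}_n=\boldsymbol{g}^{\mathrm{DE}}_n$ and let $u^{\mathrm{DE}}_N(t^{\mathrm{DE}}_j)$ denote the $j$th entry of $\boldsymbol{u}^{\mathrm{DE}}_n$. Then $u^{\mathrm{DE}}_N$ is defined on $[a,b]$ by $$u^{\mathrm{DE}}_N(t)=u_a+\sum_{j=-N}^N\Big\{g(t^{\mathrm{DE}}_j)+\mu(t^{\mathrm{DE}}_j)u^{\mathrm{DE}}_N(t^{\mathrm{DE}}_j)+\sum_{m=-N}^N k(t^{\mathrm{DE}}_j,t^{\mathrm{DE}}_m)u^{\mathrm{DE}}_N(t^{\mathrm{DE}}_m)w^{\mathrm{DE}}_m(t^{\mathrm{DE}}_j)\Big\}w^{\mathrm{DE}}_j(t).$$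
   Formalization: The constant K in "k(z,·)Q(·) belongs to L_α for all z" is required to be the same for all z; if K may depend on z, there are kernels for which I_n − W_n is singular for infinitely many N. *)

theory Defs
  imports "HOL-Complex_Analysis.Complex_Analysis" "HOL-Probability.Sinc_Integral"
    "Jordan_Normal_Form.Matrix"
begin

unbundle no vec_syntax

section \<open>The DE transformation and functions on its Riemann surface\<close>

text \<open>The same formula is used on the real line and on the complex strip.\<close>

definition psiDE :: "real \<Rightarrow> real \<Rightarrow> 'a \<Rightarrow> 'a :: {banach, real_normed_field}" where
  "psiDE a b z = of_real ((b - a) / 2) * tanh (of_real (pi / 2) * sinh z) + of_real ((b + a) / 2)"

definition Q :: "real \<Rightarrow> real \<Rightarrow> 'a \<Rightarrow> 'a :: real_normed_field" where
  "Q a b z = (z - of_real a) * (of_real b - z)"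

definition strip :: "real \<Rightarrow> complex set" where
  "strip d = {\<zeta>. \<bar>Im \<zeta>\<bar> < d}"

text \<open>
  A function on the infinitely sheeted Riemann surface that is the image of the strip under
  \<^term>\<open>psiDE a b\<close> is represented as a function of the global parameter \<open>\<zeta>\<close>, an element of
  \<^term>\<open>strip d\<close>. Since the derivative of \<^term>\<open>psiDE a b\<close> has no zero in the strip for
  \<open>d < pi/2\<close>, analyticity on the surface is analyticity in \<open>\<zeta>\<close>.

  The set \<open>L_const a b d \<alpha> K\<close> consists of the members of \<open>L_space a b d \<alpha>\<close> for which \<open>K\<close> is
  an admissible constant. It serves to say that a family of functions, such as
  \<open>k(z, \<cdot>) Q(\<cdot>)\<close> for all \<open>z\<close>, lies in \<open>L_space a b d \<alpha>\<close> with one constant.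
\<close>

definition L_const :: "real \<Rightarrow> real \<Rightarrow> real \<Rightarrow> real \<Rightarrow> real \<Rightarrow> (complex \<Rightarrow> complex) set" where
  "L_const a b d \<alpha> K = {f. f analytic_on strip d \<and>
     (\<forall>\<zeta>\<in>strip d. cmod (f \<zeta>) \<le> K * cmod (Q a b (psiDE a b \<zeta>)) powr \<alpha>)}"

definition L_space :: "real \<Rightarrow> real \<Rightarrow> real \<Rightarrow> real \<Rightarrow> (complex \<Rightarrow> complex) set" where
  "L_space a b d \<alpha> = (\<Union>K. L_const a b d \<alpha> K)"

definition Hinf :: "real \<Rightarrow> (complex \<Rightarrow> complex) set" where
  "Hinf d = {f. f analytic_on strip d \<and> bounded (f ` strip d)}"

text \<open>
  The points of the open interval from \<open>a\<close> to \<open>b\<close> are the points of the surface with real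
  parameter: \<open>F\<close> is the function on the surface whose values on the interval are given by \<open>f\<close>.
\<close>

definition represents :: "real \<Rightarrow> real \<Rightarrow> (complex \<Rightarrow> complex) \<Rightarrow> (real \<Rightarrow> complex) \<Rightarrow> bool" where
  "represents a b F f \<longleftrightarrow> (\<forall>x::real. F (of_real x) = f (psiDE a b x))"

definition represents2 :: "real \<Rightarrow> real \<Rightarrow>
    (complex \<Rightarrow> complex \<Rightarrow> complex) \<Rightarrow> (real \<Rightarrow> real \<Rightarrow> complex) \<Rightarrow> bool" where
  "represents2 a b F f \<longleftrightarrow>
     (\<forall>x y::real. F (of_real x) (of_real y) = f (psiDE a b x) (psiDE a b y))"

section \<open>The initial value problem in integrated form\<close>

definition volterra :: "real \<Rightarrow> (real \<Rightarrow> real \<Rightarrow> complex) \<Rightarrow> (real \<Rightarrow> complex) \<Rightarrow> real \<Rightarrow> complex" where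
  "volterra a k u s = integral {a..s} (\<lambda>r. k s r * u r)"

text \<open>
  The functions \<open>g\<close> and \<open>k t\<close> may be unbounded at the end points; their values there do not
  affect the integrals.
\<close>

definition solves_ivp :: "real \<Rightarrow> real \<Rightarrow> complex \<Rightarrow> (real \<Rightarrow> complex) \<Rightarrow> (real \<Rightarrow> complex) \<Rightarrow>
    (real \<Rightarrow> real \<Rightarrow> complex) \<Rightarrow> (real \<Rightarrow> complex) \<Rightarrow> bool" where
  "solves_ivp a b ua g \<mu> k u \<longleftrightarrow> continuous_on {a..b} u \<and>
     (\<forall>t\<in>{a..b}. ((\<lambda>s. g s + \<mu> s * u s + volterra a k u s) has_integral (u t - ua)) {a..t})"

section \<open>The DE-Sinc-Nystroem scheme\<close>

definition J :: "int \<Rightarrow> real \<Rightarrow> real \<Rightarrow> real" where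
  "J j h \<xi> = h * (1 / 2 + 1 / pi * Si (pi * (\<xi> / h - of_int j)))"

definition tDE :: "real \<Rightarrow> real \<Rightarrow> real \<Rightarrow> int \<Rightarrow> real" where
  "tDE a b h j = psiDE a b (of_int j * h)"

definition dDE :: "real \<Rightarrow> real \<Rightarrow> real \<Rightarrow> int \<Rightarrow> real" where
  "dDE a b h j = deriv (psiDE a b) (of_int j * h)"

definition wDE_open :: "real \<Rightarrow> real \<Rightarrow> real \<Rightarrow> int \<Rightarrow> real \<Rightarrow> real" where
  "wDE_open a b h j t = dDE a b h j * J j h (inv_into UNIV (psiDE a b) t)"

text \<open>At the end points \<open>a\<close> and \<open>b\<close> the basis functions are extended by continuity.\<close>

definition wDE :: "real \<Rightarrow> real \<Rightarrow> real \<Rightarrow> int \<Rightarrow> real \<Rightarrow> real" where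
  "wDE a b h j t = (if t \<in> {a<..<b} then wDE_open a b h j t
     else Lim (at t within {a<..<b}) (wDE_open a b h j))"

text \<open>
  Vectors and matrices have size \<open>n = 2 * N + 1\<close>; the library's row and column numbers
  \<open>0, \<dots>, 2 * N\<close> stand for the indices \<open>-N, \<dots>, N\<close>.
\<close>

definition idx :: "nat \<Rightarrow> nat \<Rightarrow> int" where
  "idx N p = int p - int N"

definition pos :: "nat \<Rightarrow> int \<Rightarrow> nat" where
  "pos N i = nat (i + int N)"

definition sinc_mat :: "nat \<Rightarrow> complex mat" where
  "sinc_mat N = Matrix.mat (2 * N + 1) (2 * N + 1) (\<lambda>(p, q).
     of_real (1 / 2 + 1 / pi * Si (pi * of_int (idx N p - idx N q))))"

definition K_mat :: "real \<Rightarrow> real \<Rightarrow> (real \<Rightarrow> real \<Rightarrow> complex) \<Rightarrow> real \<Rightarrow> nat \<Rightarrow> complex mat" where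
  "K_mat a b k h N = Matrix.mat (2 * N + 1) (2 * N + 1) (\<lambda>(p, q).
     k (tDE a b h (idx N p)) (tDE a b h (idx N q)))"

definition M_mat :: "real \<Rightarrow> real \<Rightarrow> (real \<Rightarrow> complex) \<Rightarrow> real \<Rightarrow> nat \<Rightarrow> complex mat" where
  "M_mat a b \<mu> h N = mat_diag (2 * N + 1) (\<lambda>p. \<mu> (tDE a b h (idx N p)))"

definition D_mat :: "real \<Rightarrow> real \<Rightarrow> real \<Rightarrow> nat \<Rightarrow> complex mat" where
  "D_mat a b h N = mat_diag (2 * N + 1) (\<lambda>p. of_real (dDE a b h (idx N p)))"

definition hadamard :: "complex mat \<Rightarrow> complex mat \<Rightarrow> complex mat" where
  "hadamard A B = Matrix.mat (dim_row A) (dim_col A) (\<lambda>(p, q). A $$ (p, q) * B $$ (p, q))"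

definition W_mat :: "real \<Rightarrow> real \<Rightarrow> (real \<Rightarrow> complex) \<Rightarrow> (real \<Rightarrow> real \<Rightarrow> complex) \<Rightarrow>
    real \<Rightarrow> nat \<Rightarrow> complex mat" where
  "W_mat a b \<mu> k h N =
     of_real h \<cdot>\<^sub>m (sinc_mat N * M_mat a b \<mu> h N * D_mat a b h N)
     + of_real (h\<^sup>2) \<cdot>\<^sub>m (sinc_mat N * D_mat a b h N
         * hadamard (sinc_mat N) (K_mat a b k h N) * D_mat a b h N)"

definition g_vec :: "real \<Rightarrow> real \<Rightarrow> complex \<Rightarrow> (real \<Rightarrow> complex) \<Rightarrow> real \<Rightarrow> nat \<Rightarrow> complex vec" where
  "g_vec a b ua g h N = Matrix.vec (2 * N + 1) (\<lambda>p.
     ua + (\<Sum>j=-int N..int N. g (tDE a b h j) * of_real (wDE a b h j (tDE a b h (idx N p)))))"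

text \<open>The unique solution of the linear system, when \<open>I - W\<close> is invertible.\<close>

definition u_vec :: "real \<Rightarrow> real \<Rightarrow> complex \<Rightarrow> (real \<Rightarrow> complex) \<Rightarrow> (real \<Rightarrow> complex) \<Rightarrow>
    (real \<Rightarrow> real \<Rightarrow> complex) \<Rightarrow> real \<Rightarrow> nat \<Rightarrow> complex vec" where
  "u_vec a b ua g \<mu> k h N = (THE v. v \<in> carrier_vec (2 * N + 1) \<and>
     (1\<^sub>m (2 * N + 1) - W_mat a b \<mu> k h N) *\<^sub>v v = g_vec a b ua g h N)"

definition uDE :: "real \<Rightarrow> real \<Rightarrow> complex \<Rightarrow> (real \<Rightarrow> complex) \<Rightarrow> (real \<Rightarrow> complex) \<Rightarrow>
    (real \<Rightarrow> real \<Rightarrow> complex) \<Rightarrow> real \<Rightarrow> nat \<Rightarrow> real \<Rightarrow> complex" where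
  "uDE a b ua g \<mu> k h N t =
     (let c = (\<lambda>j. vec_index (u_vec a b ua g \<mu> k h N) (pos N j)) in
      ua + (\<Sum>j=-int N..int N.
        (g (tDE a b h j) + \<mu> (tDE a b h j) * c j
         + (\<Sum>m=-int N..int N. k (tDE a b h j) (tDE a b h m) * c m
              * of_real (wDE a b h m (tDE a b h j))))
        * of_real (wDE a b h j t)))"

definition hDE :: "real \<Rightarrow> real \<Rightarrow> nat \<Rightarrow> real" where
  "hDE d \<alpha> N = ln (2 * d * real N / \<alpha>) / real N"

end

theory Submission
  imports Defs "Jordan_Normal_Form.Determinant"
begin

unbundle no vec_syntax

text \<open>
  In the variable \<open>\<zeta>\<close> the equation becomes a Volterra equation on the strip whose coefficients are
  dominated by \<open>1 / (1 + (Re \<zeta>)\<^sup>2)\<close>. Integrating along horizontal half lines, Picard iteration in the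
  weighted supremum norm with weight \<open>exp (\<lambda> arctan (Re \<zeta>))\<close> is a contraction, so the solution extends
  to a bounded holomorphic function on the strip; hence every function to which the Sinc indefinite
  integration is applied in the scheme is holomorphic with double exponential decay on the real
  line. The residue theorem expresses the error of Sinc interpolation by integrals over the boundary of
  the strip, and integrating it in \<open>x\<close> gains a factor \<open>h\<close>: the quadrature error is
  \<open>O(h exp (- \<pi> d / h))\<close>.

  For stability no compactness argument is needed. The tail of the sine integral shows that the
  matrix \<open>W\<close> differs by \<open>O(sqrt h)\<close> from a strictly lower triangular discrete Volterra operator, and a
  discrete Gronwall inequality bounds the inverse uniformly in \<open>N\<close>.
\<close>

section \<open>The sine integral\<close>

text \<open>The equation gives \<open>u\<close> only as a continuous function on [a,b], but the
  quadrature error needs holomorphy of \<open>u\<close> itself; hence the detour through a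
  holomorphic solution and a uniqueness theorem. The data are controlled only after multiplication
  by Q. This suffices because the derivative of the DE map contains Q as a factor: every coefficient
  times this derivative is bounded by a multiple of |cosh| |Q|^\<alpha>. Two decay rates are kept
  apart. Off the real line decay only has to make integrals along horizontal lines uniformly
  bounded, so 1/(1+x^2) is enough; its primitive arctan is bounded, and the weighted norm is
  equivalent to the plain one. On the real line the double exponential rate controls the truncation
  at |jh| = Nh. There constants may be lost: with exp(Nh) = 2dN/\<alpha> even the weakened factor
  exp(-(pi \<alpha>/4) exp(Nh)) is exp(-pi d N/2), far below the target. In the contour error the
  full width d must appear, although nothing is known on the boundary of the strip; the contour runs
  at height d' < d, and d' tends to d at the end.\<close>

lemma tendsto_one_over_at_top: "((\<lambda>y::real. 1 / y) \<longlongrightarrow> 0) at_top"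
  using tendsto_inverse_0_at_top[OF filterlim_ident] by (simp add: inverse_eq_divide)

text \<open>Integration by parts removes the oscillation: \<open>G\<close> has derivative -cos y /
  y^2, so adding 1/y makes it nonincreasing and subtracting 1/y makes it nondecreasing. Both tend to
  pi/2, which pins \<open>G x\<close> within 1/x of pi/2; the term cos x / x costs another
  1/x.\<close>

lemma Si_tail:
  assumes "x > 0"
  shows "\<bar>Si x - pi / 2\<bar> \<le> 2 / x"
proof -
  define G where "G y = Si y + cos y / y" for y
  have D: "(G has_real_derivative (- cos y / y\<^sup>2)) (at y)" if "y > 0" for y
    unfolding G_def using that
    by (auto intro!: derivative_eq_intros DERIV_Si simp: power2_eq_square field_simps)
  have up: "G y + 1 / y \<le> G x + 1 / x" if "x \<le> y" for y
  proof (rule DERIV_nonpos_imp_nonincreasing[OF that])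
    fix z assume "x \<le> z" "z \<le> y"
    then have z: "z > 0" using assms by simp
    have "((\<lambda>y. G y + 1 / y) has_real_derivative (- cos z / z\<^sup>2 - 1 / z\<^sup>2)) (at z)"
      using z by (auto intro!: derivative_eq_intros D simp: power2_eq_square field_simps)
    moreover have "- cos z / z\<^sup>2 - 1 / z\<^sup>2 \<le> 0"
      using cos_ge_minus_one[of z] z by (simp add: field_simps)
    ultimately show "\<exists>w. ((\<lambda>y. G y + 1 / y) has_real_derivative w) (at z) \<and> w \<le> 0" by blast
  qed
  have lo: "G y - 1 / y \<ge> G x - 1 / x" if "x \<le> y" for y
  proof (rule DERIV_nonneg_imp_nondecreasing[OF that])
    fix z assume "x \<le> z" "z \<le> y"
    then have z: "z > 0" using assms by simp
    have "((\<lambda>y. G y - 1 / y) has_real_derivative (- cos z / z\<^sup>2 + 1 / z\<^sup>2)) (at z)"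
      using z by (auto intro!: derivative_eq_intros D simp: power2_eq_square field_simps)
    moreover have "- cos z / z\<^sup>2 + 1 / z\<^sup>2 \<ge> 0"
      using cos_le_one[of z] z by (simp add: field_simps)
    ultimately show "\<exists>w. ((\<lambda>y. G y - 1 / y) has_real_derivative w) (at z) \<and> 0 \<le> w" by blast
  qed
  note inv = tendsto_one_over_at_top
  have "((\<lambda>y::real. cos y / y) \<longlongrightarrow> 0) at_top"
  proof (rule Lim_null_comparison[OF _ inv])
    show "\<forall>\<^sub>F y in at_top. norm (cos y / y) \<le> 1 / (y::real)"
      using eventually_gt_at_top[of 0] by eventually_elim (simp add: divide_right_mono)
  qed
  then have lim: "(G \<longlongrightarrow> pi / 2) at_top"
    unfolding G_def using tendsto_add[OF Si_at_top] by fastforce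
  have "pi / 2 + 0 \<le> G x + 1 / x"
    by (rule tendsto_upperbound[OF tendsto_add[OF lim inv]])
      (use up in \<open>auto intro: eventually_mono[OF eventually_ge_at_top[of x]]\<close>)
  moreover have "pi / 2 - 0 \<ge> G x - 1 / x"
    by (rule tendsto_lowerbound[OF tendsto_diff[OF lim inv]])
      (use lo in \<open>auto intro: eventually_mono[OF eventually_ge_at_top[of x]]\<close>)
  moreover have "\<bar>cos x / x\<bar> \<le> 1 / x"
    using assms by (simp add: divide_right_mono)
  ultimately show ?thesis
    unfolding G_def by linarith
qed

lemma Si_minus [simp]: "Si (- x) = - Si x"
  by (cases "x \<ge> 0") (use Si_neg[of x] Si_neg[of "-x"] in auto)

text \<open>A smoothed Heaviside function: the primitive of the normalised sinc function that
  vanishes at minus infinity and tends to 1 at plus infinity.\<close>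

definition sinc_step :: "real \<Rightarrow> real" where
  "sinc_step x = 1 / 2 + 1 / pi * Si (pi * x)"

lemma J_eq_sinc_step: "J j h \<xi> = h * sinc_step (\<xi> / h - of_int j)"
  by (simp add: J_def sinc_step_def)

text \<open>For positive x the tail of the sine integral gives 2/(pi^2 x); the negative side follows
  from the symmetry \<open>sinc_step (- x) = 1 - sinc_step x\<close>. This decay is what makes the
  quadrature matrix nearly triangular.\<close>

lemma sinc_step_tail:
  assumes "x \<noteq> 0"
  shows "\<bar>sinc_step x - (if x > 0 then 1 else 0)\<bar> \<le> 1 / \<bar>x\<bar>"
proof -
  have *: "\<bar>sinc_step y - 1\<bar> \<le> 1 / y" if "y > 0" for y
  proof -
    have "sinc_step y - 1 = (Si (pi * y) - pi / 2) / pi"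
      by (simp add: sinc_step_def field_simps)
    then have "\<bar>sinc_step y - 1\<bar> = \<bar>Si (pi * y) - pi / 2\<bar> / pi"
      by (simp add: abs_divide abs_of_pos)
    also have "\<dots> \<le> 2 / (pi * y) / pi"
      using Si_tail[of "pi * y"] that by (intro divide_right_mono) auto
    also have "\<dots> = (2 / (pi * pi)) / y" by simp
    also have "\<dots> \<le> 1 / y"
    proof (rule divide_right_mono)
      have "2 * 2 \<le> pi * pi" by (intro mult_mono) (use pi_ge_two in auto)
      then show "2 / (pi * pi) \<le> 1" by simp
    qed (use that in auto)
    finally show ?thesis .
  qed
  show ?thesis
  proof (cases "x > 0")
    case False
    have "sinc_step (- x) = 1 - sinc_step x" by (simp add: sinc_step_def)
    then show ?thesis using *[of "- x"] assms False by (simp add: abs_minus_commute)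
  qed (use * in auto)
qed

lemma sinc_step_bounded: obtains B where "B \<ge> 1" "\<And>x. \<bar>sinc_step x\<bar> \<le> B"
proof -
  obtain B where B: "\<And>T. \<bar>Si T\<bar> \<le> B" using bounded_Si by blast
  have "\<bar>sinc_step x\<bar> \<le> 1 + \<bar>B\<bar>" for x
  proof -
    have "\<bar>sinc_step x\<bar> \<le> 1 / 2 + \<bar>1 / pi * Si (pi * x)\<bar>"
      unfolding sinc_step_def by linarith
    also have "\<bar>1 / pi * Si (pi * x)\<bar> \<le> 1 * \<bar>B\<bar>"
      unfolding abs_mult by (intro mult_mono) (use pi_ge_two B[of "pi * x"] in auto)
    finally show ?thesis by simp
  qed
  then show ?thesis using that[of "1 + \<bar>B\<bar>"] by auto
qed

lemma sinc_step_at_top: "(sinc_step \<longlongrightarrow> 1) at_top"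
proof -
  note inv = tendsto_one_over_at_top
  have "((\<lambda>y. sinc_step y - 1) \<longlongrightarrow> 0) at_top"
  proof (rule Lim_null_comparison[OF _ inv])
    show "\<forall>\<^sub>F y in at_top. norm (sinc_step y - 1) \<le> 1 / y"
      using eventually_gt_at_top[of 0]
    proof eventually_elim
      case (elim y)
      then show ?case using sinc_step_tail[of y] by simp
    qed
  qed
  then show ?thesis using Lim_null by blast
qed

lemma sinc_step_at_bot: "(sinc_step \<longlongrightarrow> 0) at_bot"
proof -
  have "((\<lambda>y. 1 - sinc_step y) \<longlongrightarrow> 1 - 1) at_top"
    by (intro tendsto_intros sinc_step_at_top)
  moreover have "1 - sinc_step y = sinc_step (- y)" for y by (simp add: sinc_step_def)
  ultimately show ?thesis by (simp add: filterlim_at_bot_mirror)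
qed

lemma J_at_bot:
  assumes "h > 0"
  shows "(J j h \<longlongrightarrow> 0) at_bot"
proof -
  have "filterlim (\<lambda>\<xi>. \<xi> / h - of_int j) at_bot at_bot"
    using assms by real_asymp
  then show ?thesis
    unfolding J_eq_sinc_step[abs_def]
    by (intro tendsto_mult_right_zero filterlim_compose[OF sinc_step_at_bot])
qed

lemma J_has_derivative:
  "h > 0 \<Longrightarrow> (J j h has_real_derivative sinc (pi * (x / h - of_int j))) (at x)"
  unfolding J_def[abs_def]
  by (rule derivative_eq_intros DERIV_chain2[OF DERIV_Si] refl | simp)+

text \<open>The improper integral is the monotone limit of the integrals over [x-k, x], each
  evaluated by the fundamental theorem; nonnegativity of \<open>\<phi>\<close> makes the limit
  increasing.\<close>

lemma has_integral_atMost_derivative: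
  fixes \<phi> M :: "real \<Rightarrow> real"
  assumes D: "\<And>s. (M has_real_derivative \<phi> s) (at s)" and pos: "\<And>s. 0 \<le> \<phi> s"
    and lim: "(M \<longlongrightarrow> L) at_bot"
  shows "(\<phi> has_integral (M x - L)) {..x}"
proof (rule has_integral_monotone_convergence_increasing)
  let ?f = "\<lambda>(k::nat) s. if s \<in> {x - real k..x} then \<phi> s else 0"
  show "(?f k has_integral (M x - M (x - real k))) {..x}" for k
  proof -
    have "(\<phi> has_integral (M x - M (x - real k))) {x - real k..x}"
      by (rule fundamental_theorem_of_calculus)
        (use D in \<open>auto simp flip: has_real_derivative_iff_has_vector_derivative intro: has_field_derivative_at_within\<close>)
    then show ?thesis
      by (subst has_integral_restrict) auto
  qed
  show "?f k s \<le> ?f (Suc k) s" for k s using pos by auto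
  show "(\<lambda>k. ?f k s) \<longlonglongrightarrow> \<phi> s" if "s \<in> {..x}" for s
  proof (rule tendsto_eventually)
    show "\<forall>\<^sub>F k in sequentially. ?f k s = \<phi> s"
      using eventually_ge_at_top[of "nat \<lceil>x - s\<rceil>"]
      by eventually_elim (use that in auto)
  qed
  have "filterlim (\<lambda>k. x - real k) at_bot sequentially"
    by real_asymp
  then show "(\<lambda>k. M x - M (x - real k)) \<longlonglongrightarrow> M x - L"
    by (intro tendsto_intros filterlim_compose[OF lim])
qed

text \<open>Domination by a function with a known primitive gives integrability and a bound at once.
  The primitives inserted later are multiples of arctan and of exp(l arctan), both with finite
  limits at minus infinity.\<close>

lemma improper_integral_bound:
  fixes f :: "real \<Rightarrow> 'a::euclidean_space"
  assumes "continuous_on UNIV f"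
    and "\<And>s. (M has_real_derivative \<phi> s) (at s)" and "(M \<longlongrightarrow> L) at_bot"
    and le: "\<And>s. s \<le> x \<Longrightarrow> norm (f s) \<le> \<phi> s" and pos: "\<And>s. 0 \<le> \<phi> s"
  shows "f integrable_on {..x}" and "norm (integral {..x} f) \<le> M x - L"
proof -
  have \<phi>: "(\<phi> has_integral (M x - L)) {..x}"
    using has_integral_atMost_derivative assms(2,3) pos by blast
  show f: "f integrable_on {..x}"
    by (rule measurable_bounded_by_integrable_imp_integrable[of _ _ \<phi>])
      (use \<phi> assms in \<open>auto intro!: continuous_imp_measurable_on_sets_lebesgue intro: continuous_on_subset\<close>)
  show "norm (integral {..x} f) \<le> M x - L"
    using integral_norm_bound_integral[OF f has_integral_integrable[OF \<phi>]] le integral_unique[OF \<phi>]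
    by auto
qed

lemma integral_atMost_split:
  fixes f :: "real \<Rightarrow> 'a::euclidean_space"
  assumes "f integrable_on {..X}" "f integrable_on {X..x}" "X \<le> x"
  shows "integral {..x} f = integral {..X} f + integral {X..x} f"
proof -
  have eq: "{..x} = {..X} \<union> {X..x}" using assms by auto
  have "negligible ({..X} \<inter> {X..x})"
    by (rule negligible_subset[of "{X}"]) auto
  then show ?thesis unfolding eq by (rule integral_Un[OF assms(1,2)])
qed

section \<open>Improper integrals and holomorphy\<close>

text \<open>Every point of \<open>ball z r\<close> is the centre of a disc of radius r inside
  \<open>S\<close>, so Cauchy's estimate bounds the derivative by B/r on the convex set
  \<open>ball z r\<close>.\<close>

lemma bounded_holomorphic_Lipschitz:
  assumes "f holomorphic_on S" "open S" "\<And>z. z \<in> S \<Longrightarrow> cmod (f z) \<le> B"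
    and "cball z (2 * r) \<subseteq> S" "r > 0" "w \<in> ball z r" "w' \<in> ball z r"
  shows "cmod (f w - f w') \<le> B / r * cmod (w - w')"
proof (rule field_differentiable_bound[OF convex_ball])
  fix x assume x: "x \<in> ball z r"
  have sub: "cball x r \<subseteq> S"
  proof
    fix y assume "y \<in> cball x r"
    then have "dist z y \<le> 2 * r" using x dist_triangle[of z y x] by (auto simp: dist_commute)
    then show "y \<in> S" using assms(4) by auto
  qed
  have "x \<in> S" using sub \<open>r > 0\<close> by auto
  then show "(f has_field_derivative deriv f x) (at x within ball z r)"
    using assms(1,2) holomorphic_derivI has_field_derivative_at_within by blast
  have "cmod ((deriv ^^ 1) f x) \<le> fact 1 * B / r ^ 1"
  proof (rule Cauchy_inequality)
    show "f holomorphic_on ball x r"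
      using assms(1) sub ball_subset_cball holomorphic_on_subset by blast
    show "continuous_on (cball x r) f"
      using assms(1) sub holomorphic_on_imp_continuous_on continuous_on_subset by blast
    show "cmod (f y) \<le> B" if "cmod (x - y) = r" for y
      using assms(3) sub that by (auto simp: dist_norm)
  qed (use assms in auto)
  then show "cmod (deriv f x) \<le> B / r" by simp
qed (use assms in auto)

text \<open>The difference quotients of \<open>g\<close> in the first variable are uniformly bounded, holomorphic,
  hence equi-Lipschitz functions of the second; so no theorem of Osgood or Hartogs is needed.\<close>

lemma holomorphic_on_diagonal:
  assumes "open S"
    and h1: "\<And>w. w \<in> S \<Longrightarrow> (\<lambda>z. g z w) holomorphic_on S"
    and h2: "\<And>z. z \<in> S \<Longrightarrow> g z holomorphic_on S"
    and bd: "\<And>z w. z \<in> S \<Longrightarrow> w \<in> S \<Longrightarrow> cmod (g z w) \<le> B"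
  shows "(\<lambda>z. g z z) holomorphic_on S"
proof -
  have "(\<lambda>z. g z z) field_differentiable at z" if z: "z \<in> S" for z
  proof -
    obtain e where e: "e > 0" "cball z e \<subseteq> S"
      using \<open>open S\<close> z open_contains_cball by blast
    define r where "r = e / 2"
    have r: "r > 0" "cball z (2 * r) \<subseteq> S" using e by (auto simp: r_def)
    have inS: "w \<in> S" if "w \<in> ball z r" for w
      using that r by (auto simp: subset_iff)
    define q where "q w \<omega> = (g w \<omega> - g z \<omega>) / (w - z)" for w \<omega>
    have q_bd: "cmod (q w \<omega>) \<le> B / r" if "w \<in> ball z r" "w \<noteq> z" "\<omega> \<in> S" for w \<omega>
    proof -
      have "cmod (g w \<omega> - g z \<omega>) \<le> B / r * cmod (w - z)"
        by (rule bounded_holomorphic_Lipschitz[OF h1[OF that(3)] \<open>open S\<close>, of _ z])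
          (use that r bd z in auto)
      then show ?thesis using that r(1) by (simp add: q_def norm_divide divide_simps)
    qed
    have q_lip: "cmod (q w w - q w z) \<le> B / r / r * cmod (w - z)" if "w \<in> ball z r" "w \<noteq> z" for w
    proof (rule bounded_holomorphic_Lipschitz[of _ S _ z])
      show "q w holomorphic_on S"
        unfolding q_def using that inS z by (intro holomorphic_intros h2) auto
    qed (use that r q_bd \<open>open S\<close> in auto)
    have ev: "\<forall>\<^sub>F w in at z. w \<in> ball z r \<and> w \<noteq> z"
      using r by (auto simp: eventually_at dist_commute intro!: exI[of _ r])
    have t0: "((\<lambda>w. q w w - q w z) \<longlongrightarrow> 0) (at z)"
    proof (rule Lim_null_comparison)
      show "\<forall>\<^sub>F w in at z. norm (q w w - q w z) \<le> B / r / r * cmod (w - z)"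
        using ev by eventually_elim (use q_lip in blast)
      show "((\<lambda>w. B / r / r * cmod (w - z)) \<longlongrightarrow> 0) (at z)"
        by (intro tendsto_mult_right_zero tendsto_norm_zero) (auto intro!: tendsto_eq_intros)
    qed
    obtain d1 where d1: "((\<lambda>w. q w z) \<longlongrightarrow> d1) (at z)"
      using holomorphic_on_imp_differentiable_at[OF h1[OF z] \<open>open S\<close> z]
      unfolding q_def field_differentiable_def has_field_derivative_iff by blast
    obtain d2 where d2: "((\<lambda>w. (g z w - g z z) / (w - z)) \<longlongrightarrow> d2) (at z)"
      using holomorphic_on_imp_differentiable_at[OF h2[OF z] \<open>open S\<close> z]
      unfolding field_differentiable_def has_field_derivative_iff by blast
    \<comment> \<open>The increment along the diagonal splits into a mixed term that vanishes in the
      limit and the two partial difference quotients at z.\<close>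
    have "((\<lambda>w. (g w w - g z z) / (w - z)) \<longlongrightarrow> 0 + d1 + d2) (at z)"
    proof (rule Lim_transform_eventually[OF tendsto_add[OF tendsto_add[OF t0 d1] d2]])
      show "\<forall>\<^sub>F w in at z. q w w - q w z + q w z + (g z w - g z z) / (w - z)
          = (g w w - g z z) / (w - z)"
        by (simp add: q_def flip: add_divide_distrib)
    qed
    then show ?thesis
      unfolding field_differentiable_def has_field_derivative_iff by blast
  qed
  then show ?thesis
    by (simp add: holomorphic_on_open[OF \<open>open S\<close>] flip: field_differentiable_def)
qed

text \<open>The Cauchy density is the majorant throughout: its primitive is bounded, translations
  change it only by a constant factor, and its primitive is the exponent of the weight in the
  contraction argument.\<close>

definition cauchy_maj :: "real \<Rightarrow> (real \<Rightarrow> complex) \<Rightarrow> bool" where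
  "cauchy_maj C f \<longleftrightarrow> continuous_on UNIV f \<and> (\<forall>s. cmod (f s) \<le> C / (1 + s\<^sup>2))"

lemma cauchy_majD:
  assumes "cauchy_maj C f"
  shows "continuous_on S f" and "cmod (f s) \<le> C / (1 + s\<^sup>2)"
  using assms continuous_on_subset[OF _ subset_UNIV] by (auto simp: cauchy_maj_def)

lemma cauchy_maj_nonneg: "cauchy_maj C f \<Longrightarrow> 0 \<le> C"
  using cauchy_majD(2)[of C f 0] norm_ge_zero[of "f 0"] by (simp del: norm_ge_zero)

lemma one_plus_sq_pos: "0 < 1 + (s::real)\<^sup>2"
  by (simp add: add_pos_nonneg)

lemma cauchy_maj_integrable:
  assumes "cauchy_maj C f"
  shows "f integrable_on {..x}" and "cmod (integral {..x} f) \<le> C * (arctan x + pi / 2)"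
proof -
  have 1: "((\<lambda>s. C * arctan s) has_real_derivative C / (1 + s\<^sup>2)) (at s)" for s
    by (auto intro!: derivative_eq_intros simp: divide_inverse)
  have 2: "((\<lambda>s. C * arctan s) \<longlongrightarrow> C * (- (pi / 2))) at_bot"
    by (intro tendsto_intros tendsto_arctan_at_bot)
  have 3: "0 \<le> C / (1 + s\<^sup>2)" for s
    using cauchy_maj_nonneg[OF assms] by (simp add: divide_nonneg_pos one_plus_sq_pos)
  note * = improper_integral_bound[OF cauchy_majD(1)[OF assms] 1 2 cauchy_majD(2)[OF assms] 3]
  show "f integrable_on {..x}" by (rule *(1))
  show "cmod (integral {..x} f) \<le> C * (arctan x + pi / 2)"
    using *(2)[of x] by (simp add: algebra_simps)
qed

lemma cauchy_maj_split:
  assumes "cauchy_maj C f" "X \<le> x"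
  shows "integral {..x} f = integral {..X} f + integral {X..x} f"
  by (rule integral_atMost_split[OF cauchy_maj_integrable(1)[OF assms(1)] _ assms(2)])
    (intro integrable_continuous_real cauchy_majD(1)[OF assms(1)])

lemma cauchy_maj_tendsto_0:
  assumes "cauchy_maj C f"
  shows "((\<lambda>x. integral {..x} f) \<longlongrightarrow> 0) at_bot"
proof (rule Lim_null_comparison)
  show "\<forall>\<^sub>F x in at_bot. cmod (integral {..x} f) \<le> C * (arctan x + pi / 2)"
    using cauchy_maj_integrable[OF assms] by auto
  have "((\<lambda>x. C * (arctan x + pi / 2)) \<longlongrightarrow> C * (- (pi / 2) + pi / 2)) at_bot"
    by (intro tendsto_intros tendsto_arctan_at_bot)
  then show "((\<lambda>x. C * (arctan x + pi / 2)) \<longlongrightarrow> 0) at_bot" by simp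
qed

lemma cauchy_maj_tendsto:
  assumes "cauchy_maj C f"
  shows "((\<lambda>X. integral {X..x} f) \<longlongrightarrow> integral {..x} f) at_bot"
proof -
  have "((\<lambda>X. integral {..x} f - integral {..X} f) \<longlongrightarrow> integral {..x} f - 0) at_bot"
    by (intro tendsto_intros cauchy_maj_tendsto_0[OF assms])
  moreover have "\<forall>\<^sub>F X in at_bot. integral {..x} f - integral {..X} f = integral {X..x} f"
    using eventually_le_at_bot[of x] by eventually_elim (simp add: cauchy_maj_split[OF assms])
  ultimately show ?thesis using Lim_transform_eventually by fastforce
qed

lemma cauchy_maj_has_derivative:
  assumes "cauchy_maj C f"
  shows "((\<lambda>x. integral {..x} f) has_vector_derivative f x) (at x)"
proof -
  have "((\<lambda>y. integral {x - 1..y} f) has_vector_derivative f x) (at x within {x - 1..x + 1})"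
    by (rule integral_has_vector_derivative) (auto intro: cauchy_majD(1)[OF assms])
  then have "((\<lambda>y. integral {x - 1..y} f) has_vector_derivative f x) (at x)"
    by (subst (asm) at_within_interior) auto
  then have "((\<lambda>y. integral {..x - 1} f + integral {x - 1..y} f) has_vector_derivative f x) (at x)"
    by (auto intro!: derivative_eq_intros)
  then show ?thesis
  proof (rule has_vector_derivative_transform_within_open)
    show "open {x - 1<..}" "x \<in> {x - 1<..}" by auto
    show "integral {..x - 1} f + integral {x - 1..y} f = integral {..y} f" if "y \<in> {x - 1<..}" for y
      using that cauchy_maj_split[OF assms, of "x - 1" y] by simp
  qed
qed

text \<open>The constant depends only on a bound for the shift, which gives domination uniformly for
  all points near a given one.\<close>

lemma cauchy_weight_shift:
  assumes "\<bar>t\<bar> \<le> (r::real)"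
  shows "1 / (1 + (x + t)\<^sup>2) \<le> (2 + 2 * r\<^sup>2) / (1 + x\<^sup>2)"
proof -
  \<comment> \<open>The difference of the two sides is (x + 2t)^2.\<close>
  have "x\<^sup>2 \<le> 2 * (x + t)\<^sup>2 + 2 * t\<^sup>2"
    using zero_le_power2[of "x + 2 * t"] by (simp add: power2_eq_square algebra_simps)
  moreover have "t\<^sup>2 \<le> r\<^sup>2" using assms by (simp add: abs_le_square_iff[symmetric])
  ultimately have "1 + x\<^sup>2 \<le> 1 + 2 * (x + t)\<^sup>2 + 2 * r\<^sup>2" by linarith
  also have "\<dots> \<le> (2 + 2 * r\<^sup>2) * (1 + (x + t)\<^sup>2)"
    using mult_nonneg_nonneg[of "r\<^sup>2" "(x + t)\<^sup>2"] by (simp add: algebra_simps)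
  finally show ?thesis
    using one_plus_sq_pos[of x] one_plus_sq_pos[of "x + t"] by (simp add: field_simps)
qed

text \<open>The substitution is made on [X,0], where it is a plain translation, and X is sent to
  minus infinity.\<close>

lemma cauchy_maj_shift:
  assumes "cauchy_maj C f"
  shows "cauchy_maj (C * (2 + 2 * x\<^sup>2)) (\<lambda>s. f (x + s))"
    and "integral {..0} (\<lambda>s. f (x + s)) = integral {..x} f"
proof -
  have C: "0 \<le> C" using cauchy_maj_nonneg[OF assms] .
  show maj: "cauchy_maj (C * (2 + 2 * x\<^sup>2)) (\<lambda>s. f (x + s))"
    unfolding cauchy_maj_def
  proof (intro conjI allI)
    show "continuous_on UNIV (\<lambda>s. f (x + s))"
      by (rule continuous_on_compose2[OF cauchy_majD(1)[OF assms]]) (auto intro!: continuous_intros)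
    fix s
    have "cmod (f (x + s)) \<le> C * (1 / (1 + (s + x)\<^sup>2))"
      using cauchy_majD(2)[OF assms, of "x + s"] by (simp add: add.commute)
    also have "\<dots> \<le> C * ((2 + 2 * \<bar>x\<bar>\<^sup>2) / (1 + s\<^sup>2))"
      by (intro mult_left_mono cauchy_weight_shift C) auto
    finally show "cmod (f (x + s)) \<le> C * (2 + 2 * x\<^sup>2) / (1 + s\<^sup>2)" by simp
  qed
  have "((\<lambda>X. integral {X..0} (\<lambda>s. f (x + s))) \<longlongrightarrow> integral {..0} (\<lambda>s. f (x + s))) at_bot"
    by (rule cauchy_maj_tendsto[OF maj])
  moreover have "integral {X..0} (\<lambda>s. f (x + s)) = integral {x + X..x} f" for X
    using integral_shift_real_ivl[of "x + X" x x f] by (simp add: add.commute)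
  moreover have "((\<lambda>X. integral {x + X..x} f) \<longlongrightarrow> integral {..x} f) at_bot"
    by (rule filterlim_compose[OF cauchy_maj_tendsto[OF assms]]) real_asymp
  ultimately show "integral {..0} (\<lambda>s. f (x + s)) = integral {..x} f"
    using tendsto_unique[OF trivial_limit_at_bot_linorder] by fastforce
qed

section \<open>Half-line integrals of holomorphic functions on the strip\<close>

lemma open_strip: "open (strip d)"
  unfolding strip_def by (intro open_Collect_less continuous_intros)

lemma convex_strip: "convex (strip d)"
proof -
  have "strip d = {z. Im z < d} \<inter> {z. Im z > - d}" by (auto simp: strip_def)
  then show ?thesis by (simp add: convex_halfspace_Im_lt convex_halfspace_Im_gt convex_Int)
qed

lemma strip_add_real [simp]: "z + of_real s \<in> strip d \<longleftrightarrow> z \<in> strip d"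
  by (simp add: strip_def)

lemma of_real_in_strip [simp]: "of_real x \<in> strip d \<longleftrightarrow> d > 0"
  by (simp add: strip_def)

text \<open>One constant serves all horizontal lines, so bounds for integrals along them are uniform
  in the imaginary part.\<close>

definition strip_maj :: "real \<Rightarrow> real \<Rightarrow> (complex \<Rightarrow> complex) \<Rightarrow> bool" where
  "strip_maj d C f \<longleftrightarrow> f holomorphic_on strip d \<and> (\<forall>z\<in>strip d. cmod (f z) \<le> C / (1 + (Re z)\<^sup>2))"

lemma strip_maj_shift_cauchy_maj:
  assumes "strip_maj d C f" "z \<in> strip d"
  shows "cauchy_maj (C * (2 + 2 * (Re z)\<^sup>2)) (\<lambda>s. f (z + of_real s))"
proof -
  \<comment> \<open>On the horizontal line started at the imaginary axis the majorant is exactly the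
    Cauchy density; a translation by Re z then reaches z.\<close>
  let ?w = "\<i> * of_real (Im z)"
  have "cauchy_maj C (\<lambda>s. f (?w + of_real s))"
    unfolding cauchy_maj_def
  proof (intro conjI allI)
    have w: "?w \<in> strip d" using assms by (simp add: strip_def)
    show "continuous_on UNIV (\<lambda>s. f (?w + of_real s))"
      by (rule continuous_on_compose2[of "strip d" f])
        (use assms w in \<open>auto simp: strip_maj_def intro!: continuous_intros holomorphic_on_imp_continuous_on\<close>)
    show "cmod (f (?w + of_real s)) \<le> C / (1 + s\<^sup>2)" for s
      using assms w by (auto simp: strip_maj_def dest!: bspec[of _ _ "?w + of_real s"])
  qed
  from cauchy_maj_shift(1)[OF this, of "Re z"] show ?thesis
    by (simp add: add.assoc[symmetric] add.commute[of _ "of_real (Re z)"] complex_eq[symmetric])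
qed

lemma strip_maj_nonneg:
  assumes "strip_maj d C f" "z \<in> strip d"
  shows "0 \<le> C"
  using cauchy_maj_nonneg[OF strip_maj_shift_cauchy_maj[OF assms]] one_plus_sq_pos[of "Re z"]
  by (simp add: zero_le_mult_iff)

text \<open>The parameter z enters both through the kernel and through the end point of the path.
  Parametrising the path by s <= 0 makes the domain of integration independent of z, so that
  differentiation under the integral sign is possible: each integrand is holomorphic by
  \<open>holomorphic_on_diagonal\<close>, and its difference quotients are dominated near every
  point.\<close>

theorem halfline_integral_holomorphic:
  assumes h1: "\<And>w. w \<in> strip d \<Longrightarrow> (\<lambda>z. G z w) holomorphic_on strip d"
    and h2: "\<And>z. z \<in> strip d \<Longrightarrow> strip_maj d C (G z)"
  shows "(\<lambda>z. integral {..0} (\<lambda>s. G z (z + of_real s))) holomorphic_on strip d"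
proof -
  define V where "V z = integral {..0} (\<lambda>s. G z (z + of_real s))" for z
  note C = strip_maj_nonneg[OF h2]
  have diag: "(\<lambda>z. G z (z + of_real s)) holomorphic_on strip d" for s
  proof (rule holomorphic_on_diagonal[OF open_strip, of _ "\<lambda>z w. G z (w + of_real s)" C])
    show "(\<lambda>z. G z (w + of_real s)) holomorphic_on strip d" if "w \<in> strip d" for w
      using h1 that by simp
    show "(\<lambda>w. G z (w + of_real s)) holomorphic_on strip d" if "z \<in> strip d" for z
    proof -
      have "(\<lambda>w. w + of_real s) holomorphic_on strip d" by (intro holomorphic_intros)
      moreover have "G z holomorphic_on strip d" using h2[OF that] by (simp add: strip_maj_def)
      ultimately show ?thesis
        using holomorphic_on_compose_gen[of "\<lambda>w. w + of_real s" "strip d" "G z" "strip d"]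
        by (simp add: o_def image_subset_iff)
    qed
    show "cmod (G z (w + of_real s)) \<le> C" if "z \<in> strip d" "w \<in> strip d" for z w
    proof -
      have "cmod (G z (w + of_real s)) \<le> C / (1 + (Re (w + of_real s))\<^sup>2)"
        using h2[OF that(1)] that(2) by (auto simp: strip_maj_def simp del: plus_complex.simps)
      also have "\<dots> \<le> C / 1"
        by (intro divide_left_mono C[OF that(1) that(1)]) (auto simp: one_plus_sq_pos)
      finally show ?thesis by simp
    qed
  qed
  have "V field_differentiable at z0" if z0: "z0 \<in> strip d" for z0
  proof -
    obtain e where e: "e > 0" "cball z0 e \<subseteq> strip d"
      using open_strip z0 open_contains_cball by blast
    define r where "r = e / 2"
    have r: "r > 0" "cball z0 (2 * r) \<subseteq> strip d" using e by (auto simp: r_def)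
    have inS: "w \<in> strip d" if "w \<in> ball z0 (2 * r)" for w
      using that r by (auto simp: subset_iff)
    \<comment> \<open>\<open>K\<close> pays for replacing Re z by Re z0 in the majorant when z
      varies in the disc of radius 2r.\<close>
    define K where "K = C * (2 + 2 * (2 * r)\<^sup>2)"
    define \<phi> where "\<phi> s z = G z (z + of_real s)" for s z
    have \<phi>_bd: "cmod (\<phi> s z) \<le> K / (1 + (Re z0 + s)\<^sup>2)" if "z \<in> ball z0 (2 * r)" for s z
    proof -
      have "cmod (\<phi> s z) \<le> C * (1 / (1 + (Re z0 + s + (Re z - Re z0))\<^sup>2))"
        using h2[OF inS[OF that]] inS[OF that]
        by (auto simp: strip_maj_def \<phi>_def algebra_simps dest!: bspec[of _ _ "z + of_real s"])
      also have "\<dots> \<le> C * ((2 + 2 * (2 * r)\<^sup>2) / (1 + (Re z0 + s)\<^sup>2))"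
      proof (intro mult_left_mono cauchy_weight_shift C[OF z0 z0])
        show "\<bar>Re z - Re z0\<bar> \<le> 2 * r"
          using abs_Re_le_cmod[of "z - z0"] that by (auto simp: dist_norm norm_minus_commute)
      qed
      finally show ?thesis by (simp add: K_def)
    qed
    \<comment> \<open>For each s separately, Cauchy's estimate on discs of radius r/2 turns the
      bound for \<open>\<phi> s\<close> into a Lipschitz constant. It inherits the decay in s and is
      the dominating function.\<close>
    define h where "h s = 2 * K / r * (1 / (1 + (Re z0 + s)\<^sup>2))" for s
    have \<phi>_lip: "cmod ((\<phi> s w - \<phi> s z0) / (w - z0)) \<le> h s" if "w \<in> ball z0 (r / 2)" "w \<noteq> z0" for s w
    proof -
      have "cmod (\<phi> s w - \<phi> s z0) \<le> K / (1 + (Re z0 + s)\<^sup>2) / (r / 2) * cmod (w - z0)"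
      proof (rule bounded_holomorphic_Lipschitz[of _ "ball z0 (2 * r)"])
        show "\<phi> s holomorphic_on ball z0 (2 * r)"
          unfolding \<phi>_def using diag holomorphic_on_subset inS by blast
        show "cball z0 (2 * (r / 2)) \<subseteq> ball z0 (2 * r)" using r by auto
      qed (use that r \<phi>_bd in auto)
      then have "cmod ((\<phi> s w - \<phi> s z0) / (w - z0)) \<le> K / (1 + (Re z0 + s)\<^sup>2) / (r / 2)"
        using that by (simp only: norm_divide) (simp add: pos_divide_le_eq)
      then show ?thesis by (simp add: h_def mult_ac)
    qed
    have h_int: "h integrable_on {..0}"
    proof -
      have K0: "0 \<le> K" using C[OF z0 z0] by (simp add: K_def)
      have "(h has_integral (2 * K / r * arctan (Re z0 + 0) - 2 * K / r * (- (pi / 2)))) {..0}"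
      proof (rule has_integral_atMost_derivative)
        show "((\<lambda>s. 2 * K / r * arctan (Re z0 + s)) has_real_derivative h s) (at s)" for s
          unfolding h_def by (auto intro!: derivative_eq_intros simp: divide_inverse)
        show "0 \<le> h s" for s
          using K0 r by (simp add: h_def add_nonneg_nonneg)
        have "filterlim (\<lambda>s. Re z0 + s) at_bot at_bot" by real_asymp
        then show "((\<lambda>s. 2 * K / r * arctan (Re z0 + s)) \<longlongrightarrow> 2 * K / r * (- (pi / 2))) at_bot"
          by (intro tendsto_intros filterlim_compose[OF tendsto_arctan_at_bot])
      qed
      then show ?thesis by (rule has_integral_integrable)
    qed
    have \<phi>_int: "(\<lambda>s. \<phi> s z) integrable_on {..0}" if "z \<in> strip d" for z
      unfolding \<phi>_def
      by (rule cauchy_maj_integrable(1)[OF strip_maj_shift_cauchy_maj[OF h2[OF that] that]])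
    have \<phi>_deriv: "(\<phi> s has_field_derivative deriv (\<phi> s) z0) (at z0)" for s
      using diag[of s] z0 open_strip holomorphic_derivI unfolding \<phi>_def by blast
    \<comment> \<open>Dominated convergence speaks of sequences, so the derivative is tested along
      sequences; restriction to the small disc keeps every term under the dominating
      function.\<close>
    have "((\<lambda>w. (V w - V z0) / (w - z0)) \<longlongrightarrow> integral {..0} (\<lambda>s. deriv (\<phi> s) z0))
        (at z0 within ball z0 (r / 2))"
    proof (subst tendsto_at_iff_sequentially, intro allI impI)
      fix X assume X: "\<forall>i. X i \<in> ball z0 (r / 2) - {z0}" "X \<longlonglongrightarrow> z0"
      have XS: "X i \<in> strip d" for i 
      proof (rule inS)
        have "X i \<in> ball z0 (r / 2)" using X(1) by blast
        then show "X i \<in> ball z0 (2 * r)" using r(1) by simp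
      qed
      have eq: "(V (X i) - V z0) / (X i - z0) = integral {..0} (\<lambda>s. (\<phi> s (X i) - \<phi> s z0) / (X i - z0))" for i
      proof -
        have "V (X i) - V z0 = integral {..0} (\<lambda>s. \<phi> s (X i) - \<phi> s z0)"
          unfolding V_def \<phi>_def[symmetric] by (rule integral_diff[symmetric]) (use \<phi>_int XS z0 in auto)
        then show ?thesis by (simp add: divide_inverse)
      qed
      have "(\<lambda>i. integral {..0} (\<lambda>s. (\<phi> s (X i) - \<phi> s z0) / (X i - z0)))
          \<longlonglongrightarrow> integral {..0} (\<lambda>s. deriv (\<phi> s) z0)"
      proof (rule dominated_convergence(2)[OF _ h_int])
        show "(\<lambda>s. (\<phi> s (X i) - \<phi> s z0) / (X i - z0)) integrable_on {..0}" for i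
          unfolding divide_inverse
          by (intro integrable_on_mult_left integrable_diff \<phi>_int XS z0)
        show "cmod ((\<phi> s (X i) - \<phi> s z0) / (X i - z0)) \<le> h s" for i s
          using X(1) \<phi>_lip by auto
        show "(\<lambda>i. (\<phi> s (X i) - \<phi> s z0) / (X i - z0)) \<longlonglongrightarrow> deriv (\<phi> s) z0" for s
          using \<phi>_deriv[of s] X unfolding has_field_derivative_iff tendsto_at_iff_sequentially
          by (auto simp: o_def)
      qed
      then show "((\<lambda>w. (V w - V z0) / (w - z0)) \<circ> X) \<longlonglongrightarrow> integral {..0} (\<lambda>s. deriv (\<phi> s) z0)"
        by (simp add: o_def eq)
    qed
    then have "(V has_field_derivative integral {..0} (\<lambda>s. deriv (\<phi> s) z0)) (at z0)"
      using r(1) at_within_open[of z0 "ball z0 (r / 2)"] by (simp only: has_field_derivative_iff) simp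
    then show ?thesis unfolding field_differentiable_def by blast
  qed
  then have "V holomorphic_on strip d"
    by (simp add: holomorphic_on_open[OF open_strip] flip: field_differentiable_def)
  then show ?thesis by (simp add: V_def[abs_def])
qed

section \<open>The Volterra equation on the strip\<close>

text \<open>The primitive that vanishes as Re z tends to minus infinity; in the original variable
  this is integration from the end point a.\<close>

definition halfline :: "(complex \<Rightarrow> complex) \<Rightarrow> complex \<Rightarrow> complex" where
  "halfline f z = integral {..0} (\<lambda>s. f (z + of_real s))"

lemma strip_majD:
  assumes "strip_maj d C f"
  shows "f holomorphic_on strip d"
    and "z \<in> strip d \<Longrightarrow> cmod (f z) \<le> C / (1 + (Re z)\<^sup>2)"
  using assms by (auto simp: strip_maj_def)

lemma strip_maj_add:
  "strip_maj d C f \<Longrightarrow> strip_maj d C' g \<Longrightarrow> strip_maj d (C + C') (\<lambda>z. f z + g z)"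
  unfolding strip_maj_def add_divide_distrib
  by (auto intro!: holomorphic_intros norm_triangle_le add_mono)

lemma strip_maj_mult:
  assumes "strip_maj d C f" "g holomorphic_on strip d" "\<And>z. z \<in> strip d \<Longrightarrow> cmod (g z) \<le> B"
  shows "strip_maj d (C * B) (\<lambda>z. f z * g z)"
  unfolding strip_maj_def
proof (intro conjI ballI)
  show "(\<lambda>z. f z * g z) holomorphic_on strip d"
    using assms by (auto simp: strip_maj_def intro!: holomorphic_intros)
  fix z assume z: "z \<in> strip d"
  have "cmod (f z * g z) \<le> C / (1 + (Re z)\<^sup>2) * B"
    unfolding norm_mult
    by (intro mult_mono strip_majD(2)[OF assms(1)] assms z divide_nonneg_pos strip_maj_nonneg[OF assms(1) z])
      (simp_all add: one_plus_sq_pos)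
  then show "cmod (f z * g z) \<le> C * B / (1 + (Re z)\<^sup>2)" by simp
qed

lemma strip_maj_real:
  assumes "strip_maj d C f" "d > 0"
  shows "cauchy_maj C (\<lambda>x. f (of_real x))"
  unfolding cauchy_maj_def
proof (intro conjI allI)
  show "continuous_on UNIV (\<lambda>x. f (of_real x))"
    by (rule continuous_on_compose2[OF holomorphic_on_imp_continuous_on[OF strip_majD(1)[OF assms(1)]]])
      (use assms in \<open>auto intro!: continuous_intros\<close>)
  show "cmod (f (of_real s)) \<le> C / (1 + s\<^sup>2)" for s
    using strip_majD(2)[OF assms(1), of "of_real s"] assms(2) by simp
qed

lemma halfline_integrable:
  assumes "strip_maj d C f" "z \<in> strip d"
  shows "(\<lambda>s. f (z + of_real s)) integrable_on {..0}"
  by (rule cauchy_maj_integrable(1)[OF strip_maj_shift_cauchy_maj[OF assms]])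

lemma halfline_real:
  assumes "strip_maj d C f" "d > 0"
  shows "halfline f (of_real x) = integral {..x} (\<lambda>r. f (of_real r))"
  using cauchy_maj_shift(2)[OF strip_maj_real[OF assms], of x] by (simp add: halfline_def)

text \<open>The majorant has the primitive (A/l) exp(l arctan(x + s)), since arctan has the Cauchy
  density as derivative. The division by l is the gain that makes Picard iteration contract. The
  offset x is Re z for half lines in the strip and 0 on the real line.\<close>

lemma weighted_integral_bound:
  assumes "l > 0" "A \<ge> 0" "continuous_on UNIV f"
    and le: "\<And>s. s \<le> y \<Longrightarrow> cmod (f s) \<le> A * exp (l * arctan (x + s)) / (1 + (x + s)\<^sup>2)"
  shows "cmod (integral {..y} f) \<le> A / l * exp (l * arctan (x + y))"
proof -
  have 1: "((\<lambda>s. A / l * exp (l * arctan (x + s))) has_real_derivative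
      A * exp (l * arctan (x + s)) / (1 + (x + s)\<^sup>2)) (at s)" for s
    using assms(1) by (auto intro!: derivative_eq_intros simp: divide_inverse)
  have "filterlim (\<lambda>s. x + s) at_bot at_bot" by real_asymp
  then have 2: "((\<lambda>s. A / l * exp (l * arctan (x + s))) \<longlongrightarrow> A / l * exp (l * (- (pi / 2)))) at_bot"
    by (intro tendsto_intros filterlim_compose[OF tendsto_arctan_at_bot])
  have 3: "0 \<le> A * exp (l * arctan (x + s)) / (1 + (x + s)\<^sup>2)" for s
    using assms(2) by (simp add: add_nonneg_nonneg)
  have "cmod (integral {..y} f) \<le> A / l * exp (l * arctan (x + y)) - A / l * exp (l * (- (pi / 2)))"
    by (rule improper_integral_bound(2)[OF assms(3) 1 2 le 3])
  also have "\<dots> \<le> A / l * exp (l * arctan (x + y))"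
    using assms by (simp add: divide_nonneg_pos)
  finally show ?thesis .
qed

lemma halfline_weighted_bound:
  assumes "l > 0" "A \<ge> 0" "strip_maj d C f" "z \<in> strip d"
    and "\<And>w. w \<in> strip d \<Longrightarrow> cmod (f w) \<le> A * exp (l * arctan (Re w)) / (1 + (Re w)\<^sup>2)"
  shows "cmod (halfline f z) \<le> A / l * exp (l * arctan (Re z))"
proof -
  have "cmod (integral {..0} (\<lambda>s. f (z + of_real s))) \<le> A / l * exp (l * arctan (Re z + 0))"
  proof (rule weighted_integral_bound[OF assms(1,2)])
    show "continuous_on UNIV (\<lambda>s. f (z + of_real s))"
      by (rule cauchy_majD(1)[OF strip_maj_shift_cauchy_maj[OF assms(3,4)]])
    show "cmod (f (z + of_real s)) \<le> A * exp (l * arctan (Re z + s)) / (1 + (Re z + s)\<^sup>2)" for s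
      using assms(5)[of "z + of_real s"] assms(4) by simp
  qed
  then show ?thesis by (simp add: halfline_def)
qed

text \<open>The weighted bound with l = 1 suffices: exp(arctan) lies between exp(-pi/2) and
  exp(pi/2), whose ratio is the constant exp(pi).\<close>

lemma halfline_bound:
  assumes "strip_maj d C f" "z \<in> strip d"
  shows "cmod (halfline f z) \<le> C * exp pi"
proof -
  have C: "0 \<le> C" using strip_maj_nonneg[OF assms] .
  have "cmod (halfline f z) \<le> C * exp (pi / 2) / 1 * exp (1 * arctan (Re z))"
  proof (rule halfline_weighted_bound[OF _ _ assms])
    fix w assume w: "w \<in> strip d"
    have "C * 1 / (1 + (Re w)\<^sup>2) \<le> C * (exp (pi / 2) * exp (1 * arctan (Re w))) / (1 + (Re w)\<^sup>2)"
      using arctan_lbound[of "Re w"] C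
      by (intro divide_right_mono mult_left_mono) (auto simp: add_nonneg_nonneg simp flip: exp_add)
    then show "cmod (f w) \<le> C * exp (pi / 2) * exp (1 * arctan (Re w)) / (1 + (Re w)\<^sup>2)"
      using strip_majD(2)[OF assms(1) w] by (simp add: mult.assoc)
  qed (use C in auto)
  also have "\<dots> = C * exp (pi / 2 + arctan (Re z))" by (simp add: exp_add)
  also have "\<dots> \<le> C * exp pi"
    using arctan_ubound[of "Re z"] C by (intro mult_left_mono) auto
  finally show ?thesis .
qed

text \<open>\<open>P\<close>, \<open>M\<close>, \<open>D\<close> and \<open>\<kappa> z\<close> stand
  for g, \<mu>, 1 and k(z,.), composed with the DE map and multiplied by its derivative; in
  \<open>\<kappa>\<close> this factor belongs to the second variable. The bound on
  \<open>\<kappa> z\<close> is uniform in z, and holomorphy in z for fixed w is required separately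
  because the inner integral uses the kernel with z also as end point.\<close>

locale volterra_strip =
  fixes d C :: real and ua :: complex and P M D :: "complex \<Rightarrow> complex"
    and \<kappa> :: "complex \<Rightarrow> complex \<Rightarrow> complex"
  assumes d_pos: "d > 0"
    and P: "strip_maj d C P" and M: "strip_maj d C M" and D: "strip_maj d C D"
    and \<kappa>: "\<And>z. z \<in> strip d \<Longrightarrow> strip_maj d C (\<kappa> z)"
    and \<kappa>_hol: "\<And>w. w \<in> strip d \<Longrightarrow> (\<lambda>z. \<kappa> z w) holomorphic_on strip d"
begin

lemma C_nonneg: "C \<ge> 0"
  using strip_maj_nonneg[OF P, of 0] d_pos by (simp add: strip_def)

definition bdd_hol :: "(complex \<Rightarrow> complex) \<Rightarrow> bool" where
  "bdd_hol U \<longleftrightarrow> U holomorphic_on strip d \<and> (\<exists>B. \<forall>z\<in>strip d. cmod (U z) \<le> B)"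

definition Y :: "(complex \<Rightarrow> complex) \<Rightarrow> complex \<Rightarrow> complex" where
  "Y U z = halfline (\<lambda>w. \<kappa> z w * U w) z"

definition F :: "(complex \<Rightarrow> complex) \<Rightarrow> complex \<Rightarrow> complex" where
  "F U w = P w + M w * U w + D w * Y U w"

definition T :: "(complex \<Rightarrow> complex) \<Rightarrow> complex \<Rightarrow> complex" where
  "T U z = ua + halfline (F U) z"

text \<open>Chosen so that the contraction factor (C + C^2/lam)/lam is at most 1/2: once lam >= 1,
  the numerator is at most C + C^2.\<close>

definition lam :: real where "lam = 2 * (C + C\<^sup>2) + 1"

lemma lam: "lam \<ge> 1" "(C + C * (C / lam)) / lam \<le> 1 / 2"
proof -
  show l: "lam \<ge> 1" using C_nonneg by (simp add: lam_def)
  have "C * (C / lam) \<le> C * C"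
    using l C_nonneg mult_left_mono[of 1 lam C] by (intro mult_left_mono) (auto simp: divide_simps)
  then have "2 * (C + C * (C / lam)) \<le> lam" by (simp add: lam_def power2_eq_square)
  then show "(C + C * (C / lam)) / lam \<le> 1 / 2" using l by (simp add: divide_simps)
qed

text \<open>Makes exp(lam pi/2) times the weight at least 1; this is how a plain supremum bound
  becomes a weighted one.\<close>

lemma weight_exponent_nonneg: "0 \<le> lam * (pi / 2) + lam * arctan x"
proof -
  have "0 \<le> lam * (pi / 2 + arctan x)"
    using lam(1) arctan_lbound[of x] by (intro mult_nonneg_nonneg) auto
  then show ?thesis by (simp only: distrib_left)
qed

text \<open>The constant is chosen before z, as the holomorphy theorem for half-line integrals
  requires.\<close>

lemma kernel_maj:
  assumes "bdd_hol U"
  obtains C' where "\<And>z. z \<in> strip d \<Longrightarrow> strip_maj d C' (\<lambda>w. \<kappa> z w * U w)"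
proof -
  from assms obtain B where "U holomorphic_on strip d" "\<And>z. z \<in> strip d \<Longrightarrow> cmod (U z) \<le> B"
    by (auto simp: bdd_hol_def)
  then show ?thesis using that[of "C * B"] strip_maj_mult[OF \<kappa>] by blast
qed

lemma Y_bdd_hol:
  assumes "bdd_hol U"
  shows "bdd_hol (Y U)"
proof -
  obtain C' where C': "\<And>z. z \<in> strip d \<Longrightarrow> strip_maj d C' (\<lambda>w. \<kappa> z w * U w)"
    using kernel_maj assms by blast
  have "Y U holomorphic_on strip d"
    unfolding Y_def[abs_def] halfline_def
    by (rule halfline_integral_holomorphic[OF _ C']) (intro holomorphic_intros \<kappa>_hol)
  moreover have "cmod (Y U z) \<le> C' * exp pi" if "z \<in> strip d" for z
    unfolding Y_def using halfline_bound[OF C'[OF that] that] .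
  ultimately show ?thesis by (auto simp: bdd_hol_def)
qed

lemma F_maj:
  assumes "bdd_hol U"
  obtains C' where "strip_maj d C' (F U)"
proof -
  from assms obtain B where "U holomorphic_on strip d" "\<And>z. z \<in> strip d \<Longrightarrow> cmod (U z) \<le> B"
    by (auto simp: bdd_hol_def)
  note 1 = strip_maj_mult[OF M this]
  from Y_bdd_hol[OF assms] obtain B' where
    "Y U holomorphic_on strip d" "\<And>z. z \<in> strip d \<Longrightarrow> cmod (Y U z) \<le> B'"
    by (auto simp: bdd_hol_def)
  note 2 = strip_maj_mult[OF D this]
  show ?thesis
    using that strip_maj_add[OF strip_maj_add[OF P 1] 2] unfolding F_def[abs_def] by blast
qed

lemma T_bdd_hol:
  assumes "bdd_hol U"
  shows "bdd_hol (T U)"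
proof -
  obtain C' where C': "strip_maj d C' (F U)" using F_maj assms by blast
  have "T U holomorphic_on strip d"
    unfolding T_def[abs_def] halfline_def
    by (intro holomorphic_intros halfline_integral_holomorphic[OF _ C'])
  moreover have "cmod (T U z) \<le> cmod ua + C' * exp pi" if "z \<in> strip d" for z
    unfolding T_def by (intro norm_triangle_le add_mono halfline_bound[OF C'] that order_refl)
  ultimately show ?thesis by (auto simp: bdd_hol_def)
qed

lemma Y_diff:
  assumes "bdd_hol U" "bdd_hol U'" "z \<in> strip d"
  shows "Y U z - Y U' z = halfline (\<lambda>w. \<kappa> z w * (U w - U' w)) z"
proof -
  obtain C1 C2 where "strip_maj d C1 (\<lambda>w. \<kappa> z w * U w)" "strip_maj d C2 (\<lambda>w. \<kappa> z w * U' w)"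
    using kernel_maj[OF assms(1)] kernel_maj[OF assms(2)] assms(3) by metis
  from this[THEN halfline_integrable[OF _ assms(3)]] show ?thesis
    unfolding Y_def halfline_def by (subst integral_diff[symmetric]) (auto simp: algebra_simps)
qed

lemma T_diff:
  assumes "bdd_hol U" "bdd_hol U'" "z \<in> strip d"
  shows "T U z - T U' z = halfline (\<lambda>w. F U w - F U' w) z"
proof -
  obtain C1 C2 where "strip_maj d C1 (F U)" "strip_maj d C2 (F U')"
    using F_maj[OF assms(1)] F_maj[OF assms(2)] by metis
  from this[THEN halfline_integrable[OF _ assms(3)]] show ?thesis
    unfolding T_def halfline_def by (simp add: integral_diff)
qed

lemma bdd_hol_diff: "bdd_hol U \<Longrightarrow> bdd_hol U' \<Longrightarrow> bdd_hol (\<lambda>z. U z - U' z)"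
  unfolding bdd_hol_def
  by (auto intro!: holomorphic_intros) (meson add_mono norm_triangle_ineq4 order_trans)

text \<open>Each half-line integration gains a factor 1/lam. The term with \<open>M\<close> is
  integrated once and the term with \<open>D\<close> twice, which gives C/lam + C^2/lam^2 in
  total.\<close>

lemma weighted_contraction:
  assumes "bdd_hol U" "bdd_hol U'" "\<delta> \<ge> 0"
    and le: "\<And>z. z \<in> strip d \<Longrightarrow> cmod (U z - U' z) \<le> \<delta> * exp (lam * arctan (Re z))"
    and z: "z \<in> strip d"
  shows "cmod (T U z - T U' z) \<le> \<delta> / 2 * exp (lam * arctan (Re z))"
proof -
  have l: "lam > 0" using lam(1) by simp
  obtain C' where C': "\<And>z. z \<in> strip d \<Longrightarrow> strip_maj d C' (\<lambda>w. \<kappa> z w * (U w - U' w))"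
    using kernel_maj[OF bdd_hol_diff[OF assms(1,2)]] by blast
  have *: "cmod (k * (U w - U' w)) \<le> C * \<delta> * exp (lam * arctan (Re w)) / (1 + (Re w)\<^sup>2)"
    if "w \<in> strip d" "cmod k \<le> C / (1 + (Re w)\<^sup>2)" for w k
  proof -
    have "cmod k * cmod (U w - U' w) \<le> C / (1 + (Re w)\<^sup>2) * (\<delta> * exp (lam * arctan (Re w)))"
      using that le by (intro mult_mono) (auto intro: order_trans[OF norm_ge_zero])
    then show ?thesis by (simp add: norm_mult mult_ac)
  qed
  have Yd: "cmod (Y U w - Y U' w) \<le> C * \<delta> / lam * exp (lam * arctan (Re w))" if "w \<in> strip d" for w
    unfolding Y_diff[OF assms(1,2) that]
    using that * strip_majD(2)[OF \<kappa>] C_nonneg assms(3)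
    by (intro halfline_weighted_bound[OF l _ C']) auto
  obtain C1 C2 where C12: "strip_maj d C1 (F U)" "strip_maj d C2 (F U')"
    using F_maj[OF assms(1)] F_maj[OF assms(2)] by metis
  \<comment> \<open>The difference is written as a sum with a factor -1. Only the existence of some
    majorant matters here; the quantitative bound is the weighted one below.\<close>
  have "strip_maj d (C1 + C2 * 1) (\<lambda>w. F U w + F U' w * (- 1))"
    by (intro strip_maj_add strip_maj_mult C12) auto
  then have Fd: "strip_maj d (C1 + C2) (\<lambda>w. F U w - F U' w)" by simp
  have "cmod (T U z - T U' z) \<le> (C * \<delta> + C * (C * \<delta> / lam)) / lam * exp (lam * arctan (Re z))"
    unfolding T_diff[OF assms(1,2) z]
  proof (rule halfline_weighted_bound[OF l _ Fd z])
    fix w assume w: "w \<in> strip d"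
    have "F U w - F U' w = M w * (U w - U' w) + D w * (Y U w - Y U' w)"
      by (simp add: F_def algebra_simps)
    also have "cmod \<dots> \<le> C * \<delta> * exp (lam * arctan (Re w)) / (1 + (Re w)\<^sup>2)
        + C / (1 + (Re w)\<^sup>2) * (C * \<delta> / lam * exp (lam * arctan (Re w)))"
    proof (intro norm_triangle_le add_mono * w strip_majD(2)[OF M])
      show "cmod (D w * (Y U w - Y U' w)) \<le> C / (1 + (Re w)\<^sup>2) * (C * \<delta> / lam * exp (lam * arctan (Re w)))"
        unfolding norm_mult
        by (intro mult_mono strip_majD(2)[OF D] Yd w divide_nonneg_pos C_nonneg) (simp_all add: one_plus_sq_pos)
    qed
    also have "\<dots> = (C * \<delta> + C * (C * \<delta> / lam)) * exp (lam * arctan (Re w)) / (1 + (Re w)\<^sup>2)"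
      by (simp add: algebra_simps add_divide_distrib)
    finally show "cmod (F U w - F U' w) \<le> \<dots>" .
  qed (use l C_nonneg assms(3) in auto)
  also have "(C * \<delta> + C * (C * \<delta> / lam)) / lam = \<delta> * ((C + C * (C / lam)) / lam)"
    by (simp add: algebra_simps add_divide_distrib)
  also have "\<dots> * exp (lam * arctan (Re z)) \<le> \<delta> * (1 / 2) * exp (lam * arctan (Re z))"
    by (intro mult_right_mono mult_left_mono lam(2) assms) auto
  finally show ?thesis by simp
qed

text \<open>Successive Picard iterates from 0 differ by a geometric sequence in the weighted norm.
  The weight lies between positive constants, so the series converges uniformly on the whole strip
  and the limit is holomorphic.\<close>

theorem fixed_point:
  obtains U where "bdd_hol U" "\<And>z. z \<in> strip d \<Longrightarrow> T U z = U z"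
proof -
  define u where "u n = (T ^^ n) (\<lambda>_. 0)" for n
  have u_Suc: "u (Suc n) = T (u n)" for n by (simp add: u_def)
  have u: "bdd_hol (u n)" for n
  proof (induction n)
    case 0
    show ?case by (auto simp: u_def bdd_hol_def)
  next
    case (Suc n)
    then show ?case by (simp add: u_Suc T_bdd_hol)
  qed
  obtain B where B: "\<And>z. z \<in> strip d \<Longrightarrow> cmod (u 1 z) \<le> B" using u[of 1] by (auto simp: bdd_hol_def)
  have "B \<ge> 0" using B[of 0] d_pos norm_ge_zero[of "u 1 0"] by (simp add: strip_def del: norm_ge_zero)
  \<comment> \<open>The iteration starts at 0, so the first difference is \<open>u 1\<close>,
    bounded by \<open>B\<close>; the exponential turns this into a weighted bound.\<close>
  define \<delta> where "\<delta> = B * exp (lam * (pi / 2))"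
  have \<delta>: "\<delta> \<ge> 0" using \<open>B \<ge> 0\<close> by (simp add: \<delta>_def)
  have step: "cmod (u (Suc n) z - u n z) \<le> \<delta> / 2 ^ n * exp (lam * arctan (Re z))" if "z \<in> strip d" for n z
    using that
  proof (induction n arbitrary: z)
    case 0
    have "B * 1 \<le> B * exp (lam * (pi / 2) + lam * arctan (Re z))"
      using \<open>B \<ge> 0\<close> weight_exponent_nonneg by (intro mult_left_mono) simp_all
    then show ?case using B[OF 0] by (simp add: \<delta>_def exp_add u_def)
  next
    case (Suc n)
    have "cmod (T (u (Suc n)) z - T (u n) z) \<le> \<delta> / 2 ^ n / 2 * exp (lam * arctan (Re z))"
      by (rule weighted_contraction[OF u u _ Suc.IH Suc.prems]) (use \<delta> in auto)
    then show ?case by (simp add: u_Suc[of "Suc n"] u_Suc[of n] mult_ac)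
  qed
  define K where "K = \<delta> * exp (lam * (pi / 2))"
  have K: "K \<ge> 0" using \<delta> by (simp add: K_def)
  have w_le: "exp (lam * arctan x) \<le> exp (lam * (pi / 2))" for x
    using lam(1) arctan_ubound[of x] by simp
  have stepK: "cmod (u (Suc n) z - u n z) \<le> K * (1 / 2) ^ n" if "z \<in> strip d" for n z
  proof -
    have "\<delta> / 2 ^ n * exp (lam * arctan (Re z)) \<le> \<delta> / 2 ^ n * exp (lam * (pi / 2))"
      by (intro mult_left_mono w_le) (use \<delta> in auto)
    then show ?thesis using step[OF that, of n] by (simp add: K_def power_one_over field_simps)
  qed
  define U where "U z = (\<Sum>n. u (Suc n) z - u n z)" for z
  have sK: "(\<lambda>n. K * (1 / 2) ^ n) sums (K * 2)"
    using sums_mult[OF geometric_sums[of "1 / 2 :: real"], of K] by simp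
  have tele: "(\<Sum>k<n. u (Suc k) z - u k z) = u n z" for n z
    using sum_lessThan_telescope[of "\<lambda>k. u k z" n] by (simp add: u_def)
  have sm: "summable (\<lambda>n. u (Suc n) z - u n z)" if "z \<in> strip d" for z
    by (rule summable_comparison_test[OF _ sums_summable[OF sK]]) (use stepK[OF that] in auto)
  have "uniform_limit (strip d) (\<lambda>n z. \<Sum>k<n. u (Suc k) z - u k z) U sequentially"
    unfolding U_def using stepK
    by (intro Weierstrass_m_test[OF _ sums_summable[OF sK]]) auto
  then have ul: "uniform_limit (strip d) u U sequentially" by (simp add: tele)
  have holU: "U holomorphic_on strip d"
  proof (rule holomorphic_uniform_sequence[OF open_strip])
    show "u n holomorphic_on strip d" for n using u by (auto simp: bdd_hol_def)
    fix z assume "z \<in> strip d"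
    then obtain r where "r > 0" "cball z r \<subseteq> strip d" using open_strip open_contains_cball by blast
    then show "\<exists>e>0. cball z e \<subseteq> strip d \<and> uniform_limit (cball z e) u U sequentially"
      using uniform_limit_on_subset[OF ul] by blast
  qed
  have U_le: "cmod (U z) \<le> K * 2" if "z \<in> strip d" for z
  proof -
    have "cmod (U z) \<le> (\<Sum>n. K * (1 / 2) ^ n)"
      unfolding U_def by (intro norm_suminf_le stepK[OF that] sums_summable[OF sK])
    then show ?thesis using sums_unique[OF sK] by simp
  qed
  have bU: "bdd_hol U" using holU U_le by (auto simp: bdd_hol_def)
  have "T U z = U z" if z: "z \<in> strip d" for z
  proof -
    have "T U z - U z = 0"
    proof (rule norm_le_zero_iff[THEN iffD1], rule field_le_epsilon)
      fix e :: real assume e: "e > 0"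
      \<comment> \<open>Replacing \<open>U\<close> by an iterate inside \<open>T\<close> costs at
        most e' exp(lam pi), and the next iterate differs from \<open>U\<close> by at most
        e'.\<close>
      define e' where "e' = e / (1 + exp (lam * pi))"
      have pos: "1 + exp (lam * pi) > 0" by (simp add: add_pos_pos)
      then have e': "e' > 0" using e by (simp add: e'_def)
      obtain n where n: "\<And>m w. m \<ge> n \<Longrightarrow> w \<in> strip d \<Longrightarrow> cmod (u m w - U w) < e'"
        using ul e' unfolding uniform_limit_iff eventually_sequentially dist_norm by blast
      have "cmod (T U z - T (u n) z) \<le> e' * exp (lam * (pi / 2)) / 2 * exp (lam * arctan (Re z))"
      proof (rule weighted_contraction[OF bU u _ _ z])
        fix w assume w: "w \<in> strip d"
        have "e' * 1 \<le> e' * exp (lam * (pi / 2) + lam * arctan (Re w))"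
          using e' weight_exponent_nonneg by (intro mult_left_mono) simp_all
        then show "cmod (U w - u n w) \<le> e' * exp (lam * (pi / 2)) * exp (lam * arctan (Re w))"
          using n[OF order_refl w] by (simp add: exp_add norm_minus_commute)
      qed (use e' in auto)
      also have "\<dots> \<le> e' * exp (lam * (pi / 2)) * exp (lam * (pi / 2))"
        by (intro mult_mono w_le) (use e' in auto)
      also have "\<dots> = e' * exp (lam * pi)" by (simp add: mult.assoc flip: exp_add)
      finally have 1: "cmod (T U z - T (u n) z) \<le> e' * exp (lam * pi)" .
      have "cmod (T (u n) z - U z) \<le> e'"
        using n[of "Suc n" z] z by (simp add: u_Suc less_imp_le)
      then have "cmod (T U z - U z) \<le> e' * exp (lam * pi) + e'"
        using norm_diff_triangle_le[OF 1] by blast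
      also have "\<dots> = e' * (1 + exp (lam * pi))" by (simp add: distrib_left)
      also have "\<dots> = e" using pos by (simp add: e'_def)
      finally show "cmod (T U z - U z) \<le> 0 + e" by simp
    qed
    then show ?thesis by simp
  qed
  then show ?thesis using that bU by blast
qed

end

section \<open>Change of variables\<close>

text \<open>The direction of the substitution matters: the data are a primitive
  \<open>\<Phi>\<close> on the line, and integrability of \<open>f\<close> up to the end point a,
  near which \<open>f\<close> may be unbounded, is part of the conclusion. It follows from the
  fundamental theorem with derivatives required only in the open interval, applied to
  \<open>\<Phi>\<close> composed with the inverse of \<open>p\<close>.\<close>

lemma pullback_has_integral:
  fixes p p' :: "real \<Rightarrow> real" and \<Phi> F f :: "real \<Rightarrow> 'a::real_normed_vector"
  assumes p: "\<And>x. (p has_real_derivative p' x) (at x)" and pos: "\<And>x. p' x > 0"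
    and lim: "(p \<longlongrightarrow> a) at_bot"
    and \<Phi>: "\<And>x. (\<Phi> has_vector_derivative F x) (at x)" and \<Phi>_lim: "(\<Phi> \<longlongrightarrow> L) at_bot"
    and eq: "\<And>x. F x = p' x *\<^sub>R f (p x)"
  shows "(f has_integral (\<Phi> x - L)) {a..p x}"
proof -
  define q where "q = inv_into UNIV p"
  have less: "p x < p y" if "x < y" for x y
    by (rule DERIV_pos_imp_increasing[OF that]) (use p pos in blast)
  have less_iff: "p x < p y \<longleftrightarrow> x < y" for x y
    using less[of x y] less[of y x] by (cases x y rule: linorder_cases) auto
  have "inj p" by (rule injI) (metis less less_irrefl linorder_neqE)
  then have q: "q (p y) = y" for y by (simp add: q_def)
  have a_less: "a < p y" for y
  proof -
    have "a \<le> p (y - 1)"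
    proof (rule tendsto_upperbound[OF lim])
      show "\<forall>\<^sub>F z in at_bot. p z \<le> p (y - 1)"
        using eventually_gt_at_bot[of "y - 1"] by eventually_elim (simp add: less less_imp_le)
    qed auto
    then show ?thesis using less[of "y - 1" y] by simp
  qed
  have isCont_p: "isCont p y" for y using p DERIV_isCont by blast
  have ex: "\<exists>z. t = p z" if t: "a < t" "t \<le> p y" for t y
  proof -
    obtain N where N: "\<And>z. z \<le> N \<Longrightarrow> p z < t"
      using order_tendstoD(2)[OF lim t(1)] by (auto simp: eventually_at_bot_linorder)
    then have "min N y \<le> y" "p (min N y) \<le> t" by (auto intro: less_imp_le)
    then show ?thesis using IVT[of p "min N y" t y] isCont_p t(2) by auto
  qed
  have q_deriv: "(q has_real_derivative 1 / p' y) (at (p y))" for y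
  proof -
    have "isCont q (p y)"
      by (rule isCont_inverse_function2[of "y - 1" _ "y + 1"]) (auto simp: q isCont_p)
    then have "(q has_real_derivative inverse (p' y)) (at (p y))"
    proof (rule DERIV_inverse_function[of p "p' y" q "p y" "p (y - 1)" "p (y + 1)", rotated 5])
      show "DERIV p (q (p y)) :> p' y" using p q by simp
      show "p' y \<noteq> 0" using pos[of y] by simp
      show "p (q t) = t" if t: "p (y - 1) < t" "t < p (y + 1)" for t
      proof -
        have "\<exists>z. t = p z" using ex[of t "y + 1"] a_less[of "y - 1"] t by auto
        then show ?thesis by (auto simp: q)
      qed
    qed (simp_all add: less)
    then show ?thesis by (simp add: divide_inverse)
  qed
  \<comment> \<open>The value \<open>L\<close> at a makes the composed primitive continuous at the
    end point, which is not a value of \<open>p\<close>.\<close>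
  define \<phi> where "\<phi> t = (if t \<le> a then L else \<Phi> (q t))" for t
  have \<phi>_deriv: "(\<phi> has_vector_derivative f (p y)) (at (p y))" for y
  proof -
    have "(\<Phi> \<circ> q has_vector_derivative (1 / p' y) *\<^sub>R F y) (at (p y))"
      by (rule vector_diff_chain_at)
        (use q_deriv \<Phi> in \<open>simp_all add: q has_real_derivative_iff_has_vector_derivative\<close>)
    moreover have "(1 / p' y) *\<^sub>R F y = f (p y)" using pos[of y] by (simp add: eq)
    ultimately have "(\<Phi> \<circ> q has_vector_derivative f (p y)) (at (p y))" by simp
    then show ?thesis
      by (rule has_vector_derivative_transform_within_open[of _ _ _ "{a<..}"])
        (use a_less in \<open>auto simp: \<phi>_def\<close>)
  qed
  have "(f has_integral (\<phi> (p x) - \<phi> a)) {a..p x}"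
  proof (rule fundamental_theorem_of_calculus_interior)
    show "a \<le> p x" using a_less[of x] by simp
    show "(\<phi> has_vector_derivative f t) (at t)" if "t \<in> {a<..<p x}" for t
    proof -
      obtain z where "t = p z" using ex[of t x] \<open>t \<in> {a<..<p x}\<close> by auto
      then show ?thesis using \<phi>_deriv by simp
    qed
    show "continuous_on {a..p x} \<phi>"
    proof (unfold continuous_on_eq_continuous_within, intro ballI)
      fix t assume t: "t \<in> {a..p x}"
      show "continuous (at t within {a..p x}) \<phi>"
      proof (cases "t = a")
        case False
        then obtain z where "t = p z" using ex[of t x] t by auto
        then show ?thesis
          using \<phi>_deriv[of z] has_vector_derivative_continuous continuous_at_imp_continuous_at_within
          by blast
      next
        case True
        have "(\<phi> \<longlongrightarrow> \<phi> a) (at a within {a..p x})"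
        proof (rule tendstoI)
          fix e :: real assume "e > 0"
          then obtain N where N: "\<And>y. y \<le> N \<Longrightarrow> dist (\<Phi> y) L < e"
            using tendstoD[OF \<Phi>_lim] by (auto simp: eventually_at_bot_linorder)
          show "\<forall>\<^sub>F t in at a within {a..p x}. dist (\<phi> t) (\<phi> a) < e"
            unfolding eventually_at
          proof (intro exI[of _ "p N - a"] conjI ballI impI)
            show "0 < p N - a" using a_less[of N] by simp
            fix t assume t: "t \<in> {a..p x}" "t \<noteq> a \<and> dist t a < p N - a"
            then obtain z where z: "t = p z" using ex[of t x] by auto
            have "p z < p N" using t z by (auto simp: dist_real_def)
            then have "z < N" by (simp add: less_iff)
            then show "dist (\<phi> t) (\<phi> a) < e"
              using N[of z] a_less[of z] by (simp add: \<phi>_def z q)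
          qed
        qed
        then show ?thesis using True by (simp add: continuous_within)
      qed
    qed
  qed
  then show "(f has_integral (\<Phi> x - L)) {a..p x}"
    using a_less[of x] by (simp add: \<phi>_def q)
qed

section \<open>The DE transformation\<close>

lemma sinh_complex_of_real: "sinh (complex_of_real x) = complex_of_real (sinh x)"
  and cosh_complex_of_real: "cosh (complex_of_real x) = complex_of_real (cosh x)"
  by (simp_all add: sinh_field_def cosh_field_def exp_of_real flip: of_real_minus)

text \<open>The derivative of the DE map, written so that \<open>Q\<close> appears as a factor: if f
  is controlled only after multiplication by Q, then f times this derivative is a constant times
  cosh times the controlled product.\<close>

definition dpsi :: "real \<Rightarrow> real \<Rightarrow> 'a \<Rightarrow> 'a :: {banach, real_normed_field}" where
  "dpsi a b z = of_real (pi / (b - a)) * cosh z * Q a b (psiDE a b z)"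

lemma psiDE_complex_of_real: "psiDE a b (complex_of_real x) = of_real (psiDE a b x)"
  by (simp only: psiDE_def tanh_def sinh_complex_of_real cosh_complex_of_real id_apply
      of_real_mult[symmetric] of_real_divide[symmetric] of_real_add[symmetric] of_real_eq_id)

lemma Q_complex_of_real: "Q a b (complex_of_real t) = of_real (Q a b t)"
  by (simp add: Q_def)

lemma dpsi_complex_of_real: "dpsi a b (complex_of_real x) = of_real (dpsi a b x)"
  by (simp add: dpsi_def psiDE_complex_of_real Q_complex_of_real cosh_complex_of_real)

lemma one_minus_tanh_sq:
  fixes w :: "'a :: {banach, real_normed_field}"
  assumes "cosh w \<noteq> 0"
  shows "1 - (tanh w)\<^sup>2 = 1 / (cosh w)\<^sup>2"
proof -
  have "1 - (tanh w)\<^sup>2 = ((cosh w)\<^sup>2 - (sinh w)\<^sup>2) / (cosh w)\<^sup>2"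
    using assms by (simp add: tanh_def power_divide diff_divide_distrib)
  then show ?thesis by (simp add: cosh_square_eq)
qed

text \<open>With k = (b-a)/2 the two factors of \<open>Q\<close> are k (1 + tanh) and k (1 - tanh),
  and 1 - tanh^2 = 1/cosh^2.\<close>

lemma Q_psiDE:
  fixes z :: "'a :: {banach, real_normed_field}"
  assumes "cosh (of_real (pi / 2) * sinh z) \<noteq> 0"
  shows "Q a b (psiDE a b z) = (of_real ((b - a) / 2) / cosh (of_real (pi / 2) * sinh z))\<^sup>2"
proof -
  define c where "c = cosh (of_real (pi / 2) * sinh z)"
  define s where "s = sinh (of_real (pi / 2) * sinh z)"
  define k :: 'a where "k = of_real ((b - a) / 2)"
  have "c \<noteq> 0" using assms by (simp add: c_def)
  have k2: "of_real b = of_real a + 2 * k"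
  proof -
    have "b = a + 2 * ((b - a) / 2)" by (simp add: field_simps)
    from arg_cong[OF this, of "of_real :: real \<Rightarrow> 'a"] show ?thesis
      by (simp only: of_real_add of_real_mult of_real_numeral k_def)
  qed
  have psi: "psiDE a b z = k * (s / c) + k + of_real a"
  proof -
    have "(b + a) / 2 = (b - a) / 2 + a" by (simp add: field_simps)
    from arg_cong[OF this, of "of_real :: real \<Rightarrow> 'a"] have "of_real ((b + a) / 2) = k + of_real a"
      by (simp only: of_real_add k_def)
    then show ?thesis unfolding psiDE_def tanh_def c_def s_def k_def by (simp only: add.assoc)
  qed
  have "Q a b (psiDE a b z) = k\<^sup>2 * (1 - (s / c)\<^sup>2)"
    unfolding Q_def psi k2 by (simp add: power2_eq_square algebra_simps)
  also have "1 - (s / c)\<^sup>2 = 1 / c\<^sup>2"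
    using one_minus_tanh_sq[OF assms] by (simp add: tanh_def c_def s_def)
  finally show ?thesis by (simp add: c_def k_def power_divide)
qed

lemma psiDE_has_derivative:
  fixes z :: "'a :: {banach, real_normed_field}"
  assumes "a < b" "cosh (of_real (pi / 2) * sinh z) \<noteq> 0"
  shows "(psiDE a b has_field_derivative dpsi a b z) (at z)"
proof -
  let ?c = "cosh (of_real (pi / 2) * sinh z)" and ?s = "sinh (of_real (pi / 2) * sinh z)"
  have "1 - tanh (of_real (pi / 2) * sinh z) ^ 2 = 1 / ?c\<^sup>2"
    by (rule one_minus_tanh_sq[OF assms(2)])
  moreover have "(psiDE a b has_field_derivative of_real ((b - a) / 2) *
      ((1 - tanh (of_real (pi / 2) * sinh z) ^ 2) * (of_real (pi / 2) * cosh z))) (at z)"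
    unfolding psiDE_def[abs_def] using assms(2) by (auto intro!: derivative_eq_intros)
  moreover have "of_real ((b - a) / 2) * (1 / ?c\<^sup>2 * (of_real (pi / 2) * cosh z)) = dpsi a b z"
  proof -
    have ne: "of_real b - of_real a \<noteq> (0 :: 'a)" using assms(1) by (simp flip: of_real_diff)
    show ?thesis
      unfolding dpsi_def Q_psiDE[OF assms(2)] using assms(2) ne
      by (simp add: power2_eq_square divide_simps)
  qed
  ultimately show ?thesis by simp
qed

lemma psiDE_real_has_derivative:
  "a < b \<Longrightarrow> (psiDE a b has_real_derivative dpsi a b x) (at x)"
  by (rule psiDE_has_derivative) simp_all

lemma dpsi_pos: "a < b \<Longrightarrow> dpsi a b (x :: real) > 0"
  unfolding dpsi_def by (subst Q_psiDE) (auto intro!: mult_pos_pos divide_pos_pos)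

lemma psiDE_strict_mono:
  fixes x y :: real
  assumes "a < b" "x < y"
  shows "psiDE a b x < psiDE a b y"
  by (rule DERIV_pos_imp_increasing[OF assms(2)])
    (use psiDE_real_has_derivative[OF assms(1)] dpsi_pos[OF assms(1)] in blast)

lemma psiDE_at_bot: "(psiDE a b \<longlongrightarrow> (a :: real)) at_bot"
proof -
  have "filterlim (\<lambda>x::real. pi / 2 * sinh x) at_bot at_bot"
    using filterlim_tendsto_pos_mult_at_bot[OF tendsto_const _ sinh_real_at_bot, of "pi / 2"] by simp
  then have "((\<lambda>x::real. (b - a) / 2 * tanh (pi / 2 * sinh x) + (b + a) / 2) \<longlongrightarrow>
      (b - a) / 2 * (- 1) + (b + a) / 2) at_bot"
    by (intro tendsto_intros filterlim_compose[OF tanh_real_at_bot])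
  then show ?thesis by (simp add: psiDE_def[abs_def] field_simps)
qed

lemma psiDE_at_top: "(psiDE a b \<longlongrightarrow> (b :: real)) at_top"
proof -
  have "filterlim (\<lambda>x::real. pi / 2 * sinh x) at_top at_top"
    using filterlim_tendsto_pos_mult_at_top[OF tendsto_const _ sinh_real_at_top, of "pi / 2"] by simp
  then have "((\<lambda>x::real. (b - a) / 2 * tanh (pi / 2 * sinh x) + (b + a) / 2) \<longlongrightarrow>
      (b - a) / 2 * 1 + (b + a) / 2) at_top"
    by (intro tendsto_intros filterlim_compose[OF tanh_real_at_top])
  then show ?thesis by (simp add: psiDE_def[abs_def] field_simps)
qed

section \<open>Decay of the transformed coefficients\<close>

lemma Re_sinh: "Re (sinh z) = sinh (Re z) * cos (Im z)"
  and Im_sinh: "Im (sinh z) = cosh (Re z) * sin (Im z)"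
proof -
  have "sinh z = sinh (of_real (Re z)) * cosh (\<i> * of_real (Im z))
      + cosh (of_real (Re z)) * sinh (\<i> * of_real (Im z))"
    unfolding sinh_add[symmetric] by (simp flip: complex_eq)
  moreover have "cosh (\<i> * of_real y) = of_real (cos y)" "sinh (\<i> * of_real y) = \<i> * of_real (sin y)"
    for y :: real
    by (simp_all add: cosh_conv_cos sinh_conv_sin cos_of_real sin_of_real flip: mult.assoc)
  ultimately have "sinh z = of_real (sinh (Re z) * cos (Im z)) + \<i> * of_real (cosh (Re z) * sin (Im z))"
    by (simp add: sinh_complex_of_real cosh_complex_of_real)
  then show "Re (sinh z) = sinh (Re z) * cos (Im z)" "Im (sinh z) = cosh (Re z) * sin (Im z)"
    by simp_all
qed

lemma cmod_cosh_ge: "cmod (cosh w) \<ge> \<bar>sinh (Re w)\<bar>"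
proof -
  have "\<bar>exp (Re w) - exp (- Re w)\<bar> \<le> cmod (exp w + exp (- w))"
    using norm_triangle_ineq3[of "exp w" "- exp (- w)"] by simp
  then show ?thesis
    by (simp add: cosh_field_def sinh_field_def norm_divide)
qed

lemma cmod_cosh_le: "cmod (cosh z) \<le> cosh (Re z)"
proof -
  have "cmod (exp z + exp (- z)) \<le> exp (Re z) + exp (- Re z)"
    using norm_triangle_ineq[of "exp z" "exp (- z)"] by simp
  then show ?thesis
    by (simp add: cosh_field_def norm_divide)
qed

text \<open>A zero forces the real part of sinh z, hence Re z, to vanish, because cos(Im z) > 0. On
  the imaginary axis the argument is i (pi/2) sin(Im z) with |sin(Im z)| < 1, so cosh becomes the
  cosine of a number strictly between -pi/2 and pi/2.\<close>

lemma cosh_DE_nonzero: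
  assumes "\<bar>Im z\<bar> < pi / 2"
  shows "cosh (of_real (pi / 2) * sinh z) \<noteq> 0"
proof
  let ?w = "of_real (pi / 2) * sinh z"
  assume 0: "cosh ?w = 0"
  have "cos (Im z) > 0" using assms by (intro cos_gt_zero_pi) auto
  moreover have "sinh (Re ?w) = 0" using cmod_cosh_ge[of ?w] 0 by simp
  ultimately have "Re z = 0" by (simp add: Re_sinh)
  then have "?w = \<i> * of_real (pi / 2 * sin (Im z))"
    by (simp add: complex_eq_iff Re_sinh Im_sinh)
  then have "cosh ?w = of_real (cos (pi / 2 * sin (Im z)))"
    by (simp only: cosh_conv_cos cos_of_real flip: mult.assoc) (simp flip: cos_of_real)
  then have "cos (pi / 2 * sin (Im z)) = 0" using 0 by simp
  moreover have "\<bar>sin (Im z)\<bar> < 1"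
  proof -
    have "(sin (Im z))\<^sup>2 < 1"
      using \<open>cos (Im z) > 0\<close> sin_squared_eq[of "Im z"] by simp
    then show ?thesis by (simp add: abs_square_less_1)
  qed
  then have "cos (pi / 2 * sin (Im z)) > 0"
    using mult_strict_left_mono[of "-1" "sin (Im z)" pi] mult_strict_left_mono[of "sin (Im z)" 1 pi]
    by (intro cos_gt_zero_pi) (auto simp: abs_less_iff)
  ultimately show False by simp
qed

lemma exp_quarter_le_sinh: "1 \<le> p \<Longrightarrow> exp p / 4 \<le> sinh (p :: real)"
proof -
  assume p: "1 \<le> p"
  have "2 \<le> exp p" using exp_ge_add_one_self[of p] p by linarith
  then have "exp p / 4 \<le> (exp p - 1) / 2" by simp
  also have "\<dots> \<le> (exp p - exp (- p)) / 2"
    using p by (intro divide_right_mono diff_left_mono) auto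
  finally show "exp p / 4 \<le> sinh p" by (simp add: sinh_field_def)
qed

text \<open>Far out, |Re sinh z| >= cos d sinh|Re z| gives the growth; on the remaining closed
  rectangle the function is continuous without zeros and has a positive minimum. The closed
  rectangle is admissible because d < pi/2 is strict.\<close>

lemma cosh_DE_lower_bound:
  assumes "0 < d" "d < pi / 2"
  obtains c where "c > 0"
    "\<And>z. z \<in> strip d \<Longrightarrow> c * exp (pi / 2 * cos d * sinh \<bar>Re z\<bar>) \<le> cmod (cosh (of_real (pi / 2) * sinh z))"
proof -
  define p where "p x = pi / 2 * cos d * sinh \<bar>x\<bar>" for x :: real
  have cd: "cos d > 0" using assms by (intro cos_gt_zero_pi) auto
  \<comment> \<open>The abscissa at which the exponent \<open>p\<close> reaches 1.\<close>
  define X where "X = arsinh (1 / (pi / 2 * cos d))"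
  define S where "S = cbox (Complex (- X) (- d)) (Complex X d)"
  let ?f = "\<lambda>z. cmod (cosh (of_real (pi / 2) * sinh z))"
  have "X > 0" using cd by (simp add: X_def)
  then have "0 \<in> S" using assms by (simp add: S_def in_cbox_complex_iff)
  then have "S \<noteq> {}" by blast
  have "continuous_on S ?f" by (intro continuous_intros)
  then obtain m where m: "m \<in> S" "\<And>z. z \<in> S \<Longrightarrow> ?f m \<le> ?f z"
    using continuous_attains_inf[of S ?f] compact_cbox \<open>S \<noteq> {}\<close> by (auto simp: S_def)
  have fm: "?f m > 0"
  proof -
    have "\<bar>Im m\<bar> < pi / 2" using m(1) assms by (auto simp: S_def in_cbox_complex_iff abs_less_iff)
    then show ?thesis using cosh_DE_nonzero[of m] by simp
  qed
  \<comment> \<open>1/4 comes from sinh p >= exp(p)/4 for p >= 1; the factor 1/e compensates exp(p)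
    < e in the rectangle.\<close>
  define c where "c = min (1 / 4) (?f m / exp 1)"
  show ?thesis
  proof (rule that[of c])
    show "c > 0" using fm by (simp add: c_def)
    fix z assume z: "z \<in> strip d"
    then have y: "\<bar>Im z\<bar> < d" by (simp add: strip_def)
    have "c * exp (p (Re z)) \<le> ?f z"
    proof (cases "p (Re z) \<ge> 1")
      case True
      have "cos d \<le> cos (Im z)"
        using cos_monotone_0_pi_le[of "\<bar>Im z\<bar>" d] y assms by simp
      then have "p (Re z) \<le> \<bar>pi / 2 * (sinh (Re z) * cos (Im z))\<bar>"
        using cd by (auto simp: p_def abs_mult mult_ac intro!: mult_left_mono mult_right_mono)
      then have le: "p (Re z) \<le> \<bar>Re (of_real (pi / 2) * sinh z)\<bar>" by (simp add: Re_sinh)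
      have "c * exp (p (Re z)) \<le> exp (p (Re z)) / 4"
        by (simp add: c_def min_def)
      also have "\<dots> \<le> sinh (p (Re z))" by (rule exp_quarter_le_sinh[OF True])
      also have "\<dots> \<le> sinh \<bar>Re (of_real (pi / 2) * sinh z)\<bar>" using le by simp
      also have "\<dots> \<le> ?f z" using cmod_cosh_ge[of "of_real (pi / 2) * sinh z"] by (simp only: sinh_real_abs)
      finally show ?thesis .
    next
      case False
      then have "sinh \<bar>Re z\<bar> < 1 / (pi / 2 * cos d)"
        using cd by (simp add: p_def field_simps)
      also have "\<dots> = sinh X" by (simp add: X_def)
      finally have "\<bar>Re z\<bar> < X" by (simp only: sinh_real_less_iff)
      then have "z \<in> S" using y by (auto simp: S_def in_cbox_complex_iff)
      have "c * exp (p (Re z)) \<le> ?f m / exp 1 * exp 1"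
        using False fm by (intro mult_mono) (auto simp: c_def)
      also have "\<dots> = ?f m" by simp
      also have "\<dots> \<le> ?f z" using m(2) \<open>z \<in> S\<close> by blast
      finally show ?thesis .
    qed
    then show "c * exp (pi / 2 * cos d * sinh \<bar>Re z\<bar>) \<le> ?f z" by (simp add: p_def)
  qed
qed

text \<open>Half of the true exponent (s/2) exp|x| of exp(-s sinh|x|) is given up; in return a
  factor cosh x is absorbed and exp(-|x|) is gained, which bounds sums over the nodes
  uniformly.\<close>

definition de_weight :: "real \<Rightarrow> real \<Rightarrow> real" where
  "de_weight s x = exp (- \<bar>x\<bar>) * exp (- s / 4 * exp \<bar>x\<bar>)"

lemma cosh_double_exp_bound:
  assumes "s > 0"
  obtains C where "C > 0" "\<And>x. cosh x * exp (- s * sinh \<bar>x\<bar>) \<le> C * de_weight s x"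
proof (rule that[of "32 / s\<^sup>2 * exp (s / 2)"])
  show "32 / s\<^sup>2 * exp (s / 2) > 0" using assms by simp
  fix x :: real
  define E where "E = exp \<bar>x\<bar>"
  have E: "E \<ge> 1" by (simp add: E_def)
  have c: "cosh x \<le> E"
  proof -
    have "exp x \<le> E" "exp (- x) \<le> E" by (simp_all add: E_def)
    then show ?thesis by (simp add: cosh_field_def)
  qed
  have sh: "sinh \<bar>x\<bar> \<ge> E / 2 - 1 / 2"
  proof -
    have "exp (- \<bar>x\<bar>) \<le> 1" by simp
    then show ?thesis unfolding sinh_field_def E_def by (simp add: field_simps)
  qed
  have "0 \<le> s * E / 4" using assms E by simp
  \<comment> \<open>One factor E absorbs cosh x, the other becomes exp(-|x|); both are paid for by
    exp(s E/4). The constant 32 is 2 times 4^2.\<close>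
  then have "(s * E / 4)\<^sup>2 / 2 \<le> exp (s * E / 4)"
    using exp_lower_Taylor_quadratic[of "s * E / 4"] by linarith
  then have q: "E\<^sup>2 \<le> 32 / s\<^sup>2 * exp (s * E / 4)"
    using assms by (simp add: power_mult_distrib power_divide field_simps)
  have "cosh x * exp (- s * sinh \<bar>x\<bar>) \<le> E * exp (s / 2 - s * E / 2)"
  proof (intro mult_mono c)
    have "s * (E / 2 - 1 / 2) \<le> s * sinh \<bar>x\<bar>" using sh assms by (intro mult_left_mono) auto
    then show "exp (- s * sinh \<bar>x\<bar>) \<le> exp (s / 2 - s * E / 2)" by (simp add: algebra_simps)
  qed (use E in auto)
  also have "\<dots> = E\<^sup>2 * (exp (- \<bar>x\<bar>) * exp (s / 2 - s * E / 2))"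
    by (simp add: E_def power2_eq_square exp_minus)
  also have "\<dots> \<le> (32 / s\<^sup>2 * exp (s * E / 4)) * (exp (- \<bar>x\<bar>) * exp (s / 2 - s * E / 2))"
    by (intro mult_right_mono q) auto
  also have "\<dots> = 32 / s\<^sup>2 * exp (- \<bar>x\<bar>) * exp (s / 2 - s * E / 4)"
    by (simp add: mult_ac flip: exp_add)
  also have "\<dots> = 32 / s\<^sup>2 * exp (s / 2) * de_weight s x"
    by (simp add: de_weight_def E_def mult_ac flip: exp_add)
  finally show "cosh x * exp (- s * sinh \<bar>x\<bar>) \<le> 32 / s\<^sup>2 * exp (s / 2) * de_weight s x" .
qed

lemma exp_minus_abs_le: "exp (- \<bar>x :: real\<bar>) \<le> 2 / (1 + x\<^sup>2)"
proof -
  have "1 + x\<^sup>2 \<le> 2 * exp \<bar>x\<bar>"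
    using exp_lower_Taylor_quadratic[of "\<bar>x\<bar>"] by simp
  then show ?thesis using one_plus_sq_pos[of x] by (simp add: exp_minus field_simps)
qed

lemma de_weight_le: "s \<ge> 0 \<Longrightarrow> de_weight s x \<le> exp (- \<bar>x\<bar>)"
  unfolding de_weight_def by (simp add: mult_le_cancel_left1)

text \<open>Since |Q|^\<alpha> is a constant times a negative power of |cosh(pi/2 sinh z)|, lower
  bounds for that cosh give the decay. In the strip the exponent carries the factor cos d, and only
  1/(1+x^2) is kept of it; on the real line the full rate pi \<alpha> is recorded.\<close>

lemma DE_decay:
  assumes "a < b" "0 < \<alpha>" "0 < d" "d < pi / 2"
  obtains c where "c > 0"
    "\<And>z. z \<in> strip d \<Longrightarrow> cmod (cosh z) * cmod (Q a b (psiDE a b z)) powr \<alpha> \<le> c / (1 + (Re z)\<^sup>2)"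
    "\<And>x. cmod (cosh (of_real x)) * cmod (Q a b (psiDE a b (complex_of_real x))) powr \<alpha>
        \<le> c * de_weight (pi * \<alpha>) x"
proof -
  define k where "k = (b - a) / 2"
  have k: "k > 0" using assms by (simp add: k_def)
  have cd: "cos d > 0" using assms by (intro cos_gt_zero_pi) auto
  have Q: "cmod (Q a b (psiDE a b z)) powr \<alpha> \<le> (k / m) powr (2 * \<alpha>) * exp (- (2 * \<alpha> * r))"
    if "m > 0" "m * exp r \<le> cmod (cosh (of_real (pi / 2) * sinh z))" for m r and z :: complex
  proof -
    let ?c = "cosh (of_real (pi / 2) * sinh z)"
    have pos: "cmod ?c > 0" using that by (meson exp_gt_zero less_le_trans mult_pos_pos)
    then have ne: "?c \<noteq> 0" by auto
    have "cmod (Q a b (psiDE a b z)) = (k / cmod ?c)\<^sup>2"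
      unfolding Q_psiDE[OF ne] k_def[symmetric] using k by (simp add: norm_power norm_divide del: of_real_divide)
    also have "\<dots> \<le> (k / (m * exp r))\<^sup>2"
      using that pos k by (intro power_mono divide_left_mono) auto
    also have "\<dots> = (k / m * exp (- r)) powr 2"
    proof -
      have "k / (m * exp r) = k / m * exp (- r)" by (simp add: exp_minus divide_inverse)
      moreover have "0 < k / m * exp (- r)" using that k by simp
      ultimately show ?thesis by simp
    qed
    finally have "cmod (Q a b (psiDE a b z)) powr \<alpha> \<le> ((k / m * exp (- r)) powr 2) powr \<alpha>"
      using assms by (intro powr_mono2) auto
    also have "\<dots> = (k / m) powr (2 * \<alpha>) * exp (- r) powr (2 * \<alpha>)"
      unfolding powr_powr using that k by (subst powr_mult) auto
    also have "exp (- r) powr (2 * \<alpha>) = exp (- (2 * \<alpha> * r))"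
      by (simp add: powr_def)
    finally show ?thesis .
  qed
  obtain m where m: "m > 0"
    "\<And>z. z \<in> strip d \<Longrightarrow> m * exp (pi / 2 * cos d * sinh \<bar>Re z\<bar>) \<le> cmod (cosh (of_real (pi / 2) * sinh z))"
    using cosh_DE_lower_bound[OF assms(3,4)] by metis
  define s1 where "s1 = pi * \<alpha> * cos d"
  have s1: "s1 > 0" using assms cd by (simp add: s1_def)
  obtain C1 where C1: "C1 > 0" "\<And>x. cosh x * exp (- s1 * sinh \<bar>x\<bar>) \<le> C1 * de_weight s1 x"
    using cosh_double_exp_bound[OF s1] by metis
  define s2 where "s2 = pi * \<alpha>"
  have s2: "s2 > 0" using assms by (simp add: s2_def)
  obtain C2 where C2: "C2 > 0" "\<And>x. cosh x * exp (- s2 * sinh \<bar>x\<bar>) \<le> C2 * de_weight s2 x"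
    using cosh_double_exp_bound[OF s2] by metis
  define c1 where "c1 = (k / m) powr (2 * \<alpha>)"
  define c2 where "c2 = (k / (1 / 2)) powr (2 * \<alpha>)"
  have c12: "c1 > 0" "c2 > 0" using k m(1) by (auto simp: c1_def c2_def)
  show ?thesis
  proof (rule that[of "max (c1 * C1 * 2) (c2 * C2)"])
    show "max (c1 * C1 * 2) (c2 * C2) > 0" using c12 C1 C2 by (simp add: less_max_iff_disj)
    fix z assume z: "z \<in> strip d"
    have "cmod (cosh z) * cmod (Q a b (psiDE a b z)) powr \<alpha>
        \<le> cosh (Re z) * (c1 * exp (- (2 * \<alpha> * (pi / 2 * cos d * sinh \<bar>Re z\<bar>))))"
      unfolding c1_def by (intro mult_mono cmod_cosh_le Q m z) auto
    also have "\<dots> = c1 * (cosh (Re z) * exp (- s1 * sinh \<bar>Re z\<bar>))"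
      by (simp add: s1_def mult_ac)
    also have "\<dots> \<le> c1 * (C1 * (2 / (1 + (Re z)\<^sup>2)))"
      using c12 C1 s1 by (intro mult_left_mono order_trans[OF C1(2)] order_trans[OF de_weight_le] exp_minus_abs_le) auto
    also have "\<dots> = c1 * C1 * 2 / (1 + (Re z)\<^sup>2)" by simp
    also have "\<dots> \<le> max (c1 * C1 * 2) (c2 * C2) / (1 + (Re z)\<^sup>2)"
      by (intro divide_right_mono) (auto simp: add_nonneg_nonneg)
    finally show "cmod (cosh z) * cmod (Q a b (psiDE a b z)) powr \<alpha> \<le> \<dots>" .
  next
    fix x :: real
    \<comment> \<open>On the real line cosh y >= exp|y|/2, so 1/2 takes the place of the constant
      \<open>m\<close> and cos d is replaced by 1.\<close>
    have low: "1 / 2 * exp (pi / 2 * sinh \<bar>x\<bar>) \<le> cmod (cosh (of_real (pi / 2) * sinh (of_real x)))"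
    proof -
      have "exp (pi / 2 * sinh \<bar>x\<bar>) \<le> exp (pi / 2 * sinh x) + exp (- (pi / 2 * sinh x))"
        by (cases "x \<ge> 0") (simp_all add: add_increasing add_increasing2 flip: sinh_real_abs)
      then have "1 / 2 * exp (pi / 2 * sinh \<bar>x\<bar>) \<le> cosh (pi / 2 * sinh x)"
        by (simp add: cosh_field_def)
      also have "\<dots> = cmod (cosh (of_real (pi / 2) * sinh (of_real x)))"
        by (simp only: sinh_complex_of_real cosh_complex_of_real norm_of_real abs_of_nonneg
            cosh_real_nonneg of_real_mult[symmetric])
      finally show ?thesis .
    qed
    have "cmod (cosh (of_real x)) * cmod (Q a b (psiDE a b (complex_of_real x))) powr \<alpha>
        \<le> cosh x * (c2 * exp (- (2 * \<alpha> * (pi / 2 * sinh \<bar>x\<bar>))))"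
      unfolding c2_def by (intro mult_mono Q low) (auto simp: cosh_complex_of_real)
    also have "\<dots> = c2 * (cosh x * exp (- s2 * sinh \<bar>x\<bar>))"
      by (simp add: s2_def mult_ac)
    also have "\<dots> \<le> c2 * (C2 * de_weight s2 x)"
      using c12 by (intro mult_left_mono C2) auto
    also have "\<dots> \<le> max (c1 * C1 * 2) (c2 * C2) * de_weight s2 x"
      unfolding mult.assoc[symmetric] by (intro mult_right_mono) (auto simp: de_weight_def)
    finally show "cmod (cosh (of_real x)) * cmod (Q a b (psiDE a b (complex_of_real x))) powr \<alpha>
        \<le> max (c1 * C1 * 2) (c2 * C2) * de_weight (pi * \<alpha>) x" by (simp add: s2_def)
  qed
qed

lemma psiDE_strip_has_derivative:
  assumes "a < b" "d < pi / 2" "z \<in> strip d"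
  shows "(psiDE a b has_field_derivative dpsi a b z) (at z)"
  using assms by (intro psiDE_has_derivative cosh_DE_nonzero) (auto simp: strip_def)

text \<open>The strip bound serves half-line integrals and contour shifting, the real bound serves
  truncation and sums over nodes.\<close>

definition de_maj :: "real \<Rightarrow> real \<Rightarrow> real \<Rightarrow> (complex \<Rightarrow> complex) \<Rightarrow> bool" where
  "de_maj d s C f \<longleftrightarrow> strip_maj d C f \<and> (\<forall>x. cmod (f (of_real x)) \<le> C * de_weight s x)"

text \<open>Only the product of \<open>f\<close> with Q is assumed to be holomorphic and bounded by
  |Q|^\<alpha>; the factor Q contained in the derivative of the DE map supplies exactly this
  product.\<close>

lemma de_maj_times_dpsi:
  assumes "a < b" "0 < d" "d < pi / 2" "K \<ge> 0" "c > 0"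
    and c: "\<And>z. z \<in> strip d \<Longrightarrow> cmod (cosh z) * cmod (Q a b (psiDE a b z)) powr \<alpha> \<le> c / (1 + (Re z)\<^sup>2)"
      "\<And>x. cmod (cosh (of_real x)) * cmod (Q a b (psiDE a b (complex_of_real x))) powr \<alpha>
        \<le> c * de_weight s x"
    and hol: "(\<lambda>z. f z * Q a b (psiDE a b z)) holomorphic_on strip d"
    and le: "\<And>z. z \<in> strip d \<Longrightarrow> cmod (f z * Q a b (psiDE a b z)) \<le> K * cmod (Q a b (psiDE a b z)) powr \<alpha>"
  shows "de_maj d s (pi / (b - a) * K * c) (\<lambda>z. f z * dpsi a b z)"
proof -
  let ?p = "pi / (b - a)"
  have p: "?p > 0" using assms by simp
  have eq: "f z * dpsi a b z = of_real ?p * (cosh z * (f z * Q a b (psiDE a b z)))" for z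
    by (simp add: dpsi_def mult_ac)
  have bd: "cmod (f z * dpsi a b z) \<le> ?p * K * B"
    if z: "z \<in> strip d" and B: "cmod (cosh z) * cmod (Q a b (psiDE a b z)) powr \<alpha> \<le> B" for z B
  proof -
    have "cmod (f z * dpsi a b z) = ?p * (cmod (cosh z) * cmod (f z * Q a b (psiDE a b z)))"
      unfolding eq norm_mult norm_of_real using p by (simp only: abs_of_pos)
    also have "\<dots> \<le> ?p * (cmod (cosh z) * (K * cmod (Q a b (psiDE a b z)) powr \<alpha>))"
      using p le[OF z] by (intro mult_left_mono) auto
    also have "\<dots> = ?p * K * (cmod (cosh z) * cmod (Q a b (psiDE a b z)) powr \<alpha>)"
      by simp
    also have "\<dots> \<le> ?p * K * B" using p assms(4) B by (intro mult_left_mono mult_nonneg_nonneg) auto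
    finally show ?thesis .
  qed
  show ?thesis
    unfolding de_maj_def strip_maj_def
  proof (intro conjI ballI allI)
    have "(\<lambda>z. of_real ?p * (cos (\<i> * z) * (f z * Q a b (psiDE a b z)))) holomorphic_on strip d"
      by (intro holomorphic_intros hol)
    then show "(\<lambda>z. f z * dpsi a b z) holomorphic_on strip d"
      by (simp only: eq cosh_conv_cos)
    show "cmod (f z * dpsi a b z) \<le> ?p * K * c / (1 + (Re z)\<^sup>2)" if "z \<in> strip d" for z
      using bd[OF that c(1)[OF that]] by simp
    show "cmod (f (of_real x) * dpsi a b (of_real x)) \<le> ?p * K * c * de_weight s x" for x
      using bd[OF _ c(2)[of x]] assms(2) by simp
  qed
qed

section \<open>Uniqueness on the real line\<close>

lemma range_psiDE:
  assumes "a < b"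
  shows "psiDE a b x \<in> {a<..<b}" and "t \<in> {a<..<b} \<Longrightarrow> \<exists>x. t = psiDE a b (x :: real)"
    and "inj (psiDE a b :: real \<Rightarrow> real)"
proof -
  let ?p = "psiDE a b :: real \<Rightarrow> real"
  note less = psiDE_strict_mono[OF assms]
  show "inj ?p" by (rule injI) (metis less less_irrefl linorder_neqE)
  have "a < ?p x"
  proof -
    have "a \<le> ?p (x - 1)"
    proof (rule tendsto_upperbound[OF psiDE_at_bot[of a b]])
      show "\<forall>\<^sub>F z in at_bot. ?p z \<le> ?p (x - 1)"
        using eventually_gt_at_bot[of "x - 1"] by eventually_elim (simp add: less less_imp_le)
    qed auto
    then show ?thesis using less[of "x - 1" x] by simp
  qed
  moreover have "?p x < b"
  proof -
    have "?p (x + 1) \<le> b"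
    proof (rule tendsto_lowerbound[OF psiDE_at_top[of a b]])
      show "\<forall>\<^sub>F z in at_top. ?p (x + 1) \<le> ?p z"
        using eventually_gt_at_top[of "x + 1"] by eventually_elim (simp add: less less_imp_le)
    qed auto
    then show ?thesis using less[of x "x + 1"] by simp
  qed
  ultimately show "?p x \<in> {a<..<b}" by simp
  assume t: "t \<in> {a<..<b}"
  obtain x0 where x0: "\<And>z. z \<le> x0 \<Longrightarrow> ?p z < t"
    using order_tendstoD(2)[OF psiDE_at_bot[of a b], of t] t by (auto simp: eventually_at_bot_linorder)
  obtain x1 where x1: "\<And>z. z \<ge> x1 \<Longrightarrow> ?p z > t"
    using order_tendstoD(1)[OF psiDE_at_top[of a b], of t] t by (auto simp: eventually_at_top_linorder)
  have "\<exists>x\<ge>x0. x \<le> max x0 x1 \<and> ?p x = t"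
    by (rule IVT) (use x0[of x0] x1[of "max x0 x1"] DERIV_isCont[OF psiDE_real_has_derivative[OF assms]]
        in \<open>auto intro: less_imp_le\<close>)
  then show "\<exists>x. t = ?p x" by blast
qed

context volterra_strip
begin

text \<open>The difference e of the two solutions satisfies a homogeneous Volterra equation, and the
  weighted estimate halves any weighted bound for e. The comparison is made in the variable t: the
  hypothesis on \<open>u\<close> is an integral identity in t, and the equation of \<open>U\<close>
  is transported there by \<open>pullback_has_integral\<close>, so that no substitution has to be
  made in the outer integral of the given equation.\<close>

theorem solution_unique:
  assumes ab: "a < b" and U: "bdd_hol U" and TU: "\<And>z. z \<in> strip d \<Longrightarrow> T U z = U z"
    and P_eq: "\<And>x. P (of_real x) = of_real (dpsi a b x) * g (psiDE a b x)"
    and M_eq: "\<And>x. M (of_real x) = of_real (dpsi a b x) * \<mu> (psiDE a b x)"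
    and D_eq: "\<And>x. D (of_real x) = of_real (dpsi a b x)"
    and \<kappa>_eq: "\<And>x y. \<kappa> (of_real x) (of_real y) = of_real (dpsi a b y) * k (psiDE a b x) (psiDE a b y)"
    and sol: "solves_ivp a b ua g \<mu> k u"
  shows "u (psiDE a b x) = U (of_real x)"
proof -
  define p :: "real \<Rightarrow> real" where "p = psiDE a b"
  define p' :: "real \<Rightarrow> real" where "p' = dpsi a b"
  define q where "q = inv_into UNIV p"
  have q: "q (p x) = x" for x using range_psiDE(3)[OF ab] by (simp add: q_def p_def)
  have p: "(p has_real_derivative p' x) (at x)" "p' x > 0" for x
    using psiDE_real_has_derivative[OF ab] dpsi_pos[OF ab] by (auto simp: p_def p'_def)
  have p_lim: "(p \<longlongrightarrow> a) at_bot" using psiDE_at_bot by (simp add: p_def)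
  have p_ran: "p x \<in> {a<..<b}" for x using range_psiDE(1)[OF ab] by (simp add: p_def)
  note pull = pullback_has_integral[OF p p_lim]
  have contu: "continuous_on {a..b} u" using sol by (simp add: solves_ivp_def)
  define v where "v x = u (p x)" for x
  have contv: "continuous_on UNIV v"
    unfolding v_def
  proof (rule continuous_on_compose2[OF contu])
    show "continuous_on UNIV p" using p(1) DERIV_isCont continuous_at_imp_continuous_on by blast
    show "range p \<subseteq> {a..b}" using p_ran greaterThanLessThan_subseteq_atLeastAtMost_iff by force
  qed
  obtain Bu where Bu: "\<And>t. t \<in> {a..b} \<Longrightarrow> cmod (u t) \<le> Bu"
    using compact_imp_bounded[OF compact_continuous_image[OF contu compact_Icc]]
    unfolding bounded_iff by blast
  have v_le: "cmod (v x) \<le> Bu" for x using Bu[of "p x"] p_ran[of x] by (auto simp: v_def)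
  obtain BU where BU: "\<And>z. z \<in> strip d \<Longrightarrow> cmod (U z) \<le> BU" using U by (auto simp: bdd_hol_def)
  define e where "e x = v x - U (of_real x)" for x
  have contU: "continuous_on UNIV (\<lambda>x. U (of_real x))"
    by (rule continuous_on_compose2[of "strip d" U])
      (use U d_pos in \<open>auto simp: bdd_hol_def intro!: holomorphic_on_imp_continuous_on continuous_intros\<close>)
  have conte: "continuous_on UNIV e" unfolding e_def by (intro continuous_intros contv contU)
  have strip: "of_real x \<in> strip d" for x using d_pos by simp
  have maj: "cauchy_maj (C * B) (\<lambda>r. \<kappa> (of_real s) (of_real r) * w r)"
    if "continuous_on UNIV w" "\<And>x. cmod (w x) \<le> B" for w B s
    unfolding cauchy_maj_def
  proof (intro conjI allI)
    note \<kappa>s = strip_maj_real[OF \<kappa>[OF strip] d_pos, of s]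
    show "continuous_on UNIV (\<lambda>r. \<kappa> (of_real s) (of_real r) * w r)"
      by (intro continuous_intros that cauchy_majD(1)[OF \<kappa>s])
    fix r
    have "cmod (\<kappa> (of_real s) (of_real r)) * cmod (w r) \<le> C / (1 + r\<^sup>2) * B"
      by (intro mult_mono that cauchy_majD(2)[OF \<kappa>s] divide_nonneg_pos C_nonneg)
        (simp_all add: one_plus_sq_pos)
    then show "cmod (\<kappa> (of_real s) (of_real r) * w r) \<le> C * B / (1 + r\<^sup>2)"
      by (simp add: norm_mult)
  qed
  note majv = maj[OF contv v_le]
  have U_le: "cmod (U (of_real x)) \<le> BU" for x by (rule BU[OF strip])
  note majU = maj[OF contU U_le]
  have V_eq: "volterra a k u (p s) = integral {..s} (\<lambda>r. \<kappa> (of_real s) (of_real r) * v r)" for s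
  proof -
    have "((\<lambda>r. k (p s) r * u r) has_integral
        integral {..s} (\<lambda>r. \<kappa> (of_real s) (of_real r) * v r) - 0) {a..p s}"
      by (rule pull[OF cauchy_maj_has_derivative[OF majv] cauchy_maj_tendsto_0[OF majv]])
        (simp add: \<kappa>_eq v_def p_def p'_def scaleR_conv_of_real)
    then show ?thesis by (simp add: volterra_def integral_unique)
  qed
  obtain CU where CU: "\<And>z. z \<in> strip d \<Longrightarrow> strip_maj d CU (\<lambda>w. \<kappa> z w * U w)"
    using kernel_maj[OF U] by blast
  have Y_eq: "Y U (of_real s) = integral {..s} (\<lambda>r. \<kappa> (of_real s) (of_real r) * U (of_real r))" for s
    unfolding Y_def by (rule halfline_real[OF CU[OF strip] d_pos])
  have VY: "volterra a k u (p s) - Y U (of_real s) = integral {..s} (\<lambda>r. \<kappa> (of_real s) (of_real r) * e r)" for s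
    unfolding V_eq Y_eq
    by (subst integral_diff[symmetric])
      (use cauchy_maj_integrable(1)[OF majv] cauchy_maj_integrable(1)[OF majU]
        in \<open>auto simp: e_def algebra_simps\<close>)
  obtain CF where "strip_maj d CF (F U)" using F_maj[OF U] by blast
  note FU = strip_maj_real[OF this d_pos] and FUr = halfline_real[OF this d_pos]
  define f where "f s = g s + \<mu> s * u s + volterra a k u s" for s
  \<comment> \<open>Division by \<open>p'\<close> removes the derivative of the DE map contained in
    \<open>P\<close>, \<open>M\<close> and \<open>D\<close>, so that \<open>fU\<close> is the
    counterpart of \<open>f\<close> for \<open>U\<close>.\<close>
  define fU where "fU t = (1 / p' (q t)) *\<^sub>R F U (of_real (q t))" for t
  have intU: "(fU has_integral (U (of_real x) - ua)) {a..p x}" for x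
  proof -
    have "(fU has_integral integral {..x} (\<lambda>r. F U (of_real r)) - 0) {a..p x}"
      by (rule pull[OF cauchy_maj_has_derivative[OF FU] cauchy_maj_tendsto_0[OF FU]])
        (use p(2) in \<open>simp add: fU_def q less_imp_neq[symmetric]\<close>)
    moreover have "U (of_real x) = ua + integral {..x} (\<lambda>r. F U (of_real r))"
      using TU[OF strip, of x] by (simp add: T_def FUr)
    ultimately show ?thesis by simp
  qed
  have inte: "((\<lambda>t. f t - fU t) has_integral e x) {a..p x}" for x
  proof -
    have "(f has_integral (u (p x) - ua)) {a..p x}"
      using sol p_ran[of x] by (auto simp: solves_ivp_def f_def[abs_def])
    from has_integral_diff[OF this intU[of x]] show ?thesis by (simp add: e_def v_def)
  qed
  \<comment> \<open>The inhomogeneous term g cancels and an expression linear in e remains.\<close>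
  have f_diff: "f (p s) - fU (p s)
      = (1 / p' s) *\<^sub>R (M (of_real s) * e s + D (of_real s) * integral {..s} (\<lambda>r. \<kappa> (of_real s) (of_real r) * e r))" for s
  proof -
    have "f (p s) = (1 / p' s) *\<^sub>R (P (of_real s) + M (of_real s) * v s + D (of_real s) * volterra a k u (p s))"
      using p(2)[of s] unfolding P_eq M_eq D_eq
      by (simp add: f_def v_def p'_def[symmetric] p_def[symmetric] scaleR_conv_of_real field_simps)
    then show ?thesis
      unfolding VY[symmetric] by (simp add: fU_def q F_def e_def algebra_simps)
  qed
  have l: "lam > 0" using lam(1) by simp
  have step: "cmod (e x) \<le> \<delta> / 2 * exp (lam * arctan x)"
    if le: "\<And>y. cmod (e y) \<le> \<delta> * exp (lam * arctan y)" for \<delta> x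
  proof -
    have \<delta>: "\<delta> \<ge> 0" using le[of 0] norm_ge_zero[of "e 0"] by (simp del: norm_ge_zero)
    define A where "A = C * \<delta> + C * (C * \<delta> / lam)"
    have A: "A \<ge> 0" using \<delta> C_nonneg l by (simp add: A_def)
    have *: "cmod (m * e y) \<le> C * \<delta> * exp (lam * arctan y) / (1 + y\<^sup>2)"
      if "cmod m \<le> C / (1 + y\<^sup>2)" for m y
    proof -
      have "cmod m * cmod (e y) \<le> C / (1 + y\<^sup>2) * (\<delta> * exp (lam * arctan y))"
        using that le by (intro mult_mono) (auto intro: order_trans[OF norm_ge_zero])
      then show ?thesis by (simp add: norm_mult mult_ac)
    qed
    note Mr = strip_maj_real[OF M d_pos] and Dr = strip_maj_real[OF D d_pos]
      and \<kappa>r = strip_maj_real[OF \<kappa>[OF strip] d_pos]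
    have inner: "cmod (integral {..s} (\<lambda>r. \<kappa> (of_real s) (of_real r) * e r)) \<le> C * \<delta> / lam * exp (lam * arctan s)" for s
    proof -
      have "cmod (integral {..s} (\<lambda>r. \<kappa> (of_real s) (of_real r) * e r)) \<le> C * \<delta> / lam * exp (lam * arctan (0 + s))"
      proof (rule weighted_integral_bound[OF l])
        show "continuous_on UNIV (\<lambda>r. \<kappa> (of_real s) (of_real r) * e r)"
          by (intro continuous_intros conte cauchy_majD(1)[OF \<kappa>r])
        show "cmod (\<kappa> (of_real s) (of_real r) * e r) \<le> C * \<delta> * exp (lam * arctan (0 + r)) / (1 + (0 + r)\<^sup>2)" for r
          using *[OF cauchy_majD(2)[OF \<kappa>r]] by simp
      qed (use C_nonneg \<delta> in auto)
      then show ?thesis by simp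
    qed
    define Gx where "Gx s = A * exp (lam * arctan s) / (1 + s\<^sup>2)" for s
    \<comment> \<open>The comparison of norms is pointwise on the closed interval, but a is not a
      value of \<open>p\<close>; at this point the bound holds by definition.\<close>
    define G where "G t = (if t = a then cmod (f a - fU a) else 1 / p' (q t) * Gx (q t))" for t
    have p_ne: "p s \<noteq> a" for s using p_ran[of s] by simp
    have "(G has_integral (A / lam * exp (lam * arctan x) - A / lam * exp (lam * (- (pi / 2))))) {a..p x}"
    proof (rule pull)
      show "((\<lambda>s. A / lam * exp (lam * arctan s)) has_vector_derivative Gx s) (at s)" for s
        unfolding has_real_derivative_iff_has_vector_derivative[symmetric] Gx_def
        using l by (auto intro!: derivative_eq_intros simp: divide_inverse)
      show "((\<lambda>s. A / lam * exp (lam * arctan s)) \<longlongrightarrow> A / lam * exp (lam * (- (pi / 2)))) at_bot"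
        by (intro tendsto_intros tendsto_arctan_at_bot)
      show "Gx s = p' s *\<^sub>R G (p s)" for s
        using p(2)[of s] p_ne by (simp add: G_def q)
    qed
    note G = this
    have "cmod (integral {a..p x} (\<lambda>t. f t - fU t)) \<le> integral {a..p x} G"
    proof (rule integral_norm_bound_integral)
      show "(\<lambda>t. f t - fU t) integrable_on {a..p x}" using inte by (rule has_integral_integrable)
      show "G integrable_on {a..p x}" using G by (rule has_integral_integrable)
      fix t assume t: "t \<in> {a..p x}"
      show "cmod (f t - fU t) \<le> G t"
      proof (cases "t = a")
        case False
        then have "t \<in> {a<..<b}" using t p_ran[of x] by auto
        then obtain s where s: "t = p s" using range_psiDE(2)[OF ab] by (auto simp: p_def)
        have "cmod (M (of_real s) * e s + D (of_real s) * integral {..s} (\<lambda>r. \<kappa> (of_real s) (of_real r) * e r))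
            \<le> C * \<delta> * exp (lam * arctan s) / (1 + s\<^sup>2)
              + C / (1 + s\<^sup>2) * (C * \<delta> / lam * exp (lam * arctan s))"
          unfolding norm_mult[of "D _"]
          by (intro norm_triangle_le add_mono *[OF cauchy_majD(2)[OF Mr]], unfold norm_mult[of "D _"])
            (intro mult_mono cauchy_majD(2)[OF Dr] inner divide_nonneg_pos C_nonneg, simp_all add: one_plus_sq_pos)
        also have "\<dots> = Gx s"
          by (simp add: Gx_def A_def algebra_simps add_divide_distrib)
        finally show ?thesis
          using p(2)[of s] p_ne[of s] by (simp add: s f_diff G_def q divide_right_mono)
      qed (simp add: G_def)
    qed
    then have "cmod (e x) \<le> A / lam * exp (lam * arctan x) - A / lam * exp (lam * (- (pi / 2)))"
      using integral_unique[OF inte] integral_unique[OF G] by simp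
    also have "\<dots> \<le> A / lam * exp (lam * arctan x)" using A l by simp
    also have "A / lam = \<delta> * ((C + C * (C / lam)) / lam)"
      by (simp add: A_def algebra_simps add_divide_distrib)
    also have "\<dots> * exp (lam * arctan x) \<le> \<delta> * (1 / 2) * exp (lam * arctan x)"
      by (intro mult_right_mono mult_left_mono lam(2) \<delta>) auto
    finally show ?thesis by simp
  qed
  define B where "B = Bu + BU"
  have e_le: "cmod (e y) \<le> B" for y
    unfolding e_def B_def using norm_triangle_ineq4[of "v y" "U (of_real y)"] v_le[of y] U_le[of y] by linarith
  then have B: "B \<ge> 0" using norm_ge_zero order_trans by blast
  define \<delta> where "\<delta> = B * exp (lam * (pi / 2))"
  have it: "cmod (e y) \<le> \<delta> / 2 ^ n * exp (lam * arctan y)" for n y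
  proof (induction n arbitrary: y)
    case 0
    have "B * 1 \<le> B * exp (lam * (pi / 2) + lam * arctan y)"
      using B weight_exponent_nonneg by (intro mult_left_mono) simp_all
    then show ?case using e_le[of y] by (simp add: \<delta>_def exp_add)
  next
    case (Suc n)
    from step[OF Suc, of y] show ?case by (simp add: mult_ac)
  qed
  have "(\<lambda>n. \<delta> * exp (lam * arctan x) * (1 / 2) ^ n) \<longlonglongrightarrow> \<delta> * exp (lam * arctan x) * 0"
    by (intro tendsto_intros LIMSEQ_realpow_zero) auto
  then have "cmod (e x) \<le> \<delta> * exp (lam * arctan x) * 0"
  proof (rule LIMSEQ_le_const, intro exI allI impI)
    show "cmod (e x) \<le> \<delta> * exp (lam * arctan x) * (1 / 2) ^ n" for n
      using it[of x n] by (simp add: power_divide)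
  qed
  then show ?thesis by (simp add: e_def v_def p_def)
qed

end

section \<open>Sinc quadrature for indefinite integrals\<close>

text \<open>In fact |sin z|^2 = sin^2(Re z) + sinh^2(Im z). On the horizontal sides of the contour
  this is the source of the factor exp(-pi d/h).\<close>

lemma cmod_sin_ge: "\<bar>sinh (Im z)\<bar> \<le> cmod (sin z)"
proof -
  have "(sinh (Im z))\<^sup>2 = (exp (2 * Im z) + inverse (exp (2 * Im z)) - 2) / 4"
    by (simp add: sinh_field_def power2_eq_square field_simps exp_minus flip: exp_add)
  also have "\<dots> \<le> (cmod (sin z))\<^sup>2"
    unfolding norm_sin_squared using cos_le_one[of "2 * Re z"] by simp
  finally have "\<bar>sinh (Im z)\<bar>\<^sup>2 \<le> (cmod (sin z))\<^sup>2" by simp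
  then show ?thesis by (rule power2_le_imp_le) simp
qed

text \<open>On the vertical lines halfway between the zeros, |sin z| equals cosh(Im z); this is why
  the vertical sides of the contour pass midway between nodes.\<close>

lemma cmod_sin_half_ge:
  assumes "cos (2 * Re z) = - 1"
  shows "1 \<le> cmod (sin z)"
proof -
  define e where "e = exp (2 * Im z)"
  have "e > 0" by (simp add: e_def)
  then have "0 \<le> (e - 1)\<^sup>2 / e" by simp
  also have "\<dots> = e + inverse e - 2" using \<open>e > 0\<close> by (simp add: power2_eq_square field_simps)
  finally have "1\<^sup>2 \<le> (cmod (sin z))\<^sup>2"
    unfolding norm_sin_squared assms e_def[symmetric] by simp
  then show ?thesis using power2_le_imp_le norm_ge_zero by blast
qed

text \<open>One integration by parts gains the factor \<open>h\<close> in the quadrature error.\<close>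

lemma oscillatory_integral_bound:
  assumes "h > 0" "X \<le> \<xi>" and s: "Im w = s" "s \<noteq> 0"
  shows "cmod (integral {X..\<xi>} (\<lambda>x. of_real (sin (pi * x / h)) / (w - of_real x)))
    \<le> h / pi * (2 + pi) / \<bar>s\<bar>"
proof -
  let ?f = "\<lambda>x. of_real (sin (pi * x / h)) / (w - of_real x)"
  let ?g = "\<lambda>x. of_real (- (h / pi) * cos (pi * x / h)) / (w - of_real x)"
  let ?r = "\<lambda>x. of_real (h / pi * cos (pi * x / h)) / (w - of_real x)\<^sup>2"
  have ne: "w - of_real x \<noteq> 0" for x using s by (auto simp: complex_eq_iff)
  have norm_ge: "\<bar>s\<bar> \<le> cmod (w - of_real x)" for x
    using abs_Im_le_cmod[of "w - of_real x"] s by simp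
  \<comment> \<open>\<open>?g\<close> is the boundary term of the integration by parts and
    \<open>?r\<close> the remainder, which has one more power of w - x in the denominator.\<close>
  have der: "(?g has_vector_derivative (?f x - ?r x)) (at x within {X..\<xi>})" for x
  proof -
    let ?z = "complex_of_real x"
    have "((\<lambda>z. - (of_real h / of_real pi) * cos (of_real pi * z / of_real h)) has_field_derivative
        sin (of_real pi * ?z / of_real h)) (at ?z)"
      using assms(1) by (auto intro!: derivative_eq_intros)
    moreover have "((\<lambda>z. inverse (w - z)) has_field_derivative inverse ((w - ?z)\<^sup>2)) (at ?z)"
      using ne[of x] by (auto intro!: derivative_eq_intros simp: power2_eq_square)
    ultimately have "((\<lambda>z. - (of_real h / of_real pi) * cos (of_real pi * z / of_real h) * inverse (w - z))
        has_field_derivative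
        - (of_real h / of_real pi) * cos (of_real pi * ?z / of_real h) * inverse ((w - ?z)\<^sup>2)
        + sin (of_real pi * ?z / of_real h) * inverse (w - ?z)) (at ?z)"
      by (rule DERIV_mult')
    from has_vector_derivative_real_field[OF this, of "{X..\<xi>}"]
    show ?thesis by (simp add: divide_inverse flip: cos_of_real sin_of_real)
  qed
  have fi: "((\<lambda>x. ?f x - ?r x) has_integral (?g \<xi> - ?g X)) {X..\<xi>}"
    by (rule fundamental_theorem_of_calculus[OF assms(2) der])
  have r_int: "?r integrable_on {X..\<xi>}"
    by (intro integrable_continuous_real continuous_intros) (use ne \<open>h > 0\<close> in auto)
  have g_bd: "cmod (?g x) \<le> h / pi / \<bar>s\<bar>" for x
  proof -
    have "\<bar>- (h / pi) * cos (pi * x / h)\<bar> \<le> h / pi * 1"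
      unfolding abs_mult using assms by (intro mult_mono) auto
    then have "cmod (?g x) \<le> (h / pi * 1) / \<bar>s\<bar>"
      unfolding norm_divide norm_of_real using norm_ge[of x] s assms
      by (intro frac_le) auto
    then show ?thesis by simp
  qed
  let ?a = "\<lambda>x. h / pi * (1 / \<bar>s\<bar>) * arctan ((x - Re w) / \<bar>s\<bar>)"
  have da: "((\<lambda>x. h / pi * (1 / t) * arctan ((x - r) / t)) has_real_derivative
      h / pi * (1 / t) * (inverse (1 + ((x - r) / t)\<^sup>2) * (1 / t))) (at x within A)" if "t \<noteq> 0" for t r x A
    using that by (auto intro!: derivative_eq_intros simp: mult_ac)
  \<comment> \<open>|w - x|^2 is (x - Re w)^2 + s^2, so the remainder is dominated by a Cauchy
    density of scale |s|. Its total mass contributes the pi in 2 + pi, the two boundary terms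
    contribute the 2, and the length of the interval does not enter.\<close>
  have a: "((\<lambda>x. h / pi * (1 / ((x - Re w)\<^sup>2 + s\<^sup>2))) has_integral (?a \<xi> - ?a X)) {X..\<xi>}"
  proof (rule fundamental_theorem_of_calculus[OF assms(2)])
    fix x
    have "(?a has_real_derivative h / pi * (1 / \<bar>s\<bar>) * (inverse (1 + ((x - Re w) / \<bar>s\<bar>)\<^sup>2) * (1 / \<bar>s\<bar>))) (at x within {X..\<xi>})"
      by (rule da) (use s in simp)
    moreover have "(1 / \<bar>s\<bar>) * (inverse (1 + ((x - Re w) / \<bar>s\<bar>)\<^sup>2) * (1 / \<bar>s\<bar>)) = 1 / ((x - Re w)\<^sup>2 + s\<^sup>2)"
    proof -
      have "1 + ((x - Re w) / \<bar>s\<bar>)\<^sup>2 = ((x - Re w)\<^sup>2 + s\<^sup>2) / s\<^sup>2"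
        using s by (simp add: power_divide add_divide_distrib)
      then show ?thesis using s by (cases "s > 0") (simp_all add: power2_eq_square)
    qed
    ultimately show "(?a has_vector_derivative h / pi * (1 / ((x - Re w)\<^sup>2 + s\<^sup>2))) (at x within {X..\<xi>})"
      unfolding has_real_derivative_iff_has_vector_derivative[symmetric] by (simp only: mult.assoc)
  qed
  have "cmod (integral {X..\<xi>} ?r) \<le> ?a \<xi> - ?a X"
    unfolding integral_unique[OF a, symmetric]
  proof (rule integral_norm_bound_integral[OF r_int has_integral_integrable[OF a]])
    fix x
    have n2: "(cmod (w - of_real x))\<^sup>2 = (x - Re w)\<^sup>2 + s\<^sup>2"
      using s by (simp add: cmod_power2 power2_commute)
    have "\<bar>h / pi * cos (pi * x / h)\<bar> \<le> h / pi * 1"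
      unfolding abs_mult using assms by (intro mult_mono) auto
    then have "cmod (?r x) \<le> h / pi * 1 / ((x - Re w)\<^sup>2 + s\<^sup>2)"
      unfolding norm_divide norm_of_real norm_power n2 by (rule divide_right_mono) simp
    then show "cmod (?r x) \<le> h / pi * (1 / ((x - Re w)\<^sup>2 + s\<^sup>2))" by simp
  qed
  also have "\<dots> \<le> h / pi * (1 / \<bar>s\<bar>) * pi"
    unfolding right_diff_distrib[symmetric]
    using arctan_ubound[of "(\<xi> - Re w) / \<bar>s\<bar>"] arctan_lbound[of "(X - Re w) / \<bar>s\<bar>"] assms
    by (intro mult_left_mono) auto
  finally have r_bd: "cmod (integral {X..\<xi>} ?r) \<le> h / pi * (1 / \<bar>s\<bar>) * pi" .
  have "(?f has_integral (?g \<xi> - ?g X + integral {X..\<xi>} ?r)) {X..\<xi>}"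
    using has_integral_add[OF fi integrable_integral[OF r_int]] by simp
  then have "cmod (integral {X..\<xi>} ?f) \<le> cmod (?g \<xi>) + cmod (?g X) + cmod (integral {X..\<xi>} ?r)"
    using norm_triangle_ineq4[of "?g \<xi>" "?g X"] norm_triangle_ineq[of "?g \<xi> - ?g X" "integral {X..\<xi>} ?r"]
    by (simp only: integral_unique)
  also have "\<dots> \<le> h / pi / \<bar>s\<bar> + h / pi / \<bar>s\<bar> + h / pi * (1 / \<bar>s\<bar>) * pi"
    by (intro add_mono g_bd r_bd)
  also have "\<dots> = h / pi * (2 + pi) / \<bar>s\<bar>"
    by (simp add: add_divide_distrib distrib_left)
  finally show ?thesis .
qed

text \<open>After the two integrations are exchanged, the inner one is the oscillatory integral,
  which gains h. On the side |sin| is at least sinh(pi |s|/h), and the majorant of \<open>F\<close>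
  integrates to at most C pi over a horizontal segment of any length, so the bound survives when the
  rectangle grows.\<close>

lemma side_integral_bound:
  assumes F: "strip_maj d C F" and "h > 0" "X \<le> \<xi>" and s: "Im p = s" "Im q = s" "s \<noteq> 0" "\<bar>s\<bar> < d"
  defines "S \<equiv> (\<lambda>x. integral {0..1} (\<lambda>\<tau>. F (linepath p q \<tau>)
      / ((linepath p q \<tau> - of_real x) * sin (of_real pi * linepath p q \<tau> / of_real h)) * (q - p)))"
  shows "continuous_on {X..\<xi>} S"
    and "cmod (integral {X..\<xi>} (\<lambda>x. of_real (sin (pi * x / h)) * S x))
      \<le> C * pi / sinh (pi * \<bar>s\<bar> / h) * (h / pi * (2 + pi) / \<bar>s\<bar>)"
proof -
  define w where "w = linepath p q"
  have Imw: "Im (w \<tau>) = s" for \<tau> using s by (simp add: w_def linepath_def algebra_simps)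
  have Rew: "Re (w \<tau>) = Re p + \<tau> * (Re q - Re p)" for \<tau> by (simp add: w_def linepath_def algebra_simps)
  have w_strip: "w \<tau> \<in> strip d" for \<tau> using s by (simp add: strip_def Imw)
  have qp: "cmod (q - p) = \<bar>Re q - Re p\<bar>" using s by (simp add: cmod_def)
  have C: "0 \<le> C" using strip_maj_nonneg[OF F w_strip[of 0]] .
  have sh: "sinh (pi * \<bar>s\<bar> / h) > 0" using assms by simp
  have sin_ge: "sinh (pi * \<bar>s\<bar> / h) \<le> cmod (sin (of_real pi * w \<tau> / of_real h))" for \<tau>
  proof -
    have "\<bar>sinh (Im (of_real pi * w \<tau> / of_real h))\<bar> = sinh (pi * \<bar>s\<bar> / h)"
      using assms by (simp add: Imw abs_mult flip: sinh_real_abs)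
    then show ?thesis using cmod_sin_ge[of "of_real pi * w \<tau> / of_real h"] by simp
  qed
  then have sin_ne: "sin (of_real pi * w \<tau> / of_real h) \<noteq> 0" for \<tau> using sh by (metis norm_zero not_le)
  have ne: "w \<tau> - of_real x \<noteq> 0" for \<tau> x using Imw[of \<tau>] s by (auto simp: complex_eq_iff)
  define G where "G \<tau> = F (w \<tau>) / sin (of_real pi * w \<tau> / of_real h) * (q - p)" for \<tau>
  have cw: "continuous_on A w" for A unfolding w_def by (rule continuous_on_linepath)
  have cG: "continuous_on A G" for A
    unfolding G_def
    by (intro continuous_intros cw continuous_on_compose2[OF holomorphic_on_imp_continuous_on[OF strip_majD(1)[OF F]] cw])
      (use w_strip sin_ne \<open>h > 0\<close> in auto)
  have S_eq: "S x = integral {0..1} (\<lambda>\<tau>. G \<tau> / (w \<tau> - of_real x))" for x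
    unfolding S_def w_def[symmetric] G_def by (simp add: mult_ac)
  have cont2: "continuous_on A (\<lambda>(x, \<tau>). G \<tau> / (w \<tau> - complex_of_real x))" for A
    unfolding case_prod_beta
    by (intro continuous_intros continuous_on_compose2[OF cG[of UNIV] continuous_on_snd]
        continuous_on_compose2[OF cw[of UNIV] continuous_on_snd]) (use ne in auto)
  have "continuous_on {X..\<xi>} (\<lambda>x. integral (cbox 0 1) (\<lambda>\<tau>. G \<tau> / (w \<tau> - of_real x)))"
    by (rule integral_continuous_on_param) (rule cont2)
  then show "continuous_on {X..\<xi>} S" by (simp add: S_eq[abs_def])
  let ?K = "\<lambda>\<tau>. integral {X..\<xi>} (\<lambda>x. of_real (sin (pi * x / h)) / (w \<tau> - of_real x))"
  have "integral {X..\<xi>} (\<lambda>x. of_real (sin (pi * x / h)) * S x)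
      = integral (cbox X \<xi>) (\<lambda>x. integral (cbox 0 1) (\<lambda>\<tau>. of_real (sin (pi * x / h)) * (G \<tau> / (w \<tau> - of_real x))))"
    by (simp only: S_eq integral_mult_right cbox_interval)
  also have "\<dots> = integral (cbox 0 1) (\<lambda>\<tau>. integral (cbox X \<xi>) (\<lambda>x. of_real (sin (pi * x / h)) * (G \<tau> / (w \<tau> - of_real x))))"
  proof (rule integral_swap_continuous)
    have "continuous_on (cbox (X, 0) (\<xi>, 1)) (\<lambda>z. complex_of_real (sin (pi * fst z / h)))"
      by (intro continuous_intros) (use \<open>h > 0\<close> in auto)
    from continuous_on_mult[OF this cont2]
    show "continuous_on (cbox (X, 0) (\<xi>, 1)) (\<lambda>(x, \<tau>). of_real (sin (pi * x / h)) * (G \<tau> / (w \<tau> - complex_of_real x)))"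
      by (simp add: case_prod_beta)
  qed
  also have "\<dots> = integral {0..1} (\<lambda>\<tau>. G \<tau> * ?K \<tau>)"
    by (simp flip: integral_mult_right add: mult_ac)
  finally have eq: "integral {X..\<xi>} (\<lambda>x. of_real (sin (pi * x / h)) * S x) = integral {0..1} (\<lambda>\<tau>. G \<tau> * ?K \<tau>)" .
  define B where "B = h / pi * (2 + pi) / \<bar>s\<bar>"
  have B: "B \<ge> 0" using assms by (simp add: B_def)
  \<comment> \<open>Signed, because the upper side is traversed from right to left.\<close>
  define l where "l = Re q - Re p"
  have maj: "((\<lambda>\<tau>. C / sinh (pi * \<bar>s\<bar> / h) * B * (\<bar>l\<bar> / (1 + (Re (w \<tau>))\<^sup>2))) has_integral
      (C / sinh (pi * \<bar>s\<bar> / h) * B * (sgn l * (arctan (Re q) - arctan (Re p))))) {0..1}"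
  proof (rule has_integral_mult_right)
    have "((\<lambda>\<tau>. \<bar>l\<bar> / (1 + (Re (w \<tau>))\<^sup>2)) has_integral
        (sgn l * arctan (Re p + 1 * l) - sgn l * arctan (Re p + 0 * l))) {0..1}"
    proof (rule fundamental_theorem_of_calculus)
      show "((\<lambda>\<tau>. sgn l * arctan (Re p + \<tau> * l)) has_vector_derivative \<bar>l\<bar> / (1 + (Re (w \<tau>))\<^sup>2)) (at \<tau> within {0..1})" for \<tau>
        unfolding has_real_derivative_iff_has_vector_derivative[symmetric] Rew l_def[symmetric]
        by (auto intro!: derivative_eq_intros simp: divide_inverse abs_sgn)
    qed simp
    then show "((\<lambda>\<tau>. \<bar>l\<bar> / (1 + (Re (w \<tau>))\<^sup>2)) has_integral (sgn l * (arctan (Re q) - arctan (Re p)))) {0..1}"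
      by (simp add: l_def right_diff_distrib)
  qed
  have "cmod (integral {0..1} (\<lambda>\<tau>. G \<tau> * ?K \<tau>)) \<le> C / sinh (pi * \<bar>s\<bar> / h) * B * (sgn l * (arctan (Re q) - arctan (Re p)))"
    unfolding integral_unique[OF maj, symmetric]
  proof (rule integral_norm_bound_integral[OF _ has_integral_integrable[OF maj]])
    have "continuous_on {0..1} (\<lambda>\<tau>. integral (cbox X \<xi>) (\<lambda>x. of_real (sin (pi * x / h)) / (w \<tau> - of_real x)))"
    proof (rule integral_continuous_on_param)
      show "continuous_on ({0..1} \<times> cbox X \<xi>) (\<lambda>(\<tau>, x). complex_of_real (sin (pi * x / h)) / (w \<tau> - of_real x))"
        unfolding case_prod_beta
        by (intro continuous_intros continuous_on_compose2[OF cw[of UNIV] continuous_on_fst])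
          (use ne \<open>h > 0\<close> in auto)
    qed
    then show "(\<lambda>\<tau>. G \<tau> * ?K \<tau>) integrable_on {0..1}"
      by (intro integrable_continuous_real continuous_on_mult cG) simp
    fix \<tau>
    have "cmod (F (w \<tau>)) / cmod (sin (of_real pi * w \<tau> / of_real h)) \<le> (C / (1 + (Re (w \<tau>))\<^sup>2)) / sinh (pi * \<bar>s\<bar> / h)"
      by (intro frac_le strip_majD(2)[OF F] w_strip sin_ge sh divide_nonneg_pos C) (simp add: one_plus_sq_pos)
    then have "cmod (G \<tau>) \<le> (C / (1 + (Re (w \<tau>))\<^sup>2)) / sinh (pi * \<bar>s\<bar> / h) * \<bar>l\<bar>"
      unfolding G_def norm_mult norm_divide qp l_def by (intro mult_right_mono) auto
    then have "cmod (G \<tau> * ?K \<tau>) \<le> ((C / (1 + (Re (w \<tau>))\<^sup>2)) / sinh (pi * \<bar>s\<bar> / h) * \<bar>l\<bar>) * B"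
      unfolding norm_mult B_def
      by (intro mult_mono oscillatory_integral_bound assms Imw) (auto intro: order_trans[OF norm_ge_zero])
    then show "cmod (G \<tau> * ?K \<tau>) \<le> C / sinh (pi * \<bar>s\<bar> / h) * B * (\<bar>l\<bar> / (1 + (Re (w \<tau>))\<^sup>2))"
      by (simp add: mult_ac)
  qed
  also have "\<dots> \<le> C / sinh (pi * \<bar>s\<bar> / h) * B * pi"
  proof (intro mult_left_mono mult_nonneg_nonneg B)
    show "sgn l * (arctan (Re q) - arctan (Re p)) \<le> pi"
      using arctan_bounded[of "Re q"] arctan_bounded[of "Re p"] by (auto simp: sgn_if)
  qed (use C sh in auto)
  finally show "cmod (integral {X..\<xi>} (\<lambda>x. of_real (sin (pi * x / h)) * S x))
      \<le> C * pi / sinh (pi * \<bar>s\<bar> / h) * (h / pi * (2 + pi) / \<bar>s\<bar>)"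
    unfolding eq B_def by (simp add: mult_ac)
qed

section \<open>Residue representation of the interpolation error\<close>

lemma sin_pi_int_shift: "sin (pi * (t - of_int j)) = sin (pi * t) * cos (pi * of_int j)"
  by (simp add: right_diff_distrib sin_diff)

text \<open>Puts the shifted sinc function into the shape of a residue, with sin(pi x/h) as a factor
  common to all nodes. The number cos(pi j) is (-1)^j and may move to the denominator because its
  square is 1.\<close>

lemma sinc_node:
  assumes "h > 0" "x \<noteq> of_int j * h"
  shows "sinc (pi * (x / h - of_int j)) = sin (pi * x / h) * (h / (pi * cos (pi * of_int j) * (x - of_int j * h)))"
proof -
  have cos2: "cos (pi * of_int j) * cos (pi * of_int j) = 1"
    using sin_cos_squared_add[of "pi * of_int j"] by (simp add: power2_eq_square)
  then have c0: "cos (pi * of_int j) \<noteq> 0" by auto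
  have eq: "pi * (x / h - of_int j) = pi * (x - of_int j * h) / h"
    using assms by (simp add: field_simps)
  have ne: "pi * (x / h - of_int j) \<noteq> 0" unfolding eq using assms by simp
  have "sinc (pi * (x / h - of_int j)) = sin (pi * (x / h)) * cos (pi * of_int j) / (pi * (x - of_int j * h) / h)"
    using ne by (simp only: sin_pi_int_shift if_False flip: eq)
  also have "\<dots> = sin (pi * x / h) * (h / (pi * cos (pi * of_int j) * (x - of_int j * h)))"
    using cos2 c0 by (simp add: divide_simps)
  finally show ?thesis .
qed

lemma Re_in_cbox_strip:
  assumes "d' < d" "z \<in> cbox (Complex (- R) (- d')) (Complex R d')"
  shows "z \<in> strip d" "\<bar>Re z\<bar> \<le> R"
  using assms by (auto simp: in_cbox_complex_iff strip_def)

text \<open>The poles of \<open>f\<close> in the rectangle are x and the nodes. The residue at x is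
  F(x)/sin(pi x/h); those at the nodes are minus the terms of the sinc interpolant, divided by the
  same sine. Multiplication by sin(pi x/h) leaves the interpolation error.\<close>

lemma sinc_residue_formula:
  fixes M :: nat
  assumes F: "F holomorphic_on strip d" and d': "0 < d'" "d' < d" and h: "h > 0"
    and R: "R = (of_nat M + 1 / 2) * h" and x: "\<bar>x\<bar> < R" "\<And>j::int. x \<noteq> of_int j * h"
  defines "f \<equiv> (\<lambda>z. F z / ((z - of_real x) * sin (of_real pi * z / of_real h)))"
  shows "F (of_real x) - (\<Sum>j=-int M..int M. F (of_real (of_int j * h)) * of_real (sinc (pi * (x / h - of_int j))))
    = of_real (sin (pi * x / h)) / (2 * of_real pi * \<i>)
      * contour_integral (rectpath (Complex (- R) (- d')) (Complex R d')) f"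
proof -
  define node where "node j = complex_of_real (of_int j * h)" for j :: int
  \<comment> \<open>A convex open set around the rectangle; the strict bound (M+1) h on |Re z|
    admits no nodes beyond |j| <= M.\<close>
  define S where "S = strip d \<inter> ({z. Re z < (of_nat M + 1) * h} \<inter> {z. Re z > - ((of_nat M + 1) * h)})"
  define js where "js = {-int M..int M}"
  define pts where "pts = insert (of_real x) (node ` js)"
  have inj: "inj_on node A" for A using h by (auto simp: inj_on_def node_def)
  have "open S"
    unfolding S_def by (intro open_Int open_strip open_halfspace_Re_lt open_halfspace_Re_gt)
  have "convex S"
    unfolding S_def by (intro convex_Int convex_strip convex_halfspace_Re_lt convex_halfspace_Re_gt)
  have sin0: "sin (of_real pi * z / of_real h) = 0 \<longleftrightarrow> (\<exists>j::int. z = node j)" for z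
  proof -
    have "of_real pi * z / of_real h = of_real (of_int j * pi) \<longleftrightarrow> z = node j" for j :: int
      using h by (auto simp: node_def field_simps)
    then show ?thesis unfolding sin_eq_0 by simp
  qed
  have node_S: "node j \<in> S \<Longrightarrow> j \<in> js" for j
  proof -
    assume "node j \<in> S"
    then have "of_int j * h < (of_nat M + 1) * h" "- ((of_nat M + 1) * h) < of_int j * h"
      by (auto simp: S_def node_def)
    then have "of_int j < (of_nat M + 1 :: real)" "- (of_nat M + 1 :: real) < of_int j"
      using h by (auto simp flip: minus_mult_left[of "1 + real M" h] simp: minus_mult_left)
    then show ?thesis by (simp add: js_def)
  qed
  have cb: "z \<in> S" if "z \<in> cbox (Complex (- R) (- d')) (Complex R d')" for z
    using Re_in_cbox_strip[OF d'(2) that] h by (auto simp: S_def R abs_le_iff algebra_simps)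
  have node_box: "node j \<in> box (Complex (- R) (- d')) (Complex R d')" if "j \<in> js" for j
  proof -
    have "\<bar>of_int j\<bar> * h < R"
      unfolding R using that h by (intro mult_strict_right_mono) (auto simp: js_def)
    then have "\<bar>of_int j * h\<bar> < R" using h by (simp add: abs_mult)
    then show ?thesis using d' by (auto simp: node_def in_box_complex_iff abs_less_iff)
  qed
  have x_box: "of_real x \<in> box (Complex (- R) (- d')) (Complex R d')"
    using x d' by (auto simp: in_box_complex_iff abs_less_iff)
  have x_node: "of_real x \<noteq> node j" for j using x(2)[of j] unfolding node_def of_real_eq_iff .
  have R0: "R > 0" using x by linarith
  have holf: "f holomorphic_on S - pts"
    unfolding f_def
  proof (intro holomorphic_intros)
    show "F holomorphic_on S - pts" using F by (rule holomorphic_on_subset) (auto simp: S_def)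
    show "(z - of_real x) * sin (of_real pi * z / of_real h) \<noteq> 0" if "z \<in> S - pts" for z
      using that node_S sin0 by (auto simp: pts_def)
  qed (use h in auto)
  have pth: "path_image (rectpath (Complex (- R) (- d')) (Complex R d')) \<subseteq> S - pts"
  proof -
    have 1: "path_image (rectpath (Complex (- R) (- d')) (Complex R d')) \<subseteq> S"
      using path_image_rectpath_subset_cbox[of "Complex (- R) (- d')" "Complex R d'"] R0 d' cb by force
    have "pts \<subseteq> box (Complex (- R) (- d')) (Complex R d')"
      using x_box node_box by (auto simp: pts_def)
    then show ?thesis
      using path_image_rectpath_inter_box[of "Complex (- R) (- d')" "Complex R d'"] R0 d' 1 by auto
  qed
  have "contour_integral (rectpath (Complex (- R) (- d')) (Complex R d')) f
      = of_real (2 * pi) * \<i> * (\<Sum>p\<in>pts. winding_number (rectpath (Complex (- R) (- d')) (Complex R d')) p * residue f p)"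
  proof (rule Residue_theorem[OF \<open>open S\<close> _ _ holf _ _ pth])
    show "connected S" using \<open>convex S\<close> by (rule convex_connected)
    show "finite pts" by (simp add: pts_def js_def)
    show "\<forall>z. z \<notin> S \<longrightarrow> winding_number (rectpath (Complex (- R) (- d')) (Complex R d')) z = 0"
      using cb R0 d' by (auto intro!: winding_number_rectpath_outside)
  qed auto
  also have "(\<Sum>p\<in>pts. winding_number (rectpath (Complex (- R) (- d')) (Complex R d')) p * residue f p)
      = (\<Sum>p\<in>pts. residue f p)"
    by (intro sum.cong refl, subst winding_number_rectpath) (use x_box node_box in \<open>auto simp: pts_def\<close>)
  also have "\<dots> = residue f (of_real x) + (\<Sum>j\<in>js. residue f (node j))"
  proof -
    have "of_real x \<notin> node ` js" using x_node by auto
    then show ?thesis unfolding pts_def by (simp add: js_def sum.reindex[OF inj])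
  qed
  also have "residue f (of_real x) = F (of_real x) / sin (of_real pi * of_real x / of_real h)"
  proof -
    let ?s = "S - node ` js"
    have "open ?s" using \<open>open S\<close> by (intro open_Diff finite_imp_closed) (auto simp: js_def)
    moreover have "of_real x \<in> ?s" using x_box cb x_node box_subset_cbox by blast
    moreover have "(\<lambda>z. F z / sin (of_real pi * z / of_real h)) holomorphic_on ?s"
    proof (intro holomorphic_intros)
      show "F holomorphic_on ?s" using F by (rule holomorphic_on_subset) (auto simp: S_def)
      show "sin (of_real pi * z / of_real h) \<noteq> 0" if "z \<in> ?s" for z
        using that node_S sin0 by auto
    qed (use h in auto)
    ultimately have "residue (\<lambda>z. F z / sin (of_real pi * z / of_real h) / (z - of_real x)) (of_real x)
        = F (of_real x) / sin (of_real pi * of_real x / of_real h)"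
      by (rule residue_simple)
    then show ?thesis by (simp add: f_def mult_ac)
  qed
  also have "(\<Sum>j\<in>js. residue f (node j))
      = (\<Sum>j\<in>js. F (node j) / (node j - of_real x) * (of_real h / (of_real pi * of_real (cos (pi * of_int j)))))"
  proof (rule sum.cong[OF refl])
    fix j assume j: "j \<in> js"
    let ?s = "S - insert (of_real x) (node ` (js - {j}))"
    have "open ?s" using \<open>open S\<close> by (intro open_Diff finite_imp_closed) (auto simp: js_def)
    moreover have "node j \<in> ?s"
    proof -
      have "node j \<in> S" using node_box[OF j] cb box_subset_cbox by blast
      moreover have "node j \<noteq> of_real x" using x_node[of j] by simp
      moreover have "node j \<notin> node ` (js - {j})" using inj[of UNIV] by (auto simp: inj_on_def)
      ultimately show ?thesis by blast
    qed
    moreover have "f holomorphic_on ?s - {node j}"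
    proof (rule holomorphic_on_subset[OF holf])
      show "?s - {node j} \<subseteq> S - pts" by (auto simp: pts_def)
    qed
    \<comment> \<open>The zero of the sine at the node is simple, with derivative (pi/h)
      (-1)^j.\<close>
    moreover have "(\<lambda>w. f w * (w - node j)) \<midarrow>node j\<rightarrow>
        F (node j) / (node j - of_real x) * (of_real h / (of_real pi * of_real (cos (pi * of_int j))))"
    proof -
      let ?k = "of_real pi / of_real h * cos (of_real pi * node j / of_real h)"
      have arg: "of_real pi * node j / of_real h = of_real (pi * of_int j)"
        using h by (simp add: node_def)
      have cn: "cos (pi * of_int j) \<noteq> (0::real)"
      proof
        assume "cos (pi * of_int j) = (0::real)"
        then show False using sin_cos_squared_add[of "pi * of_int j"] by simp
      qed
      have k: "?k = of_real (pi * cos (pi * of_int j) / h)"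
        unfolding arg cos_of_real by simp
      have kne: "?k \<noteq> 0" unfolding k using cn h by simp
      have "((\<lambda>z. sin (of_real pi * z / of_real h)) has_field_derivative ?k) (at (node j))"
        using h by (auto intro!: derivative_eq_intros)
      moreover have "sin (of_real pi * node j / of_real h) = 0" using sin0 by blast
      ultimately have "(\<lambda>w. sin (of_real pi * w / of_real h) / (w - node j)) \<midarrow>node j\<rightarrow> ?k"
        by (simp add: has_field_derivative_iff)
      then have 1: "(\<lambda>w. inverse (sin (of_real pi * w / of_real h) / (w - node j))) \<midarrow>node j\<rightarrow> inverse ?k"
        by (rule tendsto_inverse[OF _ kne])
      have "isCont F (node j)"
      proof -
        have "node j \<in> strip d" using node_box[OF j] cb box_subset_cbox by (auto simp: S_def)
        then show ?thesis
          using F open_strip holomorphic_on_imp_continuous_on continuous_on_eq_continuous_at by blast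
      qed
      then have 2: "(\<lambda>w. F w / (w - of_real x)) \<midarrow>node j\<rightarrow> F (node j) / (node j - of_real x)"
        using x_node[of j] unfolding isCont_def by (intro tendsto_intros) auto
      have "(\<lambda>w. F w / (w - of_real x) * inverse (sin (of_real pi * w / of_real h) / (w - node j)))
          \<midarrow>node j\<rightarrow> F (node j) / (node j - of_real x) * inverse ?k"
        by (rule tendsto_mult[OF 2 1])
      moreover have "inverse ?k = of_real h / (of_real pi * of_real (cos (pi * of_int j)))"
        unfolding k by (simp add: field_simps)
      moreover have "F w / (w - of_real x) * inverse (sin (of_real pi * w / of_real h) / (w - node j)) = f w * (w - node j)" for w
        by (simp add: f_def divide_inverse mult_ac)
      ultimately show ?thesis by (simp only:)
    qed
    ultimately show "residue f (node j) = F (node j) / (node j - of_real x) * (of_real h / (of_real pi * of_real (cos (pi * of_int j))))"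
      by (rule residue_simple')
  qed
  finally have CI: "contour_integral (rectpath (Complex (- R) (- d')) (Complex R d')) f = of_real (2 * pi) * \<i> *
      (F (of_real x) / sin (of_real pi * of_real x / of_real h)
        + (\<Sum>j\<in>js. F (node j) / (node j - of_real x) * (of_real h / (of_real pi * of_real (cos (pi * of_int j))))))" .
  let ?sx = "complex_of_real (sin (pi * x / h))"
  have sx: "sin (of_real pi * of_real x / of_real h) = ?sx" by (simp flip: sin_of_real)
  have sx0: "?sx \<noteq> 0" using sin0[of "of_real x"] x_node unfolding sx by auto
  have "?sx / (2 * of_real pi * \<i>) * contour_integral (rectpath (Complex (- R) (- d')) (Complex R d')) f
      = F (of_real x) + (\<Sum>j\<in>js. ?sx * (F (node j) / (node j - of_real x) * (of_real h / (of_real pi * of_real (cos (pi * of_int j))))))"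
  proof -
    have "c / (2 * of_real pi * \<i>) * (of_real (2 * pi) * \<i> * (y / c + t)) = y + c * t"
      if "c \<noteq> 0" for c y t :: complex
      using that by (simp add: field_simps)
    from this[OF sx0] show ?thesis unfolding CI sx sum_distrib_left[symmetric] .
  qed
  also have "(\<Sum>j\<in>js. ?sx * (F (node j) / (node j - of_real x) * (of_real h / (of_real pi * of_real (cos (pi * of_int j))))))
      = (\<Sum>j\<in>js. - (F (node j) * of_real (sinc (pi * (x / h - of_int j)))))"
  proof (rule sum.cong[OF refl])
    fix j
    have "complex_of_real (sinc (pi * (x / h - of_int j)))
        = ?sx * (of_real h / (of_real pi * of_real (cos (pi * of_int j)) * (of_real x - node j)))"
      unfolding sinc_node[OF h x(2)] by (simp add: node_def)
    moreover have "of_real x - node j = - (node j - of_real x)" by simp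
    ultimately show "?sx * (F (node j) / (node j - of_real x) * (of_real h / (of_real pi * of_real (cos (pi * of_int j)))))
        = - (F (node j) * of_real (sinc (pi * (x / h - of_int j))))"
      by (simp only: mult_minus_right divide_minus_right) (simp add: mult_ac)
  qed
  finally show ?thesis
    by (simp add: sum_negf node_def js_def)
qed

lemma contour_integral_linepath_eq:
  assumes "continuous_on (closed_segment p q) f"
  shows "contour_integral (linepath p q) f = integral {0..1} (\<lambda>\<tau>. f (linepath p q \<tau>) * (q - p))"
  using has_contour_integral_integral[OF contour_integrable_continuous_linepath[OF assms]]
  unfolding has_contour_integral_linepath by (rule integral_unique[symmetric])

text \<open>The contribution of the two horizontal sides per unit of the majorant constant: twice
  the bound for one side, divided by 2 pi.\<close>

definition sinc_error :: "real \<Rightarrow> real \<Rightarrow> real" where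
  "sinc_error d h = h * (2 + pi) / (pi * d) / sinh (pi * d / h)"

text \<open>Integrating the residue formula in x turns sinc functions into differences of
  \<open>J\<close>. The horizontal sides are covered by \<open>side_integral_bound\<close>; on the
  vertical sides a crude bound is enough, because \<open>F\<close> is at most C/(1+R^2) there and
  this term disappears as M grows. The condition d' < d keeps the closed rectangle inside the open
  strip.\<close>

lemma sinc_quadrature_rectangle:
  fixes M :: nat
  assumes F: "strip_maj d C F" and d': "0 < d'" "d' < d" and h: "h > 0" and le: "X \<le> \<xi>"
    and R: "R = (of_nat M + 1 / 2) * h" and X: "\<bar>X\<bar> + 1 \<le> R" "\<bar>\<xi>\<bar> + 1 \<le> R"
  shows "cmod (integral {X..\<xi>} (\<lambda>x. F (of_real x))
      - (\<Sum>j=-int M..int M. F (of_real (of_int j * h)) * of_real (J j h \<xi> - J j h X)))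
    \<le> C * sinc_error d' h + (\<xi> - X) * (C * d' / (1 + R\<^sup>2))"
proof -
  define f where "f x z = F z / ((z - of_real x) * sin (of_real pi * z / of_real h))" for x :: real and z
  define p1 where "p1 = Complex (- R) (- d')"
  define p2 where "p2 = Complex R (- d')"
  define p3 where "p3 = Complex R d'"
  define p4 where "p4 = Complex (- R) d'"
  have C: "0 \<le> C" using strip_maj_nonneg[OF F, of 0] d' by (simp add: strip_def)
  have holF: "F holomorphic_on strip d" using strip_majD(1)[OF F] .
  define Sd where "Sd p q x = integral {0..1} (\<lambda>\<tau>. F (linepath p q \<tau>)
      / ((linepath p q \<tau> - of_real x) * sin (of_real pi * linepath p q \<tau> / of_real h)) * (q - p))" for p q x
  have side1: "continuous_on {X..\<xi>} (Sd p1 p2)"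
      "cmod (integral {X..\<xi>} (\<lambda>x. of_real (sin (pi * x / h)) * Sd p1 p2 x))
        \<le> C * pi / sinh (pi * d' / h) * (h / pi * (2 + pi) / d')"
    using side_integral_bound[OF F h le, of p1 "- d'" p2] d' unfolding Sd_def by (simp_all add: p1_def p2_def)
  have side2: "continuous_on {X..\<xi>} (Sd p3 p4)"
      "cmod (integral {X..\<xi>} (\<lambda>x. of_real (sin (pi * x / h)) * Sd p3 p4 x))
        \<le> C * pi / sinh (pi * d' / h) * (h / pi * (2 + pi) / d')"
    using side_integral_bound[OF F h le, of p3 "d'" p4] d' unfolding Sd_def by (simp_all add: p3_def p4_def)
  have R0: "R > 0" using X by linarith
  have sin_ne: "sin (of_real pi * z / of_real h) \<noteq> 0" if "Im z \<noteq> 0" for z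
  proof -
    have "\<bar>sinh (Im (of_real pi * z / of_real h))\<bar> > 0" using that h by simp
    then show ?thesis using cmod_sin_ge[of "of_real pi * z / of_real h"] by auto
  qed
  have sin_R: "1 \<le> cmod (sin (of_real pi * z / of_real h))" if "\<bar>Re z\<bar> = R" for z
  proof (rule cmod_sin_half_ge)
    have "\<bar>Re z\<bar> / h = of_nat M + 1 / 2" using h by (simp add: that R)
    then have "\<bar>2 * Re (of_real pi * z / of_real h)\<bar> = 2 * pi * of_nat M + pi"
      using h by (simp add: abs_mult field_simps)
    moreover have "cos (2 * pi * of_nat M + pi) = - 1"
      using cos_2npi[of M] by (simp add: cos_add mult_ac)
    ultimately show "cos (2 * Re (of_real pi * z / of_real h)) = - 1"
      using cos_abs_real by metis
  qed
  define V where "V p q x = contour_integral (linepath p q) (f x)" for p q x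
  have V_bd: "cmod (V p q x) \<le> C / (1 + R\<^sup>2) * (2 * d')" and V_cont: "continuous_on (closed_segment p q) (f x)"
    if pq: "(p = p2 \<and> q = p3) \<or> (p = p4 \<and> q = p1)" and x: "x \<in> {X..\<xi>}" for p q x
  proof -
    have seg: "\<bar>Re z\<bar> = R \<and> \<bar>Im z\<bar> \<le> d'" if "z \<in> closed_segment p q" for z
    proof -
      have "closed_segment p q \<subseteq> {z. Re z = Re p} \<inter> {z. \<bar>Im z\<bar> \<le> d'}"
      proof (rule closed_segment_subset)
        have "{z. Re z = Re p} \<inter> {z. \<bar>Im z\<bar> \<le> d'}
            = {z. Re z \<le> Re p} \<inter> {z. Re z \<ge> Re p} \<inter> ({z. Im z \<le> d'} \<inter> {z. Im z \<ge> - d'})" by auto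
        then show "convex ({z. Re z = Re p} \<inter> {z. \<bar>Im z\<bar> \<le> d'})"
          by (simp only: convex_Int convex_halfspace_Im_le convex_halfspace_Im_ge
              convex_halfspace_Re_le convex_halfspace_Re_ge)
      qed (use pq d' in \<open>auto simp: p1_def p2_def p3_def p4_def\<close>)
      moreover have "\<bar>Re p\<bar> = R" using pq R0 by (auto simp: p2_def p4_def)
      ultimately show ?thesis using that by auto
    qed
    have dist1: "1 \<le> cmod (z - of_real x)" if "z \<in> closed_segment p q" for z
    proof -
      have "1 \<le> \<bar>Re z - x\<bar>" using seg[OF that] X x by auto
      then show ?thesis using abs_Re_le_cmod[of "z - of_real x"] by simp
    qed
    have in_strip: "z \<in> strip d" if "z \<in> closed_segment p q" for z
      using seg[OF that] d' by (simp add: strip_def)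
    show c: "continuous_on (closed_segment p q) (f x)"
      unfolding f_def
    proof (intro continuous_intros)
      show "continuous_on (closed_segment p q) F"
        using holomorphic_on_imp_continuous_on[OF holF] in_strip continuous_on_subset by blast
      show "\<forall>z\<in>closed_segment p q. (z - of_real x) * sin (of_real pi * z / of_real h) \<noteq> 0"
        using dist1 sin_R seg by fastforce
    qed (use h in auto)
    have "cmod (contour_integral (linepath p q) (f x)) \<le> C / (1 + R\<^sup>2) * cmod (q - p)"
    proof (rule contour_integral_bound_linepath[OF contour_integrable_continuous_linepath[OF c]])
      show "0 \<le> C / (1 + R\<^sup>2)" using C by (simp add: add_nonneg_nonneg)
      fix z assume z: "z \<in> closed_segment p q"
      have "1 * 1 \<le> cmod (z - of_real x) * cmod (sin (of_real pi * z / of_real h))"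
        using dist1[OF z] sin_R[of z] seg[OF z] by (intro mult_mono) auto
      moreover have "(Re z)\<^sup>2 = R\<^sup>2" using seg[OF z] by (metis power2_abs)
      ultimately have "cmod (f x z) \<le> C / (1 + R\<^sup>2) / 1"
        unfolding f_def norm_divide norm_mult
        using strip_majD(2)[OF F in_strip[OF z]] C
        by (intro frac_le) (auto simp: add_nonneg_nonneg)
      then show "cmod (f x z) \<le> C / (1 + R\<^sup>2)" by simp
    qed
    moreover have "cmod (q - p) = 2 * d'"
      using pq d' cmod_eq_Im[of "q - p"] by (auto simp: p1_def p2_def p3_def p4_def)
    ultimately show "cmod (V p q x) \<le> C / (1 + R\<^sup>2) * (2 * d')" by (simp add: V_def)
  qed
  have S_contour: "contour_integral (linepath p q) (f x) = Sd p q x \<and> f x contour_integrable_on linepath p q"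
    if pq: "(p = p1 \<and> q = p2) \<or> (p = p3 \<and> q = p4)" for p q x
  proof -
    have seg: "\<bar>Im z\<bar> = d'" if "z \<in> closed_segment p q" for z
    proof -
      have "closed_segment p q \<subseteq> {z. Im z = Im p}"
      proof (rule closed_segment_subset)
        have "{z. Im z = Im p} = {z. Im z \<le> Im p} \<inter> {z. Im z \<ge> Im p}" by auto
        then show "convex {z. Im z = Im p}"
          by (simp only: convex_Int convex_halfspace_Im_le convex_halfspace_Im_ge)
      qed (use pq in \<open>auto simp: p1_def p2_def p3_def p4_def\<close>)
      moreover have "\<bar>Im p\<bar> = d'" using pq d' by (auto simp: p1_def p3_def)
      ultimately show ?thesis using that by auto
    qed
    have c: "continuous_on (closed_segment p q) (f x)"
      unfolding f_def
    proof (intro continuous_intros)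
      show "continuous_on (closed_segment p q) F"
      proof (rule continuous_on_subset[OF holomorphic_on_imp_continuous_on[OF holF]])
        show "closed_segment p q \<subseteq> strip d" using seg d' by (auto simp: strip_def)
      qed
      show "\<forall>z\<in>closed_segment p q. (z - of_real x) * sin (of_real pi * z / of_real h) \<noteq> 0"
      proof
        fix z assume "z \<in> closed_segment p q"
        then have "Im z \<noteq> 0" using seg d' by fastforce
        then show "(z - of_real x) * sin (of_real pi * z / of_real h) \<noteq> 0"
          using sin_ne[of z] by auto
      qed
    qed (use h in auto)
    show ?thesis
      using contour_integral_linepath_eq[OF c] contour_integrable_continuous_linepath[OF c]
      by (simp add: Sd_def f_def)
  qed
  let ?sn = "\<lambda>x. complex_of_real (sin (pi * x / h)) / (2 * of_real pi * \<i>)"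
  \<comment> \<open>The interpolation error without the horizontal sides. Away from the nodes it is
    the contribution of the vertical sides, while its integral can be evaluated term by
    term.\<close>
  define D where "D x = F (of_real x)
      - (\<Sum>j=-int M..int M. F (of_real (of_int j * h)) * of_real (sinc (pi * (x / h - of_int j))))
      - (1 / (2 * of_real pi * \<i>)) * (of_real (sin (pi * x / h)) * Sd p1 p2 x + of_real (sin (pi * x / h)) * Sd p3 p4 x)" for x
  define nodes where "nodes = (\<lambda>j::int. of_int j * h) ` {-int M..int M}"
  have D_bd: "cmod (D x) \<le> C * d' / (1 + R\<^sup>2)" if x: "x \<in> {X..\<xi>} - nodes" for x
  proof -
    have xR: "\<bar>x\<bar> < R" using x X by auto
    have x_ne: "x \<noteq> of_int j * h" for j :: int
    proof
      assume eq: "x = of_int j * h"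
      have "\<bar>of_int j\<bar> * h < (of_nat M + 1 / 2) * h"
        using xR h unfolding eq R by (simp add: abs_mult)
      then have "\<bar>of_int j\<bar> < (of_nat M + 1 / 2 :: real)" using h by (simp only: mult_less_cancel_right_pos)
      then have "j \<in> {-int M..int M}" by auto
      then show False using x eq by (auto simp: nodes_def)
    qed
    have CI: "contour_integral (rectpath p1 p3) (f x) = Sd p1 p2 x + (V p2 p3 x + (Sd p3 p4 x + V p4 p1 x))"
    proof -
      note i = S_contour[of p1 p2 x] S_contour[of p3 p4 x]
        contour_integrable_continuous_linepath[OF V_cont[of p2 p3 x]]
        contour_integrable_continuous_linepath[OF V_cont[of p4 p1 x]]
      have "rectpath p1 p3 = linepath p1 p2 +++ linepath p2 p3 +++ linepath p3 p4 +++ linepath p4 p1"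
        by (simp add: rectpath_def Let_def p1_def p2_def p3_def p4_def)
      then show ?thesis using i x by (simp add: V_def valid_path_join)
    qed
    have "D x = ?sn x * (V p2 p3 x + V p4 p1 x)"
    proof -
      have "c / k * (s1 + (v1 + (s2 + v2))) - 1 / k * (c * s1 + c * s2) = c / k * (v1 + v2)"
        for c k s1 s2 v1 v2 :: complex
        by (simp add: divide_inverse algebra_simps)
      then show ?thesis
        unfolding D_def sinc_residue_formula[OF holF d' h R xR x_ne, folded f_def p1_def p3_def] CI .
    qed
    also have "cmod \<dots> \<le> 1 / (2 * pi) * (C / (1 + R\<^sup>2) * (2 * d') + C / (1 + R\<^sup>2) * (2 * d'))"
      unfolding norm_mult
    proof (intro mult_mono norm_triangle_le add_mono V_bd)
      show "cmod (?sn x) \<le> 1 / (2 * pi)"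
        by (simp add: norm_divide norm_mult divide_right_mono)
    qed (use x in auto)
    also have "\<dots> = (2 / pi) * (C * d' / (1 + R\<^sup>2))" by simp
    also have "\<dots> \<le> 1 * (C * d' / (1 + R\<^sup>2))"
      using C d' pi_ge_two by (intro mult_right_mono) (auto simp: add_nonneg_nonneg)
    finally show ?thesis by simp
  qed
  have intF: "((\<lambda>x. F (of_real x)) has_integral integral {X..\<xi>} (\<lambda>x. F (of_real x))) {X..\<xi>}"
    using d' by (intro integrable_integral integrable_continuous_real cauchy_majD(1)[OF strip_maj_real[OF F]]) auto
  have intJ: "((\<lambda>x. complex_of_real (sinc (pi * (x / h - of_int j)))) has_integral of_real (J j h \<xi> - J j h X)) {X..\<xi>}" for j
  proof (rule has_integral_of_real, rule fundamental_theorem_of_calculus[OF le])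
    fix x
    show "(J j h has_vector_derivative sinc (pi * (x / h - real_of_int j))) (at x within {X..\<xi>})"
      unfolding has_real_derivative_iff_has_vector_derivative[symmetric]
      by (rule has_field_derivative_at_within[OF J_has_derivative[OF h]])
  qed
  have cs: "continuous_on {X..\<xi>} (\<lambda>x. complex_of_real (sin (pi * x / h)))"
    by (intro continuous_intros) (use h in auto)
  have intS: "((\<lambda>x. of_real (sin (pi * x / h)) * Sd p q x) has_integral
      integral {X..\<xi>} (\<lambda>x. of_real (sin (pi * x / h)) * Sd p q x)) {X..\<xi>}"
    if "continuous_on {X..\<xi>} (Sd p q)" for p q
    by (intro integrable_integral integrable_continuous_real continuous_on_mult cs that)
  let ?I = "integral {X..\<xi>} (\<lambda>x. F (of_real x))
      - (\<Sum>j=-int M..int M. F (of_real (of_int j * h)) * of_real (J j h \<xi> - J j h X))"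
  let ?S = "(1 / (2 * of_real pi * \<i>)) * (integral {X..\<xi>} (\<lambda>x. of_real (sin (pi * x / h)) * Sd p1 p2 x)
      + integral {X..\<xi>} (\<lambda>x. of_real (sin (pi * x / h)) * Sd p3 p4 x))"
  have intD: "(D has_integral (?I - ?S)) (cbox X \<xi>)"
    unfolding D_def cbox_interval
    by (intro has_integral_diff has_integral_add has_integral_mult_right has_integral_sum intF intJ
        intS side1 side2) auto
  have "cmod (?I - ?S) \<le> C * d' / (1 + R\<^sup>2) * measure lborel (cbox X \<xi>)"
  proof (rule has_integral_bound_spike_finite[OF _ _ intD])
    show "finite nodes" by (simp add: nodes_def)
    show "cmod (D x) \<le> C * d' / (1 + R\<^sup>2)" if "x \<in> cbox X \<xi> - nodes" for x
      using D_bd that by simp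
  qed (use C d' in \<open>auto simp: add_nonneg_nonneg\<close>)
  moreover have "measure lborel (cbox X \<xi>) = \<xi> - X" using le by simp
  ultimately have 1: "cmod (?I - ?S) \<le> (\<xi> - X) * (C * d' / (1 + R\<^sup>2))"
    by (simp only: mult.commute)
  have 2: "cmod ?S \<le> 1 / (2 * pi) * (C * pi / sinh (pi * d' / h) * (h / pi * (2 + pi) / d')
      + C * pi / sinh (pi * d' / h) * (h / pi * (2 + pi) / d'))"
    unfolding norm_mult
    by (intro mult_mono norm_triangle_le add_mono side1 side2) (auto simp: norm_divide norm_mult)
  have "cmod ?I \<le> cmod (?I - ?S) + cmod ?S" using norm_triangle_sub[of ?I ?S] by simp
  also have "\<dots> \<le> (\<xi> - X) * (C * d' / (1 + R\<^sup>2))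
      + 1 / (2 * pi) * (C * pi / sinh (pi * d' / h) * (h / pi * (2 + pi) / d')
      + C * pi / sinh (pi * d' / h) * (h / pi * (2 + pi) / d'))"
    by (intro add_mono 1 2)
  also have "\<dots> = C * sinc_error d' h + (\<xi> - X) * (C * d' / (1 + R\<^sup>2))"
    by (simp add: sinc_error_def)
  finally show ?thesis .
qed

text \<open>The strengthened bound with 1 - exp(-M h) is what the induction needs: by h <= exp h -
  1, each new term is at most a telescoping difference. The result is the integral of exp(-|x|) plus
  the central term h, whatever M is.\<close>

lemma geometric_node_sum:
  fixes h :: real and M :: nat
  assumes "h > 0"
  shows "(\<Sum>j=-int M..int M. h * exp (- \<bar>of_int j * h\<bar>)) \<le> h + 2"
proof -
  have "(\<Sum>j=-int M..int M. h * exp (- \<bar>of_int j * h\<bar>)) \<le> h + 2 * (1 - exp (- (of_nat M * h)))"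
  proof (induction M)
    case (Suc M)
    have eq: "{-int (Suc M)..int (Suc M)} = insert (int (Suc M)) (insert (- int (Suc M)) {-int M..int M})"
      by auto
    have "(\<Sum>j=-int (Suc M)..int (Suc M). h * exp (- \<bar>of_int j * h\<bar>))
        = 2 * (h * exp (- ((1 + of_nat M) * h))) + (\<Sum>j=-int M..int M. h * exp (- \<bar>of_int j * h\<bar>))"
      unfolding eq using assms by (simp add: abs_mult add.commute)
    also have "h * exp (- ((1 + of_nat M) * h)) \<le> (exp h - 1) * exp (- ((1 + of_nat M) * h))"
    proof (rule mult_right_mono)
      show "h \<le> exp h - 1" using exp_ge_add_one_self[of h] by linarith
    qed simp
    also have "\<dots> = exp (- (of_nat M * h)) - exp (- ((1 + of_nat M) * h))"
      by (simp add: algebra_simps flip: exp_add)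
    finally show ?case using Suc by (simp add: algebra_simps)
  qed simp
  also have "\<dots> \<le> h + 2" by simp
  finally show ?thesis .
qed

text \<open>Three limits are taken. A rectangle with M >= N nodes on each side is compared with the
  N of the scheme, the nodes in between costing the truncation term; as M tends to infinity the
  vertical sides vanish; then d' tends to d, and the lower limit X to minus infinity, where
  \<open>J\<close> vanishes.\<close>

lemma sinc_quadrature:
  fixes N :: nat
  assumes F: "de_maj d s C F" and d: "0 < d" and s: "0 \<le> s" and h: "h > 0" "h \<le> 1"
    and B: "\<And>x. \<bar>sinc_step x\<bar> \<le> B"
  shows "cmod (integral {..\<xi>} (\<lambda>x. F (of_real x))
      - (\<Sum>j=-int N..int N. F (of_real (of_int j * h)) * of_real (J j h \<xi>)))
    \<le> C * (sinc_error d h + 6 * B * exp (- s / 4 * exp (of_nat N * h)))"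
proof -
  have Fs: "strip_maj d C F" and Fr: "\<And>x. cmod (F (of_real x)) \<le> C * de_weight s x"
    using F by (auto simp: de_maj_def)
  have C: "0 \<le> C" using strip_maj_nonneg[OF Fs, of 0] d by (simp add: strip_def)
  have B0: "0 \<le> B" using B[of 0] by linarith
  let ?F = "\<lambda>x. F (complex_of_real x)"
  \<comment> \<open>The double exponential factor of \<open>de_weight\<close> at the last node;
    beyond it only the other factor exp(-|jh|) is summed.\<close>
  define t where "t = exp (- s / 4 * exp (of_nat N * h))"
  define E where "E M X = integral {X..\<xi>} ?F
      - (\<Sum>j=-int M..int M. ?F (of_int j * h) * of_real (J j h \<xi> - J j h X))" for M :: nat and X
  have trunc: "cmod (E N X - E M X) \<le> C * (6 * B * t)" if "M \<ge> N" for M X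
  proof -
    let ?J = "{-int M..int M} - {-int N..int N}"
    have "E N X - E M X = (\<Sum>j\<in>?J. ?F (of_int j * h) * of_real (J j h \<xi> - J j h X))"
      unfolding E_def using that by (subst sum_diff) auto
    also have "cmod \<dots> \<le> (\<Sum>j\<in>?J. C * (2 * B * t) * (h * exp (- \<bar>of_int j * h\<bar>)))"
    proof (rule sum_norm_le)
      fix j assume j: "j \<in> ?J"
      then have "of_nat N * h \<le> \<bar>of_int j * h\<bar>"
        unfolding abs_mult using h by (intro mult_mono) auto
      then have "exp (- s / 4 * exp \<bar>of_int j * h\<bar>) \<le> t"
        unfolding t_def using s by (simp add: mult_left_mono)
      then have "de_weight s (of_int j * h) \<le> exp (- \<bar>of_int j * h\<bar>) * t"
        unfolding de_weight_def by (intro mult_left_mono) auto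
      then have 1: "cmod (?F (of_int j * h)) \<le> C * (exp (- \<bar>of_int j * h\<bar>) * t)"
        using Fr C mult_left_mono order_trans by blast
      have "\<bar>J j h \<xi> - J j h X\<bar> \<le> h * (2 * B)"
      proof -
        have "J j h \<xi> - J j h X = h * (sinc_step (\<xi> / h - of_int j) - sinc_step (X / h - of_int j))"
          by (simp add: J_eq_sinc_step right_diff_distrib)
        moreover have "\<bar>sinc_step (\<xi> / h - of_int j) - sinc_step (X / h - of_int j)\<bar> \<le> 2 * B"
          using B[of "\<xi> / h - of_int j"] B[of "X / h - of_int j"] by linarith
        ultimately show ?thesis using h by (simp add: abs_mult mult_left_mono)
      qed
      then have "cmod (?F (of_int j * h) * of_real (J j h \<xi> - J j h X))
          \<le> C * (exp (- \<bar>of_int j * h\<bar>) * t) * (h * (2 * B))"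
        unfolding norm_mult norm_of_real
        by (intro mult_mono 1) (use C in \<open>auto simp: t_def\<close>)
      then show "cmod (?F (of_int j * h) * of_real (J j h \<xi> - J j h X))
          \<le> C * (2 * B * t) * (h * exp (- \<bar>of_int j * h\<bar>))" by (simp add: mult_ac)
    qed
    also have "\<dots> = C * (2 * B * t) * (\<Sum>j\<in>?J. h * exp (- \<bar>of_int j * h\<bar>))"
      by (simp add: sum_distrib_left)
    also have "(\<Sum>j\<in>?J. h * exp (- \<bar>of_int j * h\<bar>)) \<le> (\<Sum>j=-int M..int M. h * exp (- \<bar>of_int j * h\<bar>))"
      by (rule sum_mono2) (use h in auto)
    also have "\<dots> \<le> h + 2" by (rule geometric_node_sum[OF h(1)])
    \<comment> \<open>The constant 6 B is 2 B for the difference of two values of \<open>J\<close>,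
      times 3 >= h + 2 for the sum over the nodes.\<close>
    also have "C * (2 * B * t) * (h + 2) \<le> C * (2 * B * t) * 3"
      using C B0 h by (intro mult_left_mono) (auto simp: t_def)
    finally show ?thesis using C B0 by (simp add: t_def mult_left_mono)
  qed
  have 1: "cmod (E N X) \<le> C * sinc_error d' h + C * (6 * B * t)" if X: "X \<le> \<xi>" and d': "0 < d'" "d' < d" for X d'
  proof -
    let ?R = "\<lambda>M::nat. (of_nat M + 1 / 2) * h"
    have top: "filterlim ?R at_top sequentially" using h by real_asymp
    have "(\<lambda>M. C * d' / (1 + (?R M)\<^sup>2)) \<longlonglongrightarrow> 0" using h by real_asymp
    then have "(\<lambda>M. C * sinc_error d' h + (\<xi> - X) * (C * d' / (1 + (?R M)\<^sup>2)) + C * (6 * B * t))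
        \<longlonglongrightarrow> C * sinc_error d' h + (\<xi> - X) * 0 + C * (6 * B * t)"
      by (intro tendsto_intros)
    moreover have "\<forall>\<^sub>F M in sequentially. cmod (E N X)
        \<le> C * sinc_error d' h + (\<xi> - X) * (C * d' / (1 + (?R M)\<^sup>2)) + C * (6 * B * t)"
      using eventually_ge_at_top[of N] filterlim_at_top[THEN iffD1, OF top, rule_format, of "\<bar>X\<bar> + 1"]
        filterlim_at_top[THEN iffD1, OF top, rule_format, of "\<bar>\<xi>\<bar> + 1"]
    proof eventually_elim
      case (elim M)
      have "cmod (E M X) \<le> C * sinc_error d' h + (\<xi> - X) * (C * d' / (1 + (?R M)\<^sup>2))"
        unfolding E_def by (rule sinc_quadrature_rectangle[OF Fs d' h(1) X refl elim(2,3)])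
      then show ?case using trunc[OF elim(1), of X] norm_triangle_sub[of "E N X" "E M X"] by linarith
    qed
    ultimately have "cmod (E N X) \<le> C * sinc_error d' h + (\<xi> - X) * 0 + C * (6 * B * t)"
      by (rule tendsto_lowerbound) simp
    then show ?thesis by simp
  qed
  have 2: "cmod (E N X) \<le> C * sinc_error d h + C * (6 * B * t)" if X: "X \<le> \<xi>" for X
  proof -
    \<comment> \<open>The quadrature error does not depend on d', so its bound extends to d by
      continuity although the contour cannot reach the boundary.\<close>
    have "isCont (\<lambda>d'. sinc_error d' h) d"
      unfolding sinc_error_def[abs_def] using d h by (intro continuous_intros) auto
    then have "((\<lambda>d'. C * sinc_error d' h + C * (6 * B * t)) \<longlongrightarrow> C * sinc_error d h + C * (6 * B * t)) (at_left d)"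
      unfolding isCont_def by (intro tendsto_intros) (rule filterlim_mono[OF _ order_refl at_le], auto)
    moreover have "\<forall>\<^sub>F d' in at_left d. cmod (E N X) \<le> C * sinc_error d' h + C * (6 * B * t)"
      using eventually_at_left_real[OF d] by eventually_elim (use 1[OF X] in auto)
    ultimately show ?thesis by (rule tendsto_lowerbound) simp
  qed
  let ?L = "integral {..\<xi>} ?F - (\<Sum>j=-int N..int N. ?F (of_int j * h) * of_real (J j h \<xi> - 0))"
  have "((\<lambda>X. E N X) \<longlongrightarrow> ?L) at_bot"
    unfolding E_def
    by (intro tendsto_intros cauchy_maj_tendsto[OF strip_maj_real[OF Fs d]] J_at_bot h)
  then have "((\<lambda>X. cmod (E N X)) \<longlongrightarrow> cmod ?L) at_bot" by (rule tendsto_norm)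
  moreover have "\<forall>\<^sub>F X in at_bot. cmod (E N X) \<le> C * sinc_error d h + C * (6 * B * t)"
    using eventually_le_at_bot[of \<xi>] by eventually_elim (rule 2)
  ultimately have "cmod ?L \<le> C * sinc_error d h + C * (6 * B * t)"
    by (rule tendsto_upperbound) simp
  then show ?thesis by (simp add: t_def distrib_left)
qed

text \<open>The assumption h <= pi d puts the argument p of sinh at 1 or beyond, where sinh p >=
  exp(p)/4.\<close>

lemma sinc_error_le:
  assumes "d > 0" "h > 0" "h \<le> pi * d"
  shows "sinc_error d h \<le> 4 * (2 + pi) / (pi * d) * (h * exp (- (pi * d / h)))"
proof -
  have p: "1 \<le> pi * d / h" using assms by simp
  have "sinc_error d h \<le> h * (2 + pi) / (pi * d) / (exp (pi * d / h) / 4)"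
    unfolding sinc_error_def using assms p exp_quarter_le_sinh[OF p]
    by (intro divide_left_mono) (auto intro!: divide_nonneg_pos mult_nonneg_nonneg)
  also have "\<dots> = 4 * (2 + pi) / (pi * d) * (h * exp (- (pi * d / h)))"
  proof -
    have "x * y / z / (w / 4) = 4 * y / z * (x * inverse w)" for x y z w :: real
      by (simp add: field_simps)
    then show ?thesis by (simp only: exp_minus)
  qed
  finally show ?thesis .
qed

text \<open>The mesh size is made for exp(N h) = 2 d N/\<alpha>. The truncation factor becomes
  exp(-pi d N/2), while pi d/h is pi d N/log(2 d N/\<alpha>), of smaller order than N; so truncation
  eventually falls below the contour error, even with its factor h.\<close>

lemma DE_mesh_eventually:
  assumes "0 < \<alpha>" "0 < d" "0 < (h0::real)"
  shows "\<forall>\<^sub>F N in sequentially. 0 < hDE d \<alpha> N \<and> hDE d \<alpha> N \<le> h0 \<and>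
    exp (- (pi * \<alpha>) / 4 * exp (of_nat N * hDE d \<alpha> N)) \<le> hDE d \<alpha> N * exp (- (pi * d / hDE d \<alpha> N))"
proof -
  have "\<forall>\<^sub>F N::nat in sequentially. ln (2 * d * real N / \<alpha>) / real N < h0"
    using assms by real_asymp
  moreover have "\<forall>\<^sub>F N::nat in sequentially. 0 < ln (2 * d * real N / \<alpha>) / real N"
    using assms by real_asymp
  moreover have "\<forall>\<^sub>F N::nat in sequentially. exp (- pi / 2 * d * real N)
      \<le> ln (2 * d * real N / \<alpha>) / real N * exp (- (pi * d / (ln (2 * d * real N / \<alpha>) / real N)))"
    using assms by real_asymp
  ultimately show ?thesis using eventually_gt_at_top[of 0]
  proof eventually_elim
    case (elim N)
    have "exp (of_nat N * hDE d \<alpha> N) = 2 * d * real N / \<alpha>"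
      using elim(4) assms by (simp add: hDE_def)
    then have eq: "- (pi * \<alpha>) / 4 * exp (of_nat N * hDE d \<alpha> N) = - pi / 2 * d * real N"
      using assms by simp
    show ?case using elim(1-3) unfolding eq by (simp only: hDE_def) simp
  qed
qed

section \<open>Stability of the discrete Volterra operator\<close>

text \<open>The induction runs over the right-hand side r + sum rather than over \<open>f\<close>:
  each step multiplies it by at most 1 + b i <= exp(b i). That the sum stops before i is where
  strict triangularity enters.\<close>

lemma discrete_gronwall:
  fixes f b :: "int \<Rightarrow> real"
  assumes step: "\<And>i. l \<le> i \<Longrightarrow> i \<le> u \<Longrightarrow> f i \<le> r + (\<Sum>j=l..<i. b j * f j)"
    and b: "\<And>j. 0 \<le> b j" and i: "l \<le> i" "i \<le> u" and r: "0 \<le> r"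
  shows "f i \<le> r * exp (\<Sum>j=l..<i. b j)"
proof -
  have "i \<le> u \<longrightarrow> r + (\<Sum>j=l..<i. b j * f j) \<le> r * exp (\<Sum>j=l..<i. b j)"
    using i(1)
  proof (induction i rule: int_ge_induct)
    case base
    show ?case by simp
  next
    case (step i)
    show ?case
    proof
      assume u: "i + 1 \<le> u"
      let ?R = "r + (\<Sum>j=l..<i. b j * f j)" and ?e = "\<Sum>j=l..<i. b j"
      have R: "?R \<le> r * exp ?e" using step u by simp
      have eq: "{l..<i + 1} = insert i {l..<i}" using step by auto
      have "r + (\<Sum>j=l..<i + 1. b j * f j) = ?R + b i * f i" unfolding eq by simp
      also have "\<dots> \<le> ?R + b i * ?R"
        using assms(1)[of i] step u b by (intro add_left_mono mult_left_mono) auto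
      also have "\<dots> = (1 + b i) * ?R" by (simp add: algebra_simps)
      also have "\<dots> \<le> (1 + b i) * (r * exp ?e)" using R b[of i] by (intro mult_left_mono) auto
      also have "\<dots> \<le> exp (b i) * (r * exp ?e)"
        using exp_ge_add_one_self[of "b i"] r by (intro mult_right_mono) auto
      also have "\<dots> = r * exp (\<Sum>j=l..<i + 1. b j)" unfolding eq by (simp add: exp_add)
      finally show "r + (\<Sum>j=l..<i + 1. b j * f j) \<le> r * exp (\<Sum>j=l..<i + 1. b j)" .
    qed
  qed
  then show ?thesis using assms(1)[OF i] i by simp
qed

text \<open>Up to an error of order \<open>sqrt h\<close> the full discrete kernel is strictly lower triangular:
  nodes within distance \<open>1 / sqrt h\<close> of the diagonal are few, and further away
  \<^const>\<open>sinc_step\<close> is within \<open>sqrt h\<close> of the Heaviside function.\<close>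

lemma sinc_step_kernel_split:
  fixes x :: "int \<Rightarrow> complex"
  assumes h: "0 < h" "h \<le> 1" and B: "\<And>t. \<bar>sinc_step t\<bar> \<le> B" "1 \<le> B"
    and x: "\<And>j. j \<in> {-int N..int N} \<Longrightarrow> cmod (x j) \<le> X * exp (- \<bar>of_int j * h\<bar>)"
    and i: "i \<in> {-int N..int N}"
  shows "cmod (\<Sum>j=-int N..int N. of_real (h * sinc_step (of_int (i - j))) * x j)
    \<le> (\<Sum>j=-int N..<i. h * cmod (x j)) + X * (6 * B * sqrt h)"
proof -
  let ?I = "{-int N..int N}"
  \<comment> \<open>The diagonal value is set to 0 to make the operator strictly lower triangular;
    the value 1/2 of \<open>sinc_step\<close> at 0 goes into the error.\<close>
  define H where "H j = (if j < i then 1 else 0 :: real)" for j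
  define r where "r = 1 / sqrt h"
  define near where "near = {j \<in> ?I. \<bar>of_int (i - j)\<bar> \<le> r}"
  have sq: "sqrt h * sqrt h = h" "sqrt h > 0" "h \<le> sqrt h"
    using h by (auto simp: real_le_rsqrt power2_eq_square mult_left_le)
  have X0: "X \<ge> 0"
    using x[OF i] norm_ge_zero[of "x i"] by (metis exp_gt_zero order_trans zero_le_mult_iff not_less)
  have w_le: "cmod (x j) \<le> X" if "j \<in> ?I" for j
  proof -
    have "X * exp (- \<bar>of_int j * h\<bar>) \<le> X * 1" using X0 by (intro mult_left_mono) auto
    then show ?thesis using x[OF that] by simp
  qed
  have term_le: "\<bar>sinc_step (of_int (i - j)) - H j\<bar> * cmod (x j)
      \<le> sqrt h * (X * exp (- \<bar>of_int j * h\<bar>)) + (if j \<in> near then B * X else 0)" if j: "j \<in> ?I" for j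
  proof (cases "j \<in> near")
    case True
    have "\<bar>sinc_step (of_int (i - j)) - H j\<bar> \<le> B"
    proof (cases "i = j")
      case True
      then show ?thesis using B(1)[of 0] by (simp add: H_def)
    next
      case False
      then have "\<bar>sinc_step (of_int (i - j)) - H j\<bar> \<le> 1 / \<bar>of_int (i - j)\<bar>"
        using sinc_step_tail[of "of_int (i - j)"] by (simp add: H_def)
      also have "\<dots> \<le> 1" using False by (simp add: divide_le_eq)
      finally show ?thesis using B(2) by simp
    qed
    then have "\<bar>sinc_step (of_int (i - j)) - H j\<bar> * cmod (x j) \<le> B * X"
      using w_le[OF j] B(2) by (intro mult_mono) auto
    then show ?thesis using True sq X0 by (simp add: add_increasing)
  next
    case False
    then have far: "r < \<bar>of_int (i - j)\<bar>" using j by (simp add: near_def)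
    have r0: "r > 0" using sq by (simp add: r_def)
    have ne: "i \<noteq> j" using far r0 by auto
    then have "\<bar>sinc_step (of_int (i - j)) - H j\<bar> \<le> 1 / \<bar>of_int (i - j)\<bar>"
      using sinc_step_tail[of "of_int (i - j)"] by (simp add: H_def)
    also have "\<dots> \<le> 1 / r" using far r0 by (intro divide_left_mono) auto
    also have "1 / r = sqrt h" by (simp add: r_def)
    finally have "\<bar>sinc_step (of_int (i - j)) - H j\<bar> * cmod (x j) \<le> sqrt h * (X * exp (- \<bar>of_int j * h\<bar>))"
      using x[OF j] sq by (intro mult_mono) auto
    then show ?thesis using False by simp
  qed
  have card_near: "of_nat (card near) \<le> 2 * r + 1"
  proof -
    have "near \<subseteq> {i - \<lfloor>r\<rfloor>..i + \<lfloor>r\<rfloor>}"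
    proof
      fix j assume "j \<in> near"
      then have "of_int \<bar>i - j\<bar> \<le> r" by (simp add: near_def)
      then have "\<bar>i - j\<bar> \<le> \<lfloor>r\<rfloor>" by (simp add: le_floor_iff)
      then show "j \<in> {i - \<lfloor>r\<rfloor>..i + \<lfloor>r\<rfloor>}" by auto
    qed
    then have "card near \<le> card {i - \<lfloor>r\<rfloor>..i + \<lfloor>r\<rfloor>}" by (intro card_mono) auto
    also have "\<dots> = nat (2 * \<lfloor>r\<rfloor> + 1)" by simp
    finally have "int (card near) \<le> int (nat (2 * \<lfloor>r\<rfloor> + 1))" by (simp only: of_nat_le_iff)
    moreover have "0 \<le> \<lfloor>r\<rfloor>" using sq(2) by (simp add: r_def)
    ultimately have "int (card near) \<le> 2 * \<lfloor>r\<rfloor> + 1" by simp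
    then have "real_of_int (int (card near)) \<le> real_of_int (2 * \<lfloor>r\<rfloor> + 1)"
      by (simp only: of_int_le_iff)
    then have "real (card near) \<le> 2 * real_of_int \<lfloor>r\<rfloor> + 1" by simp
    then show ?thesis using of_int_floor_le[of r] by linarith
  qed
  have split: "(\<Sum>j\<in>?I. of_real (h * sinc_step (of_int (i - j))) * x j)
      = (\<Sum>j\<in>?I. of_real (h * H j) * x j) + (\<Sum>j\<in>?I. of_real (h * (sinc_step (of_int (i - j)) - H j)) * x j)"
    unfolding sum.distrib[symmetric] by (intro sum.cong) (auto simp: algebra_simps)
  have "cmod (\<Sum>j\<in>?I. of_real (h * H j) * x j) \<le> (\<Sum>j=-int N..<i. h * cmod (x j))"
  proof -
    have "(\<Sum>j\<in>?I. of_real (h * H j) * x j) = (\<Sum>j=-int N..<i. of_real h * x j)"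
      by (rule sum.mono_neutral_cong_right) (use i in \<open>auto simp: H_def\<close>)
    then show ?thesis using h by (auto intro!: sum_norm_le simp: norm_mult)
  qed
  moreover have "cmod (\<Sum>j\<in>?I. of_real (h * (sinc_step (of_int (i - j)) - H j)) * x j) \<le> X * (6 * B * sqrt h)"
  proof -
    have "cmod (\<Sum>j\<in>?I. of_real (h * (sinc_step (of_int (i - j)) - H j)) * x j)
        \<le> (\<Sum>j\<in>?I. h * (sqrt h * (X * exp (- \<bar>of_int j * h\<bar>)) + (if j \<in> near then B * X else 0)))"
    proof (rule sum_norm_le)
      fix j assume j: "j \<in> ?I"
      have "cmod (of_real (h * (sinc_step (of_int (i - j)) - H j)) * x j) = h * (\<bar>sinc_step (of_int (i - j)) - H j\<bar> * cmod (x j))"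
        using h by (simp add: norm_mult abs_mult flip: of_real_diff of_real_mult)
      then show "cmod (of_real (h * (sinc_step (of_int (i - j)) - H j)) * x j)
          \<le> h * (sqrt h * (X * exp (- \<bar>of_int j * h\<bar>)) + (if j \<in> near then B * X else 0))"
        using term_le[OF j] h by (simp only: mult_left_mono less_imp_le)
    qed
    also have "\<dots> = sqrt h * X * (\<Sum>j\<in>?I. h * exp (- \<bar>of_int j * h\<bar>)) + h * (\<Sum>j\<in>?I. if j \<in> near then B * X else 0)"
      by (simp add: sum.distrib distrib_left sum_distrib_left mult_ac)
    also have "(\<Sum>j\<in>?I. if j \<in> near then B * X else 0) = of_nat (card near) * (B * X)"
      by (simp add: near_def flip: sum.inter_filter)
    also have "sqrt h * X * (\<Sum>j\<in>?I. h * exp (- \<bar>of_int j * h\<bar>)) \<le> sqrt h * X * 3"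
      using geometric_node_sum[OF h(1), of N] h X0 sq by (intro mult_left_mono) auto
    also have "h * (of_nat (card near) * (B * X)) \<le> h * ((2 * r + 1) * (B * X))"
      using card_near h B X0 by (intro mult_left_mono mult_right_mono) auto
    \<comment> \<open>Here h r = sqrt h: the near nodes number about 2/sqrt h and each has weight
      h.\<close>
    also have "h * ((2 * r + 1) * (B * X)) = (2 * sqrt h + h) * (B * X)"
    proof -
      have "h * r = sqrt h" using sq h by (simp add: r_def field_simps)
      then show ?thesis by (simp add: algebra_simps)
    qed
    also have "\<dots> \<le> (2 * sqrt h + sqrt h) * (B * X)"
      using sq B X0 by (intro mult_right_mono) auto
    also have "sqrt h * X * 3 + (2 * sqrt h + sqrt h) * (B * X) \<le> X * (6 * B * sqrt h)"
    proof -
      have "sqrt h * X * 1 \<le> sqrt h * X * B" using B X0 sq by (intro mult_left_mono) auto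
      then show ?thesis by (simp add: algebra_simps)
    qed
    finally show ?thesis by simp
  qed
  ultimately show ?thesis unfolding split by (rule norm_triangle_le[OF add_mono])
qed

text \<open>The matrix of the scheme acting on grid functions, with \<open>A\<close>, \<open>D\<close> and \<open>K\<close> standing for
  \<open>\<mu> \<psi>'\<close>, \<open>\<psi>'\<close> and \<open>k \<psi>'\<close> at the nodes.\<close>

definition discrete_inner :: "real \<Rightarrow> nat \<Rightarrow> (int \<Rightarrow> int \<Rightarrow> complex) \<Rightarrow> (int \<Rightarrow> complex) \<Rightarrow> int \<Rightarrow> complex" where
  "discrete_inner h N K c j = (\<Sum>m=-int N..int N. of_real (h * sinc_step (of_int (j - m))) * (K j m * c m))"

definition discrete_op :: "real \<Rightarrow> nat \<Rightarrow> (int \<Rightarrow> complex) \<Rightarrow> (int \<Rightarrow> complex) \<Rightarrow> (int \<Rightarrow> int \<Rightarrow> complex) \<Rightarrow>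
    (int \<Rightarrow> complex) \<Rightarrow> int \<Rightarrow> complex" where
  "discrete_op h N A D K c i = (\<Sum>j=-int N..int N. of_real (h * sinc_step (of_int (i - j)))
     * (A j * c j + D j * discrete_inner h N K c j))"

text \<open>The constants depend on \<open>C\<close> alone, hence not on N. With \<gamma> the
  maximum of |c|, replacing both kernels by triangular ones costs O(\<gamma> sqrt h). Gronwall's
  inequality bounds \<gamma> by a multiple of \<rho> plus that error, and for small h the error is
  absorbed on the left. With \<rho> = 0 the statement gives injectivity.\<close>

theorem discrete_stability:
  fixes C :: real
  assumes C: "0 \<le> C"
  obtains h0 Cs where "h0 > 0" "h0 \<le> 1" "Cs > 0"
    "\<And>h N A D K c \<rho> i. 0 < h \<Longrightarrow> h \<le> h0 \<Longrightarrow>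
      (\<And>j. cmod (A j) \<le> C * exp (- \<bar>of_int j * h\<bar>)) \<Longrightarrow>
      (\<And>j. cmod (D j) \<le> C * exp (- \<bar>of_int j * h\<bar>)) \<Longrightarrow>
      (\<And>j m. cmod (K j m) \<le> C * exp (- \<bar>of_int m * h\<bar>)) \<Longrightarrow>
      (\<And>i. i \<in> {-int N..int N} \<Longrightarrow> cmod (c i - discrete_op h N A D K c i) \<le> \<rho>) \<Longrightarrow>
      i \<in> {-int N..int N} \<Longrightarrow> cmod (c i) \<le> Cs * \<rho>"
proof -
  obtain B where B: "B \<ge> 1" "\<And>x. \<bar>sinc_step x\<bar> \<le> B" using sinc_step_bounded by metis
  \<comment> \<open>First summand: the error of the inner kernel, summed by the outer triangular
    operator. Second summand: the error of the outer kernel applied to \<open>x\<close>, which is at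
    most C (1 + 9 B C) \<gamma> exp(-|jh|).\<close>
  define E where "E = 3 * C * (6 * B * C) + 6 * B * C * (1 + 9 * B * C)"
  define G where "G = exp ((1 + 3 * C) * (3 * C))"
  have E0: "E \<ge> 0" and G0: "G > 0" using B C by (auto simp: E_def G_def intro!: add_nonneg_nonneg mult_nonneg_nonneg)
  \<comment> \<open>Ensures G E sqrt h <= 1/2 for the absorption at the end.\<close>
  define h0 where "h0 = min 1 ((1 / (2 * (G * E + 1)))\<^sup>2)"
  have GE: "G * E + 1 > 0" using E0 G0 by (simp add: add_nonneg_pos)
  show ?thesis
  proof (rule that[of h0 "2 * G"])
    show "h0 > 0" using GE by (simp add: h0_def)
    show "h0 \<le> 1" by (simp add: h0_def)
    show "2 * G > 0" using G0 by simp
    fix h N A D K c \<rho> i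
    assume h: "0 < h" "h \<le> h0"
      and A: "\<And>j. cmod (A j) \<le> C * exp (- \<bar>of_int j * h\<bar>)"
      and D: "\<And>j. cmod (D j) \<le> C * exp (- \<bar>of_int j * h\<bar>)"
      and K: "\<And>j m. cmod (K j m) \<le> C * exp (- \<bar>of_int m * h\<bar>)"
      and c: "\<And>i. i \<in> {-int N..int N} \<Longrightarrow> cmod (c i - discrete_op h N A D K c i) \<le> \<rho>"
      and i: "i \<in> {-int N..int N}"
    let ?I = "{-int N..int N}"
    have h1: "h \<le> 1" using h by (simp add: h0_def)
    have sq: "sqrt h \<ge> 0" "sqrt h \<le> 1" using h h1 by auto
    have \<rho>: "\<rho> \<ge> 0" using c[OF i] norm_ge_zero order_trans by blast
    define \<gamma> where "\<gamma> = Max ((\<lambda>i. cmod (c i)) ` ?I)"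
    have \<gamma>: "cmod (c j) \<le> \<gamma>" if "j \<in> ?I" for j
      unfolding \<gamma>_def using that by (intro Max_ge) auto
    have \<gamma>0: "\<gamma> \<ge> 0" using \<gamma>[OF i] norm_ge_zero order_trans by blast
    define w where "w j = C * exp (- \<bar>of_int j * h\<bar>)" for j :: int
    have w0: "w j \<ge> 0" for j using C by (simp add: w_def)
    have w_sum: "(\<Sum>j=-int N..<l. h * w j) \<le> 3 * C" if "l \<le> int N + 1" for l
    proof -
      have "(\<Sum>j=-int N..<l. h * w j) \<le> (\<Sum>j\<in>?I. h * w j)"
        by (rule sum_mono2) (use that h w0 in auto)
      also have "\<dots> = C * (\<Sum>j\<in>?I. h * exp (- \<bar>of_int j * h\<bar>))"
        by (simp add: w_def sum_distrib_left mult_ac)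
      also have "\<dots> \<le> C * 3"
        using geometric_node_sum[OF h(1), of N] h1 C by (intro mult_left_mono) auto
      finally show ?thesis by simp
    qed
    \<comment> \<open>The bound for the inner triangular sum is monotone in its upper limit, so
      inside the outer sum up to l it may be replaced by \<open>s l\<close>; the double sum
      collapses to a single one, as Gronwall's inequality needs.\<close>
    define s where "s l = (\<Sum>m=-int N..<l. h * w m * cmod (c m))" for l
    have s_mono: "s l \<le> s l'" if "l \<le> l'" "l' \<le> int N + 1" for l l'
      unfolding s_def by (rule sum_mono2) (use that h w0 in auto)
    have s_le: "s l \<le> 3 * C * \<gamma>" if "l \<le> int N + 1" for l
    proof -
      have "s l \<le> (\<Sum>m=-int N..<l. h * w m * \<gamma>)"
        unfolding s_def by (intro sum_mono mult_left_mono \<gamma>) (use that h w0 in auto)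
      also have "\<dots> = (\<Sum>m=-int N..<l. h * w m) * \<gamma>" by (simp add: sum_distrib_right)
      also have "\<dots> \<le> 3 * C * \<gamma>" using w_sum[OF that] \<gamma>0 by (rule mult_right_mono)
      finally show ?thesis .
    qed
    define y where "y = discrete_inner h N K c"
    have y: "cmod (y j) \<le> s j + C * \<gamma> * (6 * B * sqrt h)" if j: "j \<in> ?I" for j
    proof -
      have Kc: "cmod (K j m * c m) \<le> w m * cmod (c m)" for m
        unfolding norm_mult w_def by (intro mult_right_mono K) auto
      have "cmod (y j) \<le> (\<Sum>m=-int N..<j. h * cmod (K j m * c m)) + C * \<gamma> * (6 * B * sqrt h)"
        unfolding y_def discrete_inner_def
      proof (rule sinc_step_kernel_split[OF h(1) h1 B(2,1) _ j])
        fix m assume m: "m \<in> ?I"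
        have "w m * cmod (c m) \<le> w m * \<gamma>" by (intro mult_left_mono \<gamma> m w0)
        then show "cmod (K j m * c m) \<le> C * \<gamma> * exp (- \<bar>of_int m * h\<bar>)"
          using Kc[of m] by (simp add: w_def mult_ac)
      qed
      also have "(\<Sum>m=-int N..<j. h * cmod (K j m * c m)) \<le> s j"
        unfolding s_def mult.assoc by (intro sum_mono mult_left_mono Kc) (use h in auto)
      finally show ?thesis by simp
    qed
    have y': "cmod (y j) \<le> 9 * B * C * \<gamma>" if j: "j \<in> ?I" for j
    proof -
      have "C * \<gamma> * (6 * B * sqrt h) \<le> C * \<gamma> * (6 * B * 1)"
        using sq C B \<gamma>0 by (intro mult_left_mono) auto
      moreover have "3 * C * \<gamma> * 1 \<le> 3 * C * \<gamma> * B" using B C \<gamma>0 by (intro mult_left_mono) auto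
      ultimately show ?thesis using y[OF j] s_le[of j] j by (simp add: algebra_simps)
    qed
    define x where "x j = A j * c j + D j * y j" for j
    have x: "cmod (x j) \<le> w j * (cmod (c j) + cmod (y j))" for j
      unfolding x_def distrib_left w_def
      by (intro norm_triangle_le add_mono) (simp_all add: norm_mult mult_right_mono A D)
    have main: "cmod (c l) \<le> (\<rho> + E * \<gamma> * sqrt h) + (\<Sum>j=-int N..<l. (1 + 3 * C) * (h * w j) * cmod (c j))"
      if l: "-int N \<le> l" "l \<le> int N" for l
    proof -
      have l': "l \<in> ?I" using l by simp
      have "cmod (discrete_op h N A D K c l) \<le> (\<Sum>j=-int N..<l. h * cmod (x j))
          + C * (1 + 9 * B * C) * \<gamma> * (6 * B * sqrt h)"
        unfolding discrete_op_def y_def[symmetric] x_def[symmetric]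
      proof (rule sinc_step_kernel_split[OF h(1) h1 B(2,1) _ l'])
        fix j assume j: "j \<in> ?I"
        have "w j * (cmod (c j) + cmod (y j)) \<le> w j * (\<gamma> + 9 * B * C * \<gamma>)"
          by (intro mult_left_mono add_mono \<gamma> y' j w0)
        then show "cmod (x j) \<le> C * (1 + 9 * B * C) * \<gamma> * exp (- \<bar>of_int j * h\<bar>)"
          using x[of j] by (simp add: w_def algebra_simps)
      qed
      also have "(\<Sum>j=-int N..<l. h * cmod (x j))
          \<le> (\<Sum>j=-int N..<l. h * w j * cmod (c j) + h * w j * (s l + C * \<gamma> * (6 * B * sqrt h)))"
      proof (rule sum_mono)
        fix j assume j: "j \<in> {-int N..<l}"
        have "cmod (x j) \<le> w j * (cmod (c j) + (s l + C * \<gamma> * (6 * B * sqrt h)))"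
        proof (rule order_trans[OF x], intro mult_left_mono add_left_mono w0)
          show "cmod (y j) \<le> s l + C * \<gamma> * (6 * B * sqrt h)"
            using y[of j] s_mono[of j l] j l by simp
        qed
        then have "h * cmod (x j) \<le> h * (w j * (cmod (c j) + (s l + C * \<gamma> * (6 * B * sqrt h))))"
          using h by (intro mult_left_mono) auto
        then show "h * cmod (x j) \<le> h * w j * cmod (c j) + h * w j * (s l + C * \<gamma> * (6 * B * sqrt h))"
          by (simp only: distrib_left mult.assoc)
      qed
      also have "\<dots> = s l + (\<Sum>j=-int N..<l. h * w j) * (s l + C * \<gamma> * (6 * B * sqrt h))"
        by (simp only: sum.distrib s_def sum_distrib_right)
      also have "\<dots> \<le> s l + 3 * C * (s l + C * \<gamma> * (6 * B * sqrt h))"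
      proof (intro add_left_mono mult_right_mono w_sum add_nonneg_nonneg)
        show "0 \<le> s l" unfolding s_def using h w0 by (intro sum_nonneg) auto
        show "0 \<le> C * \<gamma> * (6 * B * sqrt h)" using C \<gamma>0 B sq by simp
      qed (use l in auto)
      finally have "cmod (discrete_op h N A D K c l) \<le> (1 + 3 * C) * s l + E * \<gamma> * sqrt h"
        by (simp add: E_def algebra_simps)
      moreover have "cmod (c l) \<le> \<rho> + cmod (discrete_op h N A D K c l)"
        using c[OF l'] norm_triangle_sub[of "c l" "discrete_op h N A D K c l"] by linarith
      moreover have "(1 + 3 * C) * s l = (\<Sum>j=-int N..<l. (1 + 3 * C) * (h * w j) * cmod (c j))"
        by (simp add: s_def sum_distrib_left mult.assoc)
      ultimately show ?thesis by linarith
    qed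
    have gr: "cmod (c l) \<le> (\<rho> + E * \<gamma> * sqrt h) * G" if l: "l \<in> ?I" for l
    proof -
      have r: "0 \<le> \<rho> + E * \<gamma> * sqrt h" using \<rho> E0 \<gamma>0 sq by simp
      have "cmod (c l) \<le> (\<rho> + E * \<gamma> * sqrt h) * exp (\<Sum>j=-int N..<l. (1 + 3 * C) * (h * w j))"
        by (rule discrete_gronwall[where u = "int N" and f = "\<lambda>l. cmod (c l)", OF main])
          (use l r h w0 C in auto)
      also have "(\<Sum>j=-int N..<l. (1 + 3 * C) * (h * w j)) = (1 + 3 * C) * (\<Sum>j=-int N..<l. h * w j)"
        by (simp add: sum_distrib_left)
      also have "(\<rho> + E * \<gamma> * sqrt h) * exp ((1 + 3 * C) * (\<Sum>j=-int N..<l. h * w j)) \<le> (\<rho> + E * \<gamma> * sqrt h) * G"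
      proof (rule mult_left_mono[OF _ r])
        have "(1 + 3 * C) * (\<Sum>j=-int N..<l. h * w j) \<le> (1 + 3 * C) * (3 * C)"
          using C l by (intro mult_left_mono w_sum) auto
        then show "exp ((1 + 3 * C) * (\<Sum>j=-int N..<l. h * w j)) \<le> G" by (simp add: G_def)
      qed
      finally show ?thesis .
    qed
    have "\<gamma> \<le> (\<rho> + E * \<gamma> * sqrt h) * G"
    proof -
      have "\<gamma> \<in> (\<lambda>i. cmod (c i)) ` ?I" unfolding \<gamma>_def using i by (intro Max_in) auto
      then show ?thesis using gr by auto
    qed
    also have "\<dots> = G * \<rho> + G * E * sqrt h * \<gamma>" by (simp add: algebra_simps)
    also have "G * E * sqrt h * \<gamma> \<le> 1 / 2 * \<gamma>"
    proof (intro mult_right_mono \<gamma>0)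
      have "sqrt h \<le> 1 / (2 * (G * E + 1))"
        using h GE by (intro real_le_lsqrt) (auto simp: h0_def)
      then have "G * E * sqrt h \<le> G * E * (1 / (2 * (G * E + 1)))"
        using E0 G0 by (intro mult_left_mono) auto
      also have "\<dots> \<le> 1 / 2" using GE by (simp add: field_simps)
      finally show "G * E * sqrt h \<le> 1 / 2" .
    qed
    finally have "\<gamma> \<le> 2 * G * \<rho>" by simp
    then show "cmod (c i) \<le> 2 * G * \<rho>" using \<gamma>[OF i] by simp
  qed
qed

section \<open>The linear system of the scheme\<close>

lemma bij_betw_idx: "bij_betw (idx N) {0..<2 * N + 1} {-int N..int N}"
  by (rule bij_betw_byWitness[of _ "pos N"]) (auto simp: idx_def pos_def)

lemma sum_idx: "(\<Sum>p=0..<2 * N + 1. f (idx N p)) = (\<Sum>j=-int N..int N. f j)"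
  by (rule sum.reindex_bij_betw[OF bij_betw_idx])

lemma pos_idx [simp]: "pos N (idx N p) = p"
  by (simp add: idx_def pos_def)

lemma pos_less: "j \<in> {-int N..int N} \<Longrightarrow> pos N j < 2 * N + 1"
  and idx_pos: "j \<in> {-int N..int N} \<Longrightarrow> idx N (pos N j) = j"
  by (auto simp: idx_def pos_def)

lemma sinc_mat_carrier: "sinc_mat N \<in> carrier_mat (2 * N + 1) (2 * N + 1)"
  and M_mat_carrier: "M_mat a b \<mu> h N \<in> carrier_mat (2 * N + 1) (2 * N + 1)"
  and D_mat_carrier: "D_mat a b h N \<in> carrier_mat (2 * N + 1) (2 * N + 1)"
  and hadamard_sinc_carrier: "hadamard (sinc_mat N) A \<in> carrier_mat (2 * N + 1) (2 * N + 1)"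
  by (simp_all add: sinc_mat_def M_mat_def D_mat_def hadamard_def)

lemma W_mat_carrier: "W_mat a b \<mu> k h N \<in> carrier_mat (2 * N + 1) (2 * N + 1)"
  unfolding W_mat_def
  by (intro add_carrier_mat smult_carrier_mat mult_carrier_mat[of _ "2 * N + 1" "2 * N + 1" _ "2 * N + 1"]
      sinc_mat_carrier M_mat_carrier D_mat_carrier hadamard_sinc_carrier)

lemma index_mult_square_mat:
  assumes "A \<in> carrier_mat n n" "B \<in> carrier_mat n n" "p < n" "q < n"
  shows "(A * B) $$ (p, q) = (\<Sum>r=0..<n. A $$ (p, r) * B $$ (r, q))"
  using assms by (auto simp: scalar_prod_def intro!: sum.cong)

lemma W_mat_entry:
  assumes "p < 2 * N + 1" "q < 2 * N + 1"
  shows "W_mat a b \<mu> k h N $$ (p, q)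
    = of_real (h * sinc_step (of_int (idx N p - idx N q))) * (\<mu> (tDE a b h (idx N q)) * of_real (dDE a b h (idx N q)))
      + (\<Sum>r=0..<2 * N + 1. of_real (h * sinc_step (of_int (idx N p - idx N r))) * (of_real (dDE a b h (idx N r))
          * (of_real (h * sinc_step (of_int (idx N r - idx N q)))
            * (k (tDE a b h (idx N r)) (tDE a b h (idx N q)) * of_real (dDE a b h (idx N q))))))"
proof -
  let ?n = "2 * N + 1"
  have S: "sinc_mat N $$ (p, q) = of_real (sinc_step (of_int (idx N p - idx N q)))" if "p < ?n" "q < ?n" for p q
    using that by (simp add: sinc_mat_def sinc_step_def)
  have 1: "sinc_mat N * M_mat a b \<mu> h N = Matrix.mat ?n ?n (\<lambda>(p, q). sinc_mat N $$ (p, q) * \<mu> (tDE a b h (idx N q)))"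
    unfolding M_mat_def by (rule mat_diag_mult_right[OF sinc_mat_carrier])
  have 2: "sinc_mat N * D_mat a b h N = Matrix.mat ?n ?n (\<lambda>(p, q). sinc_mat N $$ (p, q) * of_real (dDE a b h (idx N q)))"
    unfolding D_mat_def by (rule mat_diag_mult_right[OF sinc_mat_carrier])
  define H where "H = hadamard (sinc_mat N) (K_mat a b k h N)"
  have H: "H \<in> carrier_mat ?n ?n" unfolding H_def by (rule hadamard_sinc_carrier)
  define SDH where "SDH = sinc_mat N * D_mat a b h N * H"
  have SDH: "SDH \<in> carrier_mat ?n ?n" unfolding SDH_def
    by (rule mult_carrier_mat[OF mult_carrier_mat[OF sinc_mat_carrier D_mat_carrier] H])
  have 3: "SDH * D_mat a b h N = Matrix.mat ?n ?n (\<lambda>(p, q). SDH $$ (p, q) * of_real (dDE a b h (idx N q)))"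
    unfolding D_mat_def by (rule mat_diag_mult_right[OF SDH])
  have 4: "sinc_mat N * M_mat a b \<mu> h N * D_mat a b h N = Matrix.mat ?n ?n
      (\<lambda>(p, q). (sinc_mat N * M_mat a b \<mu> h N) $$ (p, q) * of_real (dDE a b h (idx N q)))"
    unfolding D_mat_def
    by (rule mat_diag_mult_right[OF mult_carrier_mat[OF sinc_mat_carrier M_mat_carrier]])
  have 5: "SDH $$ (p, q) = (\<Sum>r=0..<?n. of_real (sinc_step (of_int (idx N p - idx N r))) * of_real (dDE a b h (idx N r))
      * (of_real (sinc_step (of_int (idx N r - idx N q))) * k (tDE a b h (idx N r)) (tDE a b h (idx N q))))"
    unfolding SDH_def index_mult_square_mat[OF mult_carrier_mat[OF sinc_mat_carrier D_mat_carrier] H assms]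
    by (rule sum.cong) (use assms in \<open>simp_all add: 2 S H_def hadamard_def K_mat_def carrier_matD[OF sinc_mat_carrier]\<close>)
  show ?thesis
    unfolding W_mat_def H_def[symmetric] SDH_def[symmetric] 3 4
    using assms by (simp add: 1 5 S power2_eq_square sum_distrib_left sum_distrib_right mult_ac del: sum.op_ivl_Suc)
qed

text \<open>Interchanging the two summations turns the matrix product into the nested operator for
  which stability was proved.\<close>

lemma W_mat_mult_vec:
  assumes v: "v \<in> carrier_vec (2 * N + 1)" and i: "i \<in> {-int N..int N}"
  shows "vec_index (W_mat a b \<mu> k h N *\<^sub>v v) (pos N i)
    = discrete_op h N (\<lambda>j. \<mu> (tDE a b h j) * of_real (dDE a b h j)) (\<lambda>j. of_real (dDE a b h j))
        (\<lambda>j m. k (tDE a b h j) (tDE a b h m) * of_real (dDE a b h m)) (\<lambda>j. vec_index v (pos N j)) i"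
proof -
  let ?n = "2 * N + 1"
  let ?S = "\<lambda>i j. complex_of_real (h * sinc_step (of_int (i - j)))"
  let ?D = "\<lambda>j. complex_of_real (dDE a b h j)"
  let ?A = "\<lambda>j. \<mu> (tDE a b h j) * ?D j"
  let ?K = "\<lambda>j m. k (tDE a b h j) (tDE a b h m) * ?D m"
  let ?c = "\<lambda>j. vec_index v (pos N j)"
  have "vec_index (W_mat a b \<mu> k h N *\<^sub>v v) (pos N i)
      = (\<Sum>q=0..<?n. W_mat a b \<mu> k h N $$ (pos N i, q) * vec_index v q)"
    using pos_less[OF i] v carrier_matD[OF W_mat_carrier[of a b \<mu> k h N]]
    by (simp add: scalar_prod_def)
  also have "\<dots> = (\<Sum>q=0..<?n. ?S i (idx N q) * (?A (idx N q) * ?c (idx N q))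
      + (\<Sum>r=0..<?n. ?S i (idx N r) * (?D (idx N r) * (?S (idx N r) (idx N q) * (?K (idx N r) (idx N q) * ?c (idx N q))))))"
  proof (rule sum.cong[OF refl])
    fix q assume "q \<in> {0..<?n}"
    then have q: "q < ?n" by simp
    show "W_mat a b \<mu> k h N $$ (pos N i, q) * vec_index v q
        = ?S i (idx N q) * (?A (idx N q) * ?c (idx N q))
          + (\<Sum>r=0..<?n. ?S i (idx N r) * (?D (idx N r) * (?S (idx N r) (idx N q) * (?K (idx N r) (idx N q) * ?c (idx N q)))))"
      unfolding W_mat_entry[OF pos_less[OF i] q] idx_pos[OF i] pos_idx distrib_right sum_distrib_right
      by (simp only: mult.assoc)
  qed
  also have "\<dots> = (\<Sum>q=0..<?n. ?S i (idx N q) * (?A (idx N q) * ?c (idx N q)))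
      + (\<Sum>r=0..<?n. ?S i (idx N r) * (?D (idx N r) * (\<Sum>q=0..<?n. ?S (idx N r) (idx N q) * (?K (idx N r) (idx N q) * ?c (idx N q)))))"
    unfolding sum.distrib sum_distrib_left by (subst sum.swap) (rule refl)
  also have "\<dots> = (\<Sum>j=-int N..int N. ?S i j * (?A j * ?c j))
      + (\<Sum>r=-int N..int N. ?S i r * (?D r * (\<Sum>m=-int N..int N. ?S r m * (?K r m * ?c m))))"
    using sum_idx[of "\<lambda>j. ?S i j * (?A j * ?c j)" N]
      sum_idx[of "\<lambda>r. ?S i r * (?D r * (\<Sum>m=-int N..int N. ?S r m * (?K r m * ?c m)))" N]
      sum_idx[of "\<lambda>m. ?S j m * (?K j m * ?c m)" N for j]
    by (simp only:)
  also have "\<dots> = discrete_op h N ?A ?D ?K ?c i"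
    unfolding discrete_op_def discrete_inner_def sum.distrib[symmetric] distrib_left ..
  finally show ?thesis .
qed

text \<open>Injectivity is what stability gives directly; a nonzero determinant then yields the
  inverse. The second claim makes the definite description in \<open>u_vec\<close> denote a
  solution.\<close>

lemma inj_kernel_imp_invertible_mat:
  fixes A :: "'a :: field mat"
  assumes A: "A \<in> carrier_mat n n"
    and ker: "\<And>v. v \<in> carrier_vec n \<Longrightarrow> A *\<^sub>v v = 0\<^sub>v n \<Longrightarrow> v = 0\<^sub>v n"
  shows "invertible_mat A"
    and "w \<in> carrier_vec n \<Longrightarrow> \<exists>!v. v \<in> carrier_vec n \<and> A *\<^sub>v v = w"
proof -
  have "Determinant.det A \<noteq> 0"
    using det_0_iff_vec_prod_zero[OF A] ker by blast
  then have "A \<in> Units (ring_mat TYPE('a) n ())" by (rule det_non_zero_imp_unit[OF A])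
  then obtain B where B: "B \<in> carrier_mat n n" "B * A = 1\<^sub>m n" "A * B = 1\<^sub>m n"
    by (auto simp: Units_def ring_mat_def)
  then show "invertible_mat A"
    using A unfolding invertible_mat_def inverts_mat_def square_mat.simps by auto
  assume w: "w \<in> carrier_vec n"
  show "\<exists>!v. v \<in> carrier_vec n \<and> A *\<^sub>v v = w"
  proof (rule ex1I[of _ "B *\<^sub>v w"])
    show "B *\<^sub>v w \<in> carrier_vec n \<and> A *\<^sub>v (B *\<^sub>v w) = w"
      using B A w by (simp flip: assoc_mult_mat_vec)
    fix v assume "v \<in> carrier_vec n \<and> A *\<^sub>v v = w"
    then have v: "v \<in> carrier_vec n" "A *\<^sub>v v = w" by auto
    have "B *\<^sub>v (A *\<^sub>v v) = 1\<^sub>m n *\<^sub>v v"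
      using assoc_mult_mat_vec[OF B(1) A v(1)] B(2) by simp
    then show "v = B *\<^sub>v w" using v by simp
  qed
qed

lemma dDE_eq: "a < b \<Longrightarrow> dDE a b h j = dpsi a b (of_int j * h)"
  unfolding dDE_def by (rule DERIV_imp_deriv[OF psiDE_real_has_derivative])

lemma wDE_psiDE:
  assumes "a < b"
  shows "wDE a b h j (psiDE a b x) = dpsi a b (of_int j * h) * J j h x"
  using range_psiDE(1,3)[OF assms] by (simp add: wDE_def wDE_open_def dDE_eq[OF assms])

lemma inv_psiDE_tends:
  assumes "a < b"
  shows "filterlim (inv_into UNIV (psiDE a b)) at_bot (at a within {a<..<b})"
    and "filterlim (inv_into UNIV (psiDE a b)) at_top (at b within {a<..<b})"
proof -
  let ?p = "psiDE a b :: real \<Rightarrow> real"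
  let ?q = "inv_into UNIV ?p"
  have q: "?q (?p x) = x" for x using range_psiDE(3)[OF assms] by simp
  note less = psiDE_strict_mono[OF assms]
  have ran: "?p x \<in> {a<..<b}" for x by (rule range_psiDE(1)[OF assms])
  show "filterlim ?q at_bot (at a within {a<..<b})"
    unfolding filterlim_at_bot
  proof
    fix Z
    show "\<forall>\<^sub>F t in at a within {a<..<b}. ?q t \<le> Z"
      unfolding eventually_at
    proof (intro exI[of _ "?p Z - a"] conjI ballI impI)
      show "0 < ?p Z - a" using ran[of Z] by simp
      fix t assume t: "t \<in> {a<..<b}" "t \<noteq> a \<and> dist t a < ?p Z - a"
      then obtain z where z: "t = ?p z" using range_psiDE(2)[OF assms] by blast
      have "?p z < ?p Z" using t z by (auto simp: dist_real_def)
      then have "z < Z" using less[of Z z] by (cases z Z rule: linorder_cases) auto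
      then show "?q t \<le> Z" by (simp add: z q)
    qed
  qed
  show "filterlim ?q at_top (at b within {a<..<b})"
    unfolding filterlim_at_top
  proof
    fix Z
    show "\<forall>\<^sub>F t in at b within {a<..<b}. Z \<le> ?q t"
      unfolding eventually_at
    proof (intro exI[of _ "b - ?p Z"] conjI ballI impI)
      show "0 < b - ?p Z" using ran[of Z] by simp
      fix t assume t: "t \<in> {a<..<b}" "t \<noteq> b \<and> dist t b < b - ?p Z"
      then obtain z where z: "t = ?p z" using range_psiDE(2)[OF assms] by blast
      have "?p Z < ?p z" using t z by (auto simp: dist_real_def)
      then have "Z < z" using less[of z Z] by (cases z Z rule: linorder_cases) auto
      then show "Z \<le> ?q t" by (simp add: z q)
    qed
  qed
qed

lemma J_at_top:
  assumes "h > 0"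
  shows "(J j h \<longlongrightarrow> h) at_top"
proof -
  have "filterlim (\<lambda>\<xi>. \<xi> / h - of_int j) at_top at_top"
    using assms by real_asymp
  then have "((\<lambda>\<xi>. h * sinc_step (\<xi> / h - of_int j)) \<longlongrightarrow> h * 1) at_top"
    by (intro tendsto_intros filterlim_compose[OF sinc_step_at_top])
  then show ?thesis unfolding J_eq_sinc_step[abs_def] by simp
qed

text \<open>The value at an end point is defined by \<open>Lim\<close>, which becomes usable only
  once convergence is known. In the parameter the end points a and b are minus and plus infinity,
  where \<open>J\<close> tends to 0 and to h.\<close>

lemma wDE_tendsto_end:
  assumes ab: "a < b" and h: "h > 0" and t0: "t0 = a \<or> t0 = b"
  shows "(wDE a b h j \<longlongrightarrow> wDE a b h j t0) (at t0 within {a<..<b})"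
proof -
  have nb: "at t0 within {a<..<b} \<noteq> bot"
    using ab t0 by (auto simp: at_within_eq_bot_iff islimpt_greaterThanLessThan1 islimpt_greaterThanLessThan2
        simp flip: trivial_limit_within)
  have "\<exists>L. (wDE_open a b h j \<longlongrightarrow> L) (at t0 within {a<..<b})"
    using t0
  proof
    assume t0: "t0 = a"
    have "((\<lambda>t. dDE a b h j * J j h (inv_into UNIV (psiDE a b) t)) \<longlongrightarrow> dDE a b h j * 0) (at a within {a<..<b})"
      by (rule tendsto_mult_left[OF filterlim_compose[OF J_at_bot[OF h] inv_psiDE_tends(1)[OF ab]]])
    then show ?thesis unfolding wDE_open_def[abs_def] t0 by blast
  next
    assume t0: "t0 = b"
    have "((\<lambda>t. dDE a b h j * J j h (inv_into UNIV (psiDE a b) t)) \<longlongrightarrow> dDE a b h j * h) (at b within {a<..<b})"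
      by (rule tendsto_mult_left[OF filterlim_compose[OF J_at_top[OF h] inv_psiDE_tends(2)[OF ab]]])
    then show ?thesis unfolding wDE_open_def[abs_def] t0 by blast
  qed
  then obtain L where L: "(wDE_open a b h j \<longlongrightarrow> L) (at t0 within {a<..<b})" by blast
  have "wDE a b h j t0 = L"
    using tendsto_Lim[OF nb L] t0 by (auto simp: wDE_def)
  moreover have "\<forall>\<^sub>F t in at t0 within {a<..<b}. wDE_open a b h j t = wDE a b h j t"
    by (auto simp: eventually_at_filter wDE_def)
  ultimately show ?thesis using Lim_transform_eventually[OF L] by simp
qed

section \<open>Convergence\<close>

lemma de_weight_antimono: "s \<le> s' \<Longrightarrow> de_weight s' x \<le> de_weight s x"
  unfolding de_weight_def by (intro mult_left_mono) (auto simp: mult_right_mono)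

lemma de_weight_nonneg: "0 \<le> de_weight s x"
  by (simp add: de_weight_def)

lemma de_maj_mono:
  assumes "de_maj d s C f" "C \<le> C'" "s' \<le> s" "0 \<le> C'"
  shows "de_maj d s' C' f"
  unfolding de_maj_def strip_maj_def
proof (intro conjI ballI allI)
  have f: "f holomorphic_on strip d" "\<And>z. z \<in> strip d \<Longrightarrow> cmod (f z) \<le> C / (1 + (Re z)\<^sup>2)"
      "\<And>x. cmod (f (of_real x)) \<le> C * de_weight s x"
    using assms(1) by (auto simp: de_maj_def strip_maj_def)
  show "f holomorphic_on strip d" by (rule f(1))
  show "cmod (f z) \<le> C' / (1 + (Re z)\<^sup>2)" if "z \<in> strip d" for z
    by (rule order_trans[OF f(2)[OF that]]) (use assms in \<open>auto intro!: divide_right_mono simp: add_nonneg_nonneg\<close>)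
  show "cmod (f (of_real x)) \<le> C' * de_weight s' x" for x
    by (rule order_trans[OF f(3)]) (intro mult_mono assms de_weight_antimono de_weight_nonneg)
qed

lemma de_maj_add: "de_maj d s C f \<Longrightarrow> de_maj d s C' g \<Longrightarrow> de_maj d s (C + C') (\<lambda>z. f z + g z)"
  unfolding de_maj_def distrib_right by (auto intro!: strip_maj_add norm_triangle_le add_mono)

lemma de_maj_mult:
  assumes "de_maj d s C f" "g holomorphic_on strip d" "\<And>z. z \<in> strip d \<Longrightarrow> cmod (g z) \<le> B" "d > 0"
  shows "de_maj d s (C * B) (\<lambda>z. f z * g z)"
  unfolding de_maj_def
proof (intro conjI allI)
  have f: "strip_maj d C f" "\<And>x. cmod (f (of_real x)) \<le> C * de_weight s x"
    using assms(1) by (auto simp: de_maj_def)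
  show "strip_maj d (C * B) (\<lambda>z. f z * g z)" by (rule strip_maj_mult[OF f(1) assms(2,3)])
  fix x
  have "0 \<le> C" using strip_maj_nonneg[OF f(1), of 0] assms by (simp add: strip_def)
  then have "cmod (f (of_real x)) * cmod (g (of_real x)) \<le> C * de_weight s x * B"
    using assms(4) by (intro mult_mono f assms mult_nonneg_nonneg de_weight_nonneg) auto
  then show "cmod (f (of_real x) * g (of_real x)) \<le> C * B * de_weight s x" by (simp add: norm_mult mult_ac)
qed

lemma de_maj_node: "de_maj d s C f \<Longrightarrow> 0 \<le> s \<Longrightarrow> 0 \<le> C \<Longrightarrow> cmod (f (of_real x)) \<le> C * exp (- \<bar>x\<bar>)"
  unfolding de_maj_def by (meson de_weight_le mult_left_mono order_trans)

text \<open>The factor h in the quadrature weights and the decay of \<open>x\<close> bound the sum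
  uniformly in N; the 3 is h + 2 with h <= 1.\<close>

lemma node_sum_bound:
  assumes h: "0 < h" "h \<le> 1" and s: "\<And>j. \<bar>s j\<bar> \<le> h * B" and "0 \<le> B" "0 \<le> X"
    and x: "\<And>j. j \<in> {-int N..int N} \<Longrightarrow> cmod (x j) \<le> X * exp (- \<bar>of_int j * h\<bar>)"
  shows "cmod (\<Sum>j=-int N..int N. of_real (s j) * x j) \<le> 3 * B * X"
proof -
  have "cmod (\<Sum>j=-int N..int N. of_real (s j) * x j) \<le> (\<Sum>j=-int N..int N. B * X * (h * exp (- \<bar>of_int j * h\<bar>)))"
  proof (rule sum_norm_le)
    fix j assume j: "j \<in> {-int N..int N}"
    have "\<bar>s j\<bar> * cmod (x j) \<le> h * B * (X * exp (- \<bar>of_int j * h\<bar>))"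
      using h assms(4) by (intro mult_mono s x j) auto
    then show "cmod (of_real (s j) * x j) \<le> B * X * (h * exp (- \<bar>of_int j * h\<bar>))"
      by (simp add: norm_mult mult_ac)
  qed
  also have "\<dots> = B * X * (\<Sum>j=-int N..int N. h * exp (- \<bar>of_int j * h\<bar>))"
    by (simp add: sum_distrib_left)
  also have "\<dots> \<le> B * X * 3"
    using geometric_node_sum[OF h(1), of N] h assms by (intro mult_left_mono) auto
  finally show ?thesis by (simp add: mult_ac)
qed

lemma discrete_inner_diff:
  "discrete_inner h N K (\<lambda>j. c j - e j) j = discrete_inner h N K c j - discrete_inner h N K e j"
  by (simp add: discrete_inner_def right_diff_distrib sum_subtractf)

lemma discrete_op_diff:
  "discrete_op h N A D K (\<lambda>j. c j - e j) i = discrete_op h N A D K c i - discrete_op h N A D K e i"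
  unfolding discrete_op_def discrete_inner_diff sum_subtractf[symmetric]
  by (intro sum.cong) (simp_all add: algebra_simps)

lemma J_node: "h > 0 \<Longrightarrow> J m h (of_int j * h) = h * sinc_step (of_int (j - m))"
  by (simp add: J_eq_sinc_step)

text \<open>Consistency and stability give convergence at the nodes, and the Nystroem interpolation
  formula carries the bound over to all \<open>\<xi>\<close>.\<close>

lemma nystroem_error:
  assumes h: "0 < h" "h \<le> 1" and B: "\<And>x. \<bar>sinc_step x\<bar> \<le> B" "1 \<le> B" and C: "0 \<le> C" and Cs: "0 \<le> Cs" and \<eta>: "0 \<le> \<eta>"
    and A: "\<And>j. cmod (A j) \<le> C * exp (- \<bar>of_int j * h\<bar>)"
    and D: "\<And>j. cmod (D j) \<le> C * exp (- \<bar>of_int j * h\<bar>)"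
    and K: "\<And>j m. cmod (K j m) \<le> C * exp (- \<bar>of_int m * h\<bar>)"
    and stab: "\<And>c \<rho> i. (\<And>i. i \<in> {-int N..int N} \<Longrightarrow> cmod (c i - discrete_op h N A D K c i) \<le> \<rho>) \<Longrightarrow>
      i \<in> {-int N..int N} \<Longrightarrow> cmod (c i) \<le> Cs * \<rho>"
    and U: "\<And>\<xi>. cmod (U \<xi> - (ua + (\<Sum>j=-int N..int N. (P j + A j * U (of_int j * h) + D j * Y j) * of_real (J j h \<xi>)))) \<le> \<eta>"
    and Y: "\<And>j. cmod (Y j - discrete_inner h N K (\<lambda>j. U (of_int j * h)) j) \<le> \<eta>"
    and c: "\<And>i. i \<in> {-int N..int N} \<Longrightarrow>
      c i - discrete_op h N A D K c i = ua + (\<Sum>j=-int N..int N. P j * of_real (J j h (of_int i * h)))"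
  defines "E \<equiv> Cs * (1 + 3 * B * C)"
  shows "cmod (U \<xi> - (ua + (\<Sum>j=-int N..int N. (P j + A j * c j + D j * discrete_inner h N K c j) * of_real (J j h \<xi>))))
    \<le> (1 + 3 * B * (C * E + C * (1 + 3 * B * (C * E)))) * \<eta>"
proof -
  let ?I = "{-int N..int N}"
  define u where "u j = U (of_int j * h)" for j :: int
  define e where "e j = u j - c j" for j
  \<comment> \<open>\<open>R\<close> is the quadrature residual of the outer integral and
    \<open>S\<close> that of the inner one, both taken at the exact solution.\<close>
  define R where "R \<xi> = U \<xi> - (ua + (\<Sum>j\<in>?I. (P j + A j * u j + D j * Y j) * of_real (J j h \<xi>)))" for \<xi>
  define S where "S j = Y j - discrete_inner h N K u j" for j
  have R: "cmod (R \<xi>) \<le> \<eta>" for \<xi> using U by (simp add: R_def u_def)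
  have S: "cmod (S j) \<le> \<eta>" for j using Y by (simp add: S_def u_def[abs_def])
  have J_bd: "\<bar>J j h \<xi>\<bar> \<le> h * B" for j \<xi>
    using B h by (simp add: J_eq_sinc_step abs_mult)
  have J_sum: "cmod (\<Sum>j\<in>?I. of_real (J j h \<xi>) * x j) \<le> 3 * B * X"
    if "0 \<le> X" "\<And>j. j \<in> ?I \<Longrightarrow> cmod (x j) \<le> X * exp (- \<bar>of_int j * h\<bar>)" for X x \<xi>
    by (rule node_sum_bound[OF h, where s = "\<lambda>j. J j h \<xi>"]) (use that J_bd B in auto)
  have E0: "E \<ge> 0" using Cs B C by (simp add: E_def)
  have "cmod (e i) \<le> Cs * ((1 + 3 * B * C) * \<eta>)" if i: "i \<in> ?I" for i
  proof (rule stab[OF _ i])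
    fix i assume i: "i \<in> ?I"
    have "u i = R (of_int i * h) + ua + (\<Sum>j\<in>?I. P j * of_real (J j h (of_int i * h)))
        + (\<Sum>j\<in>?I. of_real (J j h (of_int i * h)) * (A j * u j + D j * Y j))"
      unfolding R_def u_def by (simp add: sum.distrib algebra_simps)
    also have "(\<Sum>j\<in>?I. of_real (J j h (of_int i * h)) * (A j * u j + D j * Y j))
        = discrete_op h N A D K u i + (\<Sum>j\<in>?I. of_real (J j h (of_int i * h)) * (D j * S j))"
      unfolding discrete_op_def S_def J_node[OF h(1)] sum.distrib[symmetric]
      by (intro sum.cong) (simp_all add: algebra_simps)
    \<comment> \<open>The nodal error solves the discrete equation with only the residuals as
      right-hand side, so stability applies.\<close>
    finally have "e i - discrete_op h N A D K e i
        = R (of_int i * h) + (\<Sum>j\<in>?I. of_real (J j h (of_int i * h)) * (D j * S j))"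
      using c[OF i] unfolding e_def[abs_def] discrete_op_diff by (simp add: algebra_simps)
    also have "cmod \<dots> \<le> \<eta> + 3 * B * (C * \<eta>)"
    proof (rule order_trans[OF norm_triangle_ineq add_mono[OF R J_sum]])
      show "cmod (D j * S j) \<le> C * \<eta> * exp (- \<bar>of_int j * h\<bar>)" for j
        using mult_mono[OF D S, of j j] C by (simp add: norm_mult mult_ac)
    qed (use B C \<eta> in auto)
    finally show "cmod (e i - discrete_op h N A D K e i) \<le> (1 + 3 * B * C) * \<eta>"
      by (simp add: algebra_simps)
  qed
  then have e: "cmod (e i) \<le> E * \<eta>" if "i \<in> ?I" for i
    using that by (simp add: E_def mult.assoc)
  have inner_e: "cmod (discrete_inner h N K e j) \<le> 3 * B * (C * (E * \<eta>))" for j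
    unfolding discrete_inner_def
  proof (rule node_sum_bound[OF h])
    show "\<bar>h * sinc_step (of_int (j - m))\<bar> \<le> h * B" for m using B(1)[of "of_int (j - m)"] h by (simp add: abs_mult)
    show "cmod (K j m * e m) \<le> C * (E * \<eta>) * exp (- \<bar>of_int m * h\<bar>)" if "m \<in> ?I" for m
      using mult_mono[OF K[of j m] e[OF that]] C by (simp add: norm_mult mult_ac)
  qed (use B C E0 \<eta> in auto)
  \<comment> \<open>When the two interpolation formulas are subtracted, the term with g drops out
    and the nodal error enters only through weighted sums.\<close>
  have "U \<xi> - (ua + (\<Sum>j\<in>?I. (P j + A j * c j + D j * discrete_inner h N K c j) * of_real (J j h \<xi>)))
      = R \<xi> + (\<Sum>j\<in>?I. of_real (J j h \<xi>) * (A j * e j + D j * (S j + discrete_inner h N K e j)))"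
  proof -
    have "(\<Sum>j\<in>?I. of_real (J j h \<xi>) * (A j * e j + D j * (S j + discrete_inner h N K e j)))
        = (\<Sum>j\<in>?I. (P j + A j * u j + D j * Y j) * of_real (J j h \<xi>))
          - (\<Sum>j\<in>?I. (P j + A j * c j + D j * discrete_inner h N K c j) * of_real (J j h \<xi>))"
      unfolding sum_subtractf[symmetric] S_def e_def[abs_def] discrete_inner_diff
      by (intro sum.cong) (simp_all add: algebra_simps)
    then show ?thesis by (simp add: R_def)
  qed
  also have "cmod \<dots> \<le> \<eta> + 3 * B * (C * (E * \<eta>) + C * (\<eta> + 3 * B * (C * (E * \<eta>))))"
  proof (rule order_trans[OF norm_triangle_ineq add_mono[OF R J_sum]])
    show "cmod (A j * e j + D j * (S j + discrete_inner h N K e j))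
        \<le> (C * (E * \<eta>) + C * (\<eta> + 3 * B * (C * (E * \<eta>)))) * exp (- \<bar>of_int j * h\<bar>)" if j: "j \<in> ?I" for j
    proof -
      have "cmod (A j * e j) \<le> C * exp (- \<bar>of_int j * h\<bar>) * (E * \<eta>)"
        unfolding norm_mult by (intro mult_mono A e j) (use C in auto)
      moreover have "cmod (D j * (S j + discrete_inner h N K e j))
          \<le> C * exp (- \<bar>of_int j * h\<bar>) * (\<eta> + 3 * B * (C * (E * \<eta>)))"
        unfolding norm_mult by (intro mult_mono D norm_triangle_le add_mono S inner_e) (use C in auto)
      ultimately have "cmod (A j * e j + D j * (S j + discrete_inner h N K e j))
          \<le> C * exp (- \<bar>of_int j * h\<bar>) * (E * \<eta>) + C * exp (- \<bar>of_int j * h\<bar>) * (\<eta> + 3 * B * (C * (E * \<eta>)))"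
        by (intro norm_triangle_le add_mono)
      then show ?thesis by (simp only: distrib_right mult.assoc mult.commute[of "exp _"])
    qed
  qed (use B C E0 \<eta> in auto)
  also have "\<dots> = (1 + 3 * B * (C * E + C * (1 + 3 * B * (C * E)))) * \<eta>"
    by (simp add: algebra_simps)
  finally show ?thesis .
qed

lemma one_minus_W_mult_vec:
  assumes "v \<in> carrier_vec (2 * N + 1)" "i \<in> {-int N..int N}"
  shows "vec_index ((1\<^sub>m (2 * N + 1) - W_mat a b \<mu> k h N) *\<^sub>v v) (pos N i)
    = vec_index v (pos N i) - discrete_op h N (\<lambda>j. \<mu> (tDE a b h j) * of_real (dDE a b h j))
        (\<lambda>j. of_real (dDE a b h j)) (\<lambda>j m. k (tDE a b h j) (tDE a b h m) * of_real (dDE a b h m))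
        (\<lambda>j. vec_index v (pos N j)) i"
proof -
  have "(1\<^sub>m (2 * N + 1) - W_mat a b \<mu> k h N) *\<^sub>v v = 1\<^sub>m (2 * N + 1) *\<^sub>v v - W_mat a b \<mu> k h N *\<^sub>v v"
    by (rule minus_mult_distrib_mat_vec[OF one_carrier_mat W_mat_carrier assms(1)])
  moreover have "dim_vec (W_mat a b \<mu> k h N *\<^sub>v v) = 2 * N + 1"
    using carrier_matD[OF W_mat_carrier[of a b \<mu> k h N]] by simp
  ultimately show ?thesis
    using assms(1) pos_less[OF assms(2)] by (simp add: W_mat_mult_vec[OF assms])
qed

lemma L_spaceE:
  assumes "f \<in> L_space a b d \<alpha>"
  obtains K where "f \<in> L_const a b d \<alpha> K"
  using assms by (auto simp: L_space_def)

theorem theorem4p2: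
  fixes a b \<alpha> d :: real and ua :: complex
    and g \<mu> u :: "real \<Rightarrow> complex" and k :: "real \<Rightarrow> real \<Rightarrow> complex"
    and gS \<mu>S :: "complex \<Rightarrow> complex" and kS :: "complex \<Rightarrow> complex \<Rightarrow> complex"
  assumes "a < b" and "0 < \<alpha>" and "\<alpha> \<le> 1" and "0 < d" and "d < pi / 2"
    and "represents a b gS g" and "represents a b \<mu>S \<mu>" and "represents2 a b kS k"
    and "(\<lambda>\<zeta>. gS \<zeta> * Q a b (psiDE a b \<zeta>)) \<in> L_space a b d \<alpha>"
    and "(\<lambda>\<zeta>. \<mu>S \<zeta> * Q a b (psiDE a b \<zeta>)) \<in> L_space a b d \<alpha>"
    and "\<exists>K. \<forall>\<zeta>\<in>strip d. (\<lambda>\<omega>. kS \<zeta> \<omega> * Q a b (psiDE a b \<omega>)) \<in> L_const a b d \<alpha> K"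
    and "\<forall>\<omega>\<in>strip d. (\<lambda>\<zeta>. kS \<zeta> \<omega> * Q a b (psiDE a b \<omega>)) \<in> Hinf d"
    and "continuous_on {a..b} \<mu>"
    and "\<forall>t\<in>{a..b}. continuous_on {a..b} (\<lambda>s. k t s * of_real (Q a b s))"
    and "\<forall>s\<in>{a..b}. continuous_on {a..b} (\<lambda>t. k t s * of_real (Q a b s))"
    and "solves_ivp a b ua g \<mu> k u"
  shows "\<exists>N0>0.
    (\<forall>N\<ge>N0. invertible_mat (1\<^sub>m (2 * N + 1) - W_mat a b \<mu> k (hDE d \<alpha> N) N)) \<and>
    (\<exists>C. \<forall>N\<ge>N0. \<forall>t\<in>{a..b}.
       cmod (u t - uDE a b ua g \<mu> k (hDE d \<alpha> N) N t)
         \<le> C * (ln (2 * d * real N / \<alpha>) / real N)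
             * exp (- (pi * d * real N) / ln (2 * d * real N / \<alpha>)))"
proof -
  note ab = assms(1) and \<alpha> = assms(2,3) and d = assms(4,5)
  define P where "P z = gS z * dpsi a b z" for z
  define M where "M z = \<mu>S z * dpsi a b z" for z
  define D :: "complex \<Rightarrow> complex" where "D z = dpsi a b z" for z
  define \<kappa> where "\<kappa> z w = kS z w * dpsi a b w" for z w
  have strip: "of_real x \<in> strip d" for x using d by simp
  have P_real: "P (of_real x) = g (psiDE a b x) * of_real (dpsi a b x)" for x
    using assms(6) by (simp add: P_def represents_def dpsi_complex_of_real)
  have M_real: "M (of_real x) = \<mu> (psiDE a b x) * of_real (dpsi a b x)" for x
    using assms(7) by (simp add: M_def represents_def dpsi_complex_of_real)
  have D_real: "D (of_real x) = of_real (dpsi a b x)" for x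
    by (simp add: D_def dpsi_complex_of_real)
  have \<kappa>_real: "\<kappa> (of_real x) (of_real y) = k (psiDE a b x) (psiDE a b y) * of_real (dpsi a b y)" for x y
    using assms(8) by (simp add: \<kappa>_def represents2_def dpsi_complex_of_real)

  \<comment> \<open>Majorants for the coefficients on the strip\<close>
  obtain c where c: "c > 0"
    "\<And>z. z \<in> strip d \<Longrightarrow> cmod (cosh z) * cmod (Q a b (psiDE a b z)) powr \<alpha> \<le> c / (1 + (Re z)\<^sup>2)"
    "\<And>x. cmod (cosh (of_real x)) * cmod (Q a b (psiDE a b (complex_of_real x))) powr \<alpha>
        \<le> c * de_weight (pi * \<alpha>) x"
    using DE_decay[OF ab \<alpha>(1) d] by metis
  have one: "0 < (1 :: real)" by simp
  \<comment> \<open>For \<open>D\<close> the function multiplying the derivative of the DE map is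
    the constant 1; its product with Q is bounded by |Q|, the case of exponent 1.\<close>
  obtain c1 where c1: "c1 > 0"
    "\<And>z. z \<in> strip d \<Longrightarrow> cmod (cosh z) * cmod (Q a b (psiDE a b z)) powr 1 \<le> c1 / (1 + (Re z)\<^sup>2)"
    "\<And>x. cmod (cosh (of_real x)) * cmod (Q a b (psiDE a b (complex_of_real x))) powr 1
        \<le> c1 * de_weight (pi * 1) x"
    using DE_decay[OF ab one d] by metis
  \<comment> \<open>An admissible constant in \<open>L_const\<close> carries no sign condition,
    hence \<open>max K 0\<close>.\<close>
  have L_maj: "de_maj d (pi * \<alpha>) (pi / (b - a) * max K 0 * c) (\<lambda>z. f z * dpsi a b z)"
    if "(\<lambda>z. f z * Q a b (psiDE a b z)) \<in> L_const a b d \<alpha> K" for f K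
  proof (rule de_maj_times_dpsi[OF ab d _ c])
    show "(\<lambda>z. f z * Q a b (psiDE a b z)) holomorphic_on strip d"
      using that by (auto simp: L_const_def intro: analytic_imp_holomorphic)
    fix z assume "z \<in> strip d"
    then have "cmod (f z * Q a b (psiDE a b z)) \<le> K * cmod (Q a b (psiDE a b z)) powr \<alpha>"
      using that by (auto simp: L_const_def)
    also have "\<dots> \<le> max K 0 * cmod (Q a b (psiDE a b z)) powr \<alpha>"
      by (intro mult_right_mono) auto
    finally show "cmod (f z * Q a b (psiDE a b z)) \<le> \<dots>" .
  qed simp
  have D_maj0: "de_maj d (pi * 1) (pi / (b - a) * 1 * c1) (\<lambda>z. 1 * dpsi a b z)"
  proof (rule de_maj_times_dpsi[OF ab d _ c1])
    have "psiDE a b holomorphic_on strip d"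
      using psiDE_strip_has_derivative[OF ab d(2)] open_strip by (auto simp: holomorphic_on_open)
    then show "(\<lambda>z. 1 * Q a b (psiDE a b z)) holomorphic_on strip d"
      unfolding Q_def by (intro holomorphic_intros)
  qed simp_all
  obtain Kg where Kg: "(\<lambda>\<zeta>. gS \<zeta> * Q a b (psiDE a b \<zeta>)) \<in> L_const a b d \<alpha> Kg"
    using L_spaceE[OF assms(9)] .
  obtain Km where Km: "(\<lambda>\<zeta>. \<mu>S \<zeta> * Q a b (psiDE a b \<zeta>)) \<in> L_const a b d \<alpha> Km"
    using L_spaceE[OF assms(10)] .
  obtain Kk where Kk: "\<And>\<zeta>. \<zeta> \<in> strip d \<Longrightarrow> (\<lambda>\<omega>. kS \<zeta> \<omega> * Q a b (psiDE a b \<omega>)) \<in> L_const a b d \<alpha> Kk"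
    using assms(11) by blast
  define C where "C = pi / (b - a) * max Kg 0 * c + pi / (b - a) * max Km 0 * c
    + pi / (b - a) * max Kk 0 * c + pi / (b - a) * 1 * c1"
  have nn: "0 \<le> pi / (b - a) * max K 0 * c" "0 \<le> pi / (b - a) * 1 * c1" for K
    using ab c(1) c1(1) by auto
  have C: "C \<ge> 0" unfolding C_def using nn by (intro add_nonneg_nonneg)
  have P: "de_maj d (pi * \<alpha>) C P" unfolding P_def[abs_def]
    by (rule de_maj_mono[OF L_maj[OF Kg] _ order_refl C]) (use nn in \<open>simp add: C_def add_nonneg_nonneg\<close>)
  have M: "de_maj d (pi * \<alpha>) C M" unfolding M_def[abs_def]
    by (rule de_maj_mono[OF L_maj[OF Km] _ order_refl C]) (use nn in \<open>simp add: C_def add_nonneg_nonneg\<close>)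
  have \<kappa>: "de_maj d (pi * \<alpha>) C (\<kappa> z)" if "z \<in> strip d" for z unfolding \<kappa>_def[abs_def]
    by (rule de_maj_mono[OF L_maj[OF Kk[OF that]] _ order_refl C]) (use nn in \<open>simp add: C_def add_nonneg_nonneg\<close>)
  \<comment> \<open>The decay rate pi of \<open>D\<close> is at least pi \<alpha> because \<alpha>
    <= 1.\<close>
  have D: "de_maj d (pi * \<alpha>) C D" unfolding D_def[abs_def]
    by (rule de_maj_mono[OF D_maj0[unfolded mult_1] _ _ C])
      (use nn \<alpha> in \<open>simp_all add: C_def add_nonneg_nonneg\<close>)
  have \<kappa>_hol: "(\<lambda>z. \<kappa> z w) holomorphic_on strip d" if "w \<in> strip d" for w
  proof -
    have "(\<lambda>z. kS z w * Q a b (psiDE a b w)) holomorphic_on strip d"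
      using assms(12) that by (auto simp: Hinf_def intro: analytic_imp_holomorphic)
    \<comment> \<open>For fixed w, \<open>dpsi a b w\<close> is \<open>Q\<close> at w times a number
      independent of z.\<close>
    then have "(\<lambda>z. kS z w * Q a b (psiDE a b w) * (of_real (pi / (b - a)) * cosh w)) holomorphic_on strip d"
      by (rule holomorphic_on_mult[OF _ holomorphic_on_const])
    moreover have "(\<lambda>z. kS z w * Q a b (psiDE a b w) * (of_real (pi / (b - a)) * cosh w)) = (\<lambda>z. \<kappa> z w)"
      by (simp add: \<kappa>_def dpsi_def mult_ac)
    ultimately show ?thesis by (simp only:)
  qed

  \<comment> \<open>The holomorphic solution, its identification with \<open>u\<close>, and the
    constants\<close>
  interpret V: volterra_strip d C ua P M D \<kappa>
    using P M D \<kappa> \<kappa>_hol d by unfold_locales (auto simp: de_maj_def)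
  obtain U where U: "V.bdd_hol U" and TU: "\<And>z. z \<in> strip d \<Longrightarrow> V.T U z = U z"
    using V.fixed_point by blast
  have u_eq: "u (psiDE a b x) = U (of_real x)" for x
    by (rule V.solution_unique[OF ab U TU _ _ D_real _ assms(16)])
      (simp_all add: P_real M_real \<kappa>_real mult.commute)

  obtain BU where BU: "U holomorphic_on strip d" "\<And>z. z \<in> strip d \<Longrightarrow> cmod (U z) \<le> BU"
    using U by (auto simp: V.bdd_hol_def)
  obtain BY where BY: "V.Y U holomorphic_on strip d" "\<And>z. z \<in> strip d \<Longrightarrow> cmod (V.Y U z) \<le> BY"
    using V.Y_bdd_hol[OF U] by (auto simp: V.bdd_hol_def)
  have BU0: "BU \<ge> 0" and BY0: "BY \<ge> 0"
    using BU(2)[OF strip[of 0]] BY(2)[OF strip[of 0]] norm_ge_zero order_trans by blast+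
  \<comment> \<open>One constant for both functions that are integrated numerically, the outer
    integrand \<open>V.F U\<close> and the inner integrand.\<close>
  define C1 where "C1 = C + C * BU + C * BY"
  have C1: "C1 \<ge> 0" using C BU0 BY0 by (simp add: C1_def)
  have F_maj: "de_maj d (pi * \<alpha>) C1 (V.F U)"
    unfolding C1_def V.F_def[abs_def]
    by (intro de_maj_add de_maj_mult P M D BU BY d)
  have \<kappa>U_maj: "de_maj d (pi * \<alpha>) C1 (\<lambda>w. \<kappa> z w * U w)" if "z \<in> strip d" for z
  proof (rule de_maj_mono[OF de_maj_mult[OF \<kappa>[OF that] BU d(1)] _ order_refl C1])
    show "C * BU \<le> C1" using C mult_nonneg_nonneg[OF C BY0] by (simp add: C1_def)
  qed
  obtain B where B: "B \<ge> 1" "\<And>x. \<bar>sinc_step x\<bar> \<le> B" using sinc_step_bounded by metis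
  obtain h0 Cs where h0: "h0 > 0" "h0 \<le> 1" and Cs: "Cs > 0"
    and stab: "\<And>h N A D K c \<rho> i. 0 < h \<Longrightarrow> h \<le> h0 \<Longrightarrow>
      (\<And>j. cmod (A j) \<le> C * exp (- \<bar>of_int j * h\<bar>)) \<Longrightarrow>
      (\<And>j. cmod (D j) \<le> C * exp (- \<bar>of_int j * h\<bar>)) \<Longrightarrow>
      (\<And>j m. cmod (K j m) \<le> C * exp (- \<bar>of_int m * h\<bar>)) \<Longrightarrow>
      (\<And>i. i \<in> {-int N..int N} \<Longrightarrow> cmod (c i - discrete_op h N A D K c i) \<le> \<rho>) \<Longrightarrow>
      i \<in> {-int N..int N} \<Longrightarrow> cmod (c i) \<le> Cs * \<rho>"
    using discrete_stability[OF C] by metis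
  \<comment> \<open>The bound h <= h0 is for stability, h <= pi d for the exponential bound of the
    contour error.\<close>
  have "0 < min h0 (pi * d)" using h0 d by simp
  from DE_mesh_eventually[OF \<alpha>(1) d(1) this] obtain N1 where
    N1: "\<And>N. N \<ge> N1 \<Longrightarrow> 0 < hDE d \<alpha> N \<and> hDE d \<alpha> N \<le> min h0 (pi * d) \<and>
      exp (- (pi * \<alpha>) / 4 * exp (of_nat N * hDE d \<alpha> N)) \<le> hDE d \<alpha> N * exp (- (pi * d / hDE d \<alpha> N))"
    unfolding eventually_sequentially by blast
  define Cq where "Cq = C1 * (4 * (2 + pi) / (pi * d) + 6 * B)"
  have Cq: "Cq \<ge> 0" using C1 d B by (simp add: Cq_def)
  define E where "E = Cs * (1 + 3 * B * C)"
  define C2 where "C2 = (1 + 3 * B * (C * E + C * (1 + 3 * B * (C * E)))) * Cq"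

  \<comment> \<open>Invertibility and error bound for one N\<close>
  have main: "invertible_mat (1\<^sub>m (2 * N + 1) - W_mat a b \<mu> k (hDE d \<alpha> N) N) \<and>
    (\<forall>t\<in>{a..b}. cmod (u t - uDE a b ua g \<mu> k (hDE d \<alpha> N) N t)
      \<le> C2 * (hDE d \<alpha> N * exp (- (pi * d / hDE d \<alpha> N))))" if N: "N \<ge> N1" for N
  proof -
    define h where "h = hDE d \<alpha> N"
    have h: "0 < h" "h \<le> h0" "h \<le> 1" "h \<le> pi * d"
      and tail: "exp (- (pi * \<alpha>) / 4 * exp (of_nat N * h)) \<le> h * exp (- (pi * d / h))"
      using N1[OF N] h0 by (auto simp: h_def)
    let ?I = "{-int N..int N}"
    let ?n = "2 * N + 1"
    define Ad where "Ad j = \<mu> (tDE a b h j) * complex_of_real (dDE a b h j)" for j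
    define Dd where "Dd j = complex_of_real (dDE a b h j)" for j
    define Kd where "Kd j m = k (tDE a b h j) (tDE a b h m) * complex_of_real (dDE a b h m)" for j m
    define Pd where "Pd j = g (tDE a b h j) * complex_of_real (dDE a b h j)" for j
    have Ad_eq: "Ad j = M (of_real (of_int j * h))" and Dd_eq: "Dd j = D (of_real (of_int j * h))"
      and Pd_eq: "Pd j = P (of_real (of_int j * h))" for j
      by (simp_all only: Ad_def Dd_def Pd_def M_real D_real P_real tDE_def dDE_eq[OF ab])
    have Kd_eq: "Kd j m = \<kappa> (of_real (of_int j * h)) (of_real (of_int m * h))" for j m
      by (simp only: Kd_def \<kappa>_real tDE_def dDE_eq[OF ab])
    have s0: "0 \<le> pi * \<alpha>" using \<alpha> by simp
    have A_bd: "cmod (Ad j) \<le> C * exp (- \<bar>of_int j * h\<bar>)" and D_bd: "cmod (Dd j) \<le> C * exp (- \<bar>of_int j * h\<bar>)" for j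
      unfolding Ad_eq Dd_eq by (rule de_maj_node[OF M s0 C], rule de_maj_node[OF D s0 C])
    have K_bd: "cmod (Kd j m) \<le> C * exp (- \<bar>of_int m * h\<bar>)" for j m
      unfolding Kd_eq by (rule de_maj_node[OF \<kappa>[OF strip] s0 C])
    note st = stab[where A = Ad and D = Dd and K = Kd, OF h(1,2) A_bd D_bd K_bd]
    let ?W = "1\<^sub>m ?n - W_mat a b \<mu> k h N"
    have Wc: "?W \<in> carrier_mat ?n ?n" by (rule minus_carrier_mat[OF W_mat_carrier])
    have W_vec: "vec_index (?W *\<^sub>v v) (pos N i)
        = vec_index v (pos N i) - discrete_op h N Ad Dd Kd (\<lambda>j. vec_index v (pos N j)) i"
      if "v \<in> carrier_vec ?n" "i \<in> ?I" for v i
      unfolding Ad_def[abs_def] Dd_def[abs_def] Kd_def[abs_def] by (rule one_minus_W_mult_vec[OF that])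
    \<comment> \<open>Stability with residual 0 makes the kernel trivial.\<close>
    have ker: "v = 0\<^sub>v ?n" if v: "v \<in> carrier_vec ?n" "?W *\<^sub>v v = 0\<^sub>v ?n" for v
    proof (rule eq_vecI)
      fix p assume "p < dim_vec (0\<^sub>v ?n :: complex Matrix.vec)"
      then have p: "p < ?n" by simp
      have "cmod (vec_index v (pos N (idx N p))) \<le> Cs * 0"
      proof (rule st)
        show "idx N p \<in> ?I" using p by (auto simp: idx_def)
        fix i assume i: "i \<in> ?I"
        show "cmod (vec_index v (pos N i) - discrete_op h N Ad Dd Kd (\<lambda>j. vec_index v (pos N j)) i) \<le> 0"
          using W_vec[OF v(1) i] pos_less[OF i] unfolding v(2) by simp
      qed
      then show "vec_index v p = vec_index (0\<^sub>v ?n) p" using p by simp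
    qed (use v in simp)
    note inv = inj_kernel_imp_invertible_mat[OF Wc ker]
    define v where "v = u_vec a b ua g \<mu> k h N"
    have "\<exists>!v. v \<in> carrier_vec ?n \<and> ?W *\<^sub>v v = g_vec a b ua g h N"
      by (rule inv(2)) (simp_all add: g_vec_def)
    from theI'[OF this] have v: "v \<in> carrier_vec ?n" "?W *\<^sub>v v = g_vec a b ua g h N"
      unfolding v_def u_vec_def by auto
    define cc where "cc j = vec_index v (pos N j)" for j
    have w_psi: "complex_of_real (wDE a b h j (psiDE a b x)) = of_real (dDE a b h j) * of_real (J j h x)" for j x
      by (simp add: wDE_psiDE[OF ab] dDE_eq[OF ab])
    have cc: "cc i - discrete_op h N Ad Dd Kd cc i = ua + (\<Sum>j\<in>?I. Pd j * of_real (J j h (of_int i * h)))"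
      if i: "i \<in> ?I" for i
      using W_vec[OF v(1) i] pos_less[OF i]
      unfolding v(2) cc_def[abs_def] by (simp add: g_vec_def idx_pos[OF i] tDE_def[of a b h i] w_psi Pd_def mult.assoc)
    \<comment> \<open>Both parts of the quadrature error are brought to the common rate h exp(-pi
      d/h): the contour part by \<open>sinc_error_le\<close>, the truncation part by the choice of
      the mesh size.\<close>
    have quad: "cmod (integral {..\<xi>} (\<lambda>x. G (of_real x))
        - (\<Sum>j\<in>?I. G (of_real (of_int j * h)) * of_real (J j h \<xi>))) \<le> Cq * (h * exp (- (pi * d / h)))"
      if G: "de_maj d (pi * \<alpha>) C1 G" for G \<xi>
    proof -
      have "C1 * (sinc_error d h + 6 * B * exp (- (pi * \<alpha>) / 4 * exp (of_nat N * h)))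
          \<le> C1 * (4 * (2 + pi) / (pi * d) * (h * exp (- (pi * d / h))) + 6 * B * (h * exp (- (pi * d / h))))"
        using B by (intro mult_left_mono add_mono sinc_error_le d h tail C1) auto
      also have "\<dots> = Cq * (h * exp (- (pi * d / h)))"
        unfolding Cq_def by (simp only: distrib_right mult.assoc)
      finally show ?thesis
        using sinc_quadrature[OF G d(1) s0 h(1,3) B(2), of \<xi> N] by (rule order_trans[rotated])
    qed
    have F_real: "V.F U (of_real (of_int j * h))
        = Pd j + Ad j * U (of_real (of_int j * h)) + Dd j * V.Y U (of_real (of_int j * h))" for j
      by (simp only: V.F_def Pd_eq Ad_eq Dd_eq)
    have err: "cmod (U (of_real \<xi>) - (ua + (\<Sum>j\<in>?I. (Pd j + Ad j * cc j + Dd j * discrete_inner h N Kd cc j)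
        * of_real (J j h \<xi>)))) \<le> C2 * (h * exp (- (pi * d / h)))" for \<xi>
      unfolding C2_def E_def mult.assoc[of _ Cq]
    proof (rule nystroem_error[where h = h and B = B and C = C and Cs = Cs and N = N and A = Ad and D = Dd
          and K = Kd and P = Pd and c = cc and U = "\<lambda>x. U (of_real x)"
          and Y = "\<lambda>j. V.Y U (of_real (of_int j * h))" and ua = ua,
          OF h(1,3) B(2,1) C _ _ A_bd D_bd K_bd])
      show "cmod (c i) \<le> Cs * \<rho>"
        if "\<And>i. i \<in> ?I \<Longrightarrow> cmod (c i - discrete_op h N Ad Dd Kd c i) \<le> \<rho>" "i \<in> ?I" for c \<rho> i
        by (rule st[OF that])
      show "cc i - discrete_op h N Ad Dd Kd cc i = ua + (\<Sum>j\<in>?I. Pd j * of_real (J j h (of_int i * h)))"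
        if "i \<in> ?I" for i by (rule cc[OF that])
      show "cmod (U (of_real \<xi>) - (ua + (\<Sum>j\<in>?I. (Pd j + Ad j * U (of_real (of_int j * h))
          + Dd j * V.Y U (of_real (of_int j * h))) * of_real (J j h \<xi>)))) \<le> Cq * (h * exp (- (pi * d / h)))" for \<xi>
      proof -
        have "U (of_real \<xi>) = ua + integral {..\<xi>} (\<lambda>x. V.F U (of_real x))"
          using TU[OF strip[of \<xi>]] halfline_real[of d C1 "V.F U" \<xi>] F_maj d
          by (simp add: V.T_def de_maj_def)
        then show ?thesis using quad[OF F_maj, of \<xi>] by (simp only: F_real add_diff_add diff_self add_0_left)
      qed
      show "cmod (V.Y U (of_real (of_int j * h)) - discrete_inner h N Kd (\<lambda>j. U (of_real (of_int j * h))) j)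
          \<le> Cq * (h * exp (- (pi * d / h)))" for j
      proof -
        let ?z = "complex_of_real (of_int j * h)"
        have "strip_maj d C1 (\<lambda>w. \<kappa> ?z w * U w)"
          using \<kappa>U_maj[OF strip[of "of_int j * h"]] unfolding de_maj_def by (rule conjunct1)
        then have "V.Y U ?z = integral {..of_int j * h} (\<lambda>r. \<kappa> ?z (of_real r) * U (of_real r))"
          unfolding V.Y_def
          by (rule halfline_real[OF _ d(1)])
        moreover have "discrete_inner h N Kd (\<lambda>j. U (of_real (of_int j * h))) j
            = (\<Sum>m\<in>?I. \<kappa> ?z (of_real (of_int m * h)) * U (of_real (of_int m * h)) * of_real (J m h (of_int j * h)))"
          unfolding discrete_inner_def Kd_eq J_node[OF h(1)] by (intro sum.cong) (simp_all only: mult_ac)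
        ultimately show ?thesis using quad[OF \<kappa>U_maj[OF strip], of "of_int j * h"] by (simp only:)
      qed
    qed (use Cs Cq h in auto)
    have uDE_eq: "uDE a b ua g \<mu> k h N t = ua + (\<Sum>j\<in>?I. (g (tDE a b h j) + \<mu> (tDE a b h j) * cc j
         + (\<Sum>m\<in>?I. k (tDE a b h j) (tDE a b h m) * cc m * of_real (wDE a b h m (tDE a b h j))))
        * of_real (wDE a b h j t))" for t
      by (simp add: uDE_def Let_def cc_def v_def)
    have inner_eq: "(\<Sum>m\<in>?I. k (tDE a b h j) (tDE a b h m) * cc m * of_real (wDE a b h m (tDE a b h j)))
        = discrete_inner h N Kd cc j" for j
      unfolding discrete_inner_def tDE_def[of a b h j] w_psi J_node[OF h(1)] Kd_def
      by (intro sum.cong) (simp_all only: mult_ac tDE_def)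
    have uDE_psi: "uDE a b ua g \<mu> k h N (psiDE a b x)
        = ua + (\<Sum>j\<in>?I. (Pd j + Ad j * cc j + Dd j * discrete_inner h N Kd cc j) * of_real (J j h x))" for x
      unfolding uDE_eq inner_eq w_psi Pd_def Ad_def Dd_def
      by (simp add: algebra_simps)
    have err_open: "cmod (u t - uDE a b ua g \<mu> k h N t) \<le> C2 * (h * exp (- (pi * d / h)))" if t: "t \<in> {a<..<b}" for t
    proof -
      obtain x where "t = psiDE a b x" using range_psiDE(2)[OF ab t] by blast
      then show ?thesis using err[of x] by (simp add: u_eq uDE_psi)
    qed
    \<comment> \<open>At the end points \<open>u\<close> and the approximation are limits of their
      values inside, so the bound on the open interval carries over.\<close>
    have err_end: "cmod (u t - uDE a b ua g \<mu> k h N t) \<le> C2 * (h * exp (- (pi * d / h)))" if t: "t = a \<or> t = b" for t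
    proof (rule tendsto_upperbound)
      have "continuous_on {a..b} u" using assms(16) by (simp add: solves_ivp_def)
      then have "(u \<longlongrightarrow> u t) (at t within {a..b})"
        using t ab by (auto simp: continuous_on_def)
      then have "(u \<longlongrightarrow> u t) (at t within {a<..<b})"
        by (rule tendsto_within_subset) auto
      moreover have "(uDE a b ua g \<mu> k h N \<longlongrightarrow> uDE a b ua g \<mu> k h N t) (at t within {a<..<b})"
        unfolding uDE_eq by (intro tendsto_intros wDE_tendsto_end[OF ab h(1) t])
      ultimately show "((\<lambda>t. cmod (u t - uDE a b ua g \<mu> k h N t)) \<longlongrightarrow> cmod (u t - uDE a b ua g \<mu> k h N t))
          (at t within {a<..<b})"
        by (intro tendsto_intros)
      show "\<forall>\<^sub>F t in at t within {a<..<b}. cmod (u t - uDE a b ua g \<mu> k h N t) \<le> C2 * (h * exp (- (pi * d / h)))"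
        using err_open by (auto simp: eventually_at_filter)
      show "at t within {a<..<b} \<noteq> bot"
        using ab t by (auto simp: at_within_eq_bot_iff islimpt_greaterThanLessThan1 islimpt_greaterThanLessThan2
            simp flip: trivial_limit_within)
    qed
    have "cmod (u t - uDE a b ua g \<mu> k h N t) \<le> C2 * (h * exp (- (pi * d / h)))" if "t \<in> {a..b}" for t
      using err_open[of t] err_end[of t] that by fastforce
    then show ?thesis using inv(1) by (simp add: h_def)
  qed
  show ?thesis
  proof (intro exI[of _ "max 1 N1"] conjI allI impI exI[of _ C2] ballI)
    fix N assume N: "max 1 N1 \<le> N"
    then show "invertible_mat (1\<^sub>m (2 * N + 1) - W_mat a b \<mu> k (hDE d \<alpha> N) N)" using main by simp
    fix t assume t: "t \<in> {a..b}"
    have "pi * d / hDE d \<alpha> N = pi * d * real N / ln (2 * d * real N / \<alpha>)" by (simp add: hDE_def)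
    then show "cmod (u t - uDE a b ua g \<mu> k (hDE d \<alpha> N) N t)
        \<le> C2 * (ln (2 * d * real N / \<alpha>) / real N) * exp (- (pi * d * real N) / ln (2 * d * real N / \<alpha>))"
      using main[of N] N t by (simp add: hDE_def mult.assoc)
  qed simp
qed

end
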